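(* Let $(V,E,\Psi)$ be a strongly connected planar box-like self-affine GIFS satisfying the rectangular open set condition (ROSC) and such that all $T_e$ ($e\in E$) are diagonal. Let $\{X_v\}_{v\in V}$ be the unique graph-directed self-affine carpet family associated with $(V,E,\Psi)$. Then for all $v\in V$, $$\dim_B X_v=\max\{\gamma_A(0),\gamma_B(0)\}.$$
   Context: Graph: $(V,E)$ is a finite directed graph (loops and multiple edges allowed) in which every vertex is the initial vertex of at least one edge; $i(e),t(e)$ are the initial and terminal vertices of $e\in E$. It is strongly connected if for all $v,v'\in V$ there is a finite word of edges $w_1\cdots w_k$ ($k\ge1$) with $i(w_1)=v$, $t(w_{j-1})=i(w_j)$ for $1<j\le k$, $t(w_k)=v'$. The planar box-like self-affine GIFS $(V,E,\Psi)$ with all $T_e$ diagonal consists of such a graph and maps $\psi_e(\xi)=T_e\xi+t_e$ on $\mathbb R^2$, $t_e\in\mathbb R^2$, $T_e=\begin{pmatrix}\pm a_e&0\\0&\pm b_e\end{pmatrix}$, $0<a_e,b_e<1$. ROSC: for every $v\in V$, the sets $\psi_e((0,1)^2)$ with $i(e)=v$ are pairwise disjoint subsets of $(0,1)^2$. $\{X_v\}_{v\in V}$ is the unique family of non-empty compact sets with $X_v=\bigcup_{e:\,i(e)=v}\psi_e(X_{t(e)})$. $\dim_B$ denotes box dimension (part of the claim is that it exists). Fix any associated positive vector $\mathcal P=(p_e)_{e\in E}$, i.e. $p_e>0$ and $\sum_{e:\,i(e)=v}p_e=1$ for all $v$; let $\{\mu_v\}$ be the unique family of Borel probability measures, $\mu_v$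 supported on $X_v$, with $\mu_v=\sum_{e:\,i(e)=v}p_e\,\mu_{t(e)}\circ\psi_e^{-1}$, and let $\mu_v^x,\mu_v^y$ be the projections of $\mu_v$ to the $x$- and $y$-axis. For a compactly supported Borel probability measure $\nu$, $\tau_\nu(0)$ is the $L^q$-spectrum at $q=0$, that is, the box dimension of $\operatorname{supp}\nu$. In this setting $\tau_{\mu_v^x}(0)$ and $\tau_{\mu_v^y}(0)$ exist and do not depend on $v$ (nor on $\mathcal P$); put $\tau_A(0)=\tau_{\mu_v^x}(0)$ (the box dimension of the projection of $X_v$ to the $x$-axis), $\tau_B(0)=\tau_{\mu_v^y}(0)$ (the box dimension of the projection of $X_v$ to the $y$-axis). For $x,y\in\mathbb R$, $F^{(0)}_{x,y}$ is the $\#E\times\#E$ matrix with $F^{(0)}_{x,y}(e,e')=a_{e'}^x b_{e'}^y$ if $t(e)=i(e')$ and $0$ otherwise; $\rho$ is the spectral radius. $\gamma_A(0),\gamma_B(0)$ are the unique real solutions of $\rho(F^{(0)}_{\tau_A(0),\,\gamma_A(0)-\tau_A(0)})=1$ and $\rho(F^{(0)}_{\gamma_B(0)-\tau_B(0),\,\tau_B(0)})=1$. *)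

theory Defs
  imports
    "Graph_Theory.Arc_Walk"
    "Jordan_Normal_Form.Spectral_Radius"
    "HOL-Probability.Probability"
begin

text \<open>
  The Jordan normal form library also uses \<open>$\<close> for its own vectors; here \<open>$\<close> always means
  the component of a vector in \<open>real^2\<close>. Its matrices occur only in \<open>matrix_F\<close>.
\<close>

no_notation Matrix.vec_index (infixl "$" 100)

section \<open>Graphs\<close>

text \<open>
  A graph is a \<open>pre_digraph\<close>: \<open>tail G e\<close> is the initial and \<open>head G e\<close> the terminal vertex of
  the edge \<open>e\<close>. The predicate \<open>fin_digraph\<close> permits loops and multiple edges.
\<close>

definition gifs_graph :: "('v, 'e) pre_digraph \<Rightarrow> bool" where
  "gifs_graph G \<longleftrightarrow> fin_digraph G \<and> (\<forall>v\<in>verts G. out_arcs G v \<noteq> {})"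

text \<open>Unlike \<open>strongly_connected\<close> of the graph library, only non-empty words are admitted.\<close>

definition strongly_conn :: "('v, 'e) pre_digraph \<Rightarrow> bool" where
  "strongly_conn G \<longleftrightarrow>
     (\<forall>v\<in>verts G. \<forall>v'\<in>verts G. \<exists>w. w \<noteq> [] \<and> pre_digraph.awalk G v w v')"

section \<open>Box-like self-affine GIFSs with diagonal matrices\<close>

text \<open>The moduli of the diagonal entries of \<open>T e\<close> are the numbers \<open>a\<^sub>e\<close> and \<open>b\<^sub>e\<close>.\<close>

definition diagonal_box_like_gifs :: "('v, 'e) pre_digraph \<Rightarrow> ('e \<Rightarrow> real^2^2) \<Rightarrow> bool" where
  "diagonal_box_like_gifs G T \<longleftrightarrow> gifs_graph G \<and>
     (\<forall>e\<in>arcs G. T e $ 1 $ 2 = 0 \<and> T e $ 2 $ 1 = 0 \<and>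
        0 < \<bar>T e $ 1 $ 1\<bar> \<and> \<bar>T e $ 1 $ 1\<bar> < 1 \<and>
        0 < \<bar>T e $ 2 $ 2\<bar> \<and> \<bar>T e $ 2 $ 2\<bar> < 1)"

definition gifs_map :: "('e \<Rightarrow> real^2^2) \<Rightarrow> ('e \<Rightarrow> real^2) \<Rightarrow> 'e \<Rightarrow> real^2 \<Rightarrow> real^2" where
  "gifs_map T t e \<xi> = T e *v \<xi> + t e"

definition open_unit_square :: "(real^2) set" where
  "open_unit_square = {\<xi>. \<forall>i. 0 < \<xi> $ i \<and> \<xi> $ i < 1}"

definition rosc ::
    "('v, 'e) pre_digraph \<Rightarrow> ('e \<Rightarrow> real^2^2) \<Rightarrow> ('e \<Rightarrow> real^2) \<Rightarrow> bool" where
  "rosc G T t \<longleftrightarrow> (\<forall>v\<in>verts G.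
     (\<forall>e\<in>out_arcs G v. gifs_map T t e ` open_unit_square \<subseteq> open_unit_square) \<and>
     disjoint_family_on (\<lambda>e. gifs_map T t e ` open_unit_square) (out_arcs G v))"

definition carpet_family ::
    "('v, 'e) pre_digraph \<Rightarrow> ('e \<Rightarrow> real^2^2) \<Rightarrow> ('e \<Rightarrow> real^2) \<Rightarrow> ('v \<Rightarrow> (real^2) set) \<Rightarrow> bool"
  where
  "carpet_family G T t X \<longleftrightarrow> (\<forall>v\<in>verts G. compact (X v) \<and> X v \<noteq> {} \<and>
     X v = (\<Union>e\<in>out_arcs G v. gifs_map T t e ` X (head G e)))"

definition associated_vector :: "('v, 'e) pre_digraph \<Rightarrow> ('e \<Rightarrow> real) \<Rightarrow> bool" where
  "associated_vector G p \<longleftrightarrow>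
     (\<forall>e\<in>arcs G. p e > 0) \<and> (\<forall>v\<in>verts G. (\<Sum>e\<in>out_arcs G v. p e) = 1)"

definition measure_family ::
    "('v, 'e) pre_digraph \<Rightarrow> ('e \<Rightarrow> real^2^2) \<Rightarrow> ('e \<Rightarrow> real^2) \<Rightarrow> ('v \<Rightarrow> (real^2) set) \<Rightarrow>
     ('e \<Rightarrow> real) \<Rightarrow> ('v \<Rightarrow> (real^2) measure) \<Rightarrow> bool" where
  "measure_family G T t X p \<mu> \<longleftrightarrow> (\<forall>v\<in>verts G.
     prob_space (\<mu> v) \<and> sets (\<mu> v) = sets borel \<and> emeasure (\<mu> v) (- X v) = 0 \<and>
     (\<forall>A\<in>sets borel. measure (\<mu> v) A =
        (\<Sum>e\<in>out_arcs G v. p e * measure (\<mu> (head G e)) (gifs_map T t e -` A))))"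

definition proj_measure :: "2 \<Rightarrow> (real^2) measure \<Rightarrow> real measure" where
  "proj_measure i \<nu> = distr \<nu> borel (\<lambda>\<xi>. \<xi> $ i)"

section \<open>Box dimension\<close>

text \<open>The least number of sets of diameter at most \<open>\<delta>\<close> that cover \<open>S\<close>.\<close>

definition covering_number :: "'a::metric_space set \<Rightarrow> real \<Rightarrow> nat" where
  "covering_number S \<delta> = (LEAST n. \<exists>\<C>. finite \<C> \<and> card \<C> = n \<and> S \<subseteq> \<Union>\<C> \<and>
     (\<forall>U\<in>\<C>. bounded U \<and> diameter U \<le> \<delta>))"

definition has_box_dimension :: "'a::metric_space set \<Rightarrow> real \<Rightarrow> bool" where
  "has_box_dimension S d \<longleftrightarrow>
     ((\<lambda>\<delta>. ln (real (covering_number S \<delta>)) / (- ln \<delta>)) \<longlongrightarrow> d) (at_right 0)"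

definition box_dimension :: "'a::metric_space set \<Rightarrow> real" where
  "box_dimension S = (THE d. has_box_dimension S d)"

definition measure_support :: "'a::topological_space measure \<Rightarrow> 'a set" where
  "measure_support \<nu> = {x. \<forall>U. open U \<and> x \<in> U \<longrightarrow> emeasure \<nu> U > 0}"

text \<open>The value at \<open>q = 0\<close> of the \<open>L\<^sup>q\<close>-spectrum of \<open>\<nu>\<close>.\<close>

definition tau_0 :: "'a::metric_space measure \<Rightarrow> real" where
  "tau_0 \<nu> = box_dimension (measure_support \<nu>)"

section \<open>The matrices and the exponents\<close>

text \<open>
  Rows and columns are indexed by an arbitrary enumeration of the edges; another enumeration
  conjugates the matrix by a permutation matrix, so the spectral radius is unaffected.
  The entries are complex numbers because \<open>spectral_radius\<close> is defined for complex matrices.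
\<close>

definition arc_list :: "('v, 'e) pre_digraph \<Rightarrow> 'e list" where
  "arc_list G = (SOME es. distinct es \<and> set es = arcs G)"

definition matrix_F ::
    "('v, 'e) pre_digraph \<Rightarrow> ('e \<Rightarrow> real^2^2) \<Rightarrow> real \<Rightarrow> real \<Rightarrow> complex Matrix.mat" where
  "matrix_F G T x y = Matrix.mat (card (arcs G)) (card (arcs G)) (\<lambda>(k, l).
     let e = arc_list G ! k; e' = arc_list G ! l in
     if head G e = tail G e'
     then complex_of_real (\<bar>T e' $ 1 $ 1\<bar> powr x * \<bar>T e' $ 2 $ 2\<bar> powr y) else 0)"

definition gamma_A :: "('v, 'e) pre_digraph \<Rightarrow> ('e \<Rightarrow> real^2^2) \<Rightarrow> real \<Rightarrow> real" where
  "gamma_A G T \<tau> = (THE \<gamma>. spectral_radius (matrix_F G T \<tau> (\<gamma> - \<tau>)) = 1)"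

definition gamma_B :: "('v, 'e) pre_digraph \<Rightarrow> ('e \<Rightarrow> real^2^2) \<Rightarrow> real \<Rightarrow> real" where
  "gamma_B G T \<tau> = (THE \<gamma>. spectral_radius (matrix_F G T (\<gamma> - \<tau>) \<tau>) = 1)"

end

theory Submission
  imports Defs
begin

text \<open>
  The theorem comes from counting thin rectangles. Let \<open>\<tau>\<^sub>1\<close> and \<open>\<tau>\<^sub>2\<close> be the box dimensions of the
  projections of the carpets to the two axes. Follow a path of edges until the image of the unit
  square first has a side of length at most \<open>\<delta>\<close>. It is then a rectangle with sides \<open>x\<^sub>1\<close>, \<open>x\<^sub>2\<close>, one of
  them comparable to \<open>\<delta>\<close>, and the copy of a carpet inside it looks, at scale \<open>\<delta>\<close>, like the projection
  of that carpet to the other axis \<open>i\<close>. Covering it takes about \<open>(x\<^sub>i / \<delta>) powr \<tau>\<^sub>i\<close> sets. As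
  \<open>x\<^sub>j\<close> is comparable to \<open>\<delta>\<close>, this number is, up to a constant and for every \<open>s\<close>, equal to
  \<open>\<delta> powr (- s) * x\<^sub>i powr \<tau>\<^sub>i * x\<^sub>j powr (s - \<tau>\<^sub>i)\<close>. The last two factors are multiplicative along
  paths; for \<open>i = 1\<close> and \<open>i = 2\<close> their transfer matrices are those whose spectral radius
  is 1 at the critical exponents \<open>s = \<gamma>\<^sub>A\<close> and \<open>s = \<gamma>\<^sub>B\<close>.

  If such a matrix has spectral radius less than 1, some positive function on the vertices makes
  weight times function non-increasing under subdivision (\<open>vertex_superinvariant\<close>); if it has
  spectral radius at least 1, some nonnegative non-zero function makes it non-decreasing
  (\<open>vertex_subinvariant\<close>). An estimate for the thin rectangles therefore passes to the unit square
  by induction on the number of subdivisions.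

  For the upper bound, let \<open>s\<close> exceed both critical exponents and add the two weights: each thin
  rectangle is controlled by the weight of its own long axis (\<open>covering_number_X_upper\<close>).

  For the lower bound only one weight is at hand, and it must not exceed the true count for
  rectangles that are long in the other direction. This holds if its two exponents are at most
  \<open>\<tau>\<^sub>1\<close> and \<open>\<tau>\<^sub>2\<close>. By the rectangular open set condition the rectangles are disjoint, and each
  takes up a fixed proportion of the area of a neighbourhood of any set of diameter \<open>\<delta>\<close> that it
  meets; so one covering set serves boundedly many of them (\<open>covering_number_X_lower\<close>).

  That the exponents are small enough, i.e. that both critical exponents are at most
  \<open>\<tau>\<^sub>1 + \<tau>\<^sub>2\<close>, is again a consequence of the lower bound. If the weight with exponents
  \<open>(\<tau>\<^sub>1, \<tau>\<^sub>2)\<close> had spectral radius greater than 1, so would the one with slightly larger exponents,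
  and the lower bound would beat the trivial estimate that comes from covering the product of the
  two projections (\<open>rho_axis_dim_le_1\<close>).

  The projections are self-similar, possibly with overlaps. Each of them contains near every point
  and at every scale a copy of each of the others, so covering numbers are supermultiplicative up
  to a change of scale, and box dimensions exist by a version of Fekete's lemma
  (\<open>covering_number_mult_le\<close>, \<open>has_box_dimension_of_supermultiplicative\<close>).

  Spectral radii of nonnegative matrices are accessible through such inequalities: the absolute
  values of an eigenvector form a subinvariant vector, a partial sum of the Neumann series is a
  superinvariant one, and comparing the two yields monotonicity of the spectral radius in the
  entries. Hence the spectral radius is continuous and strictly decreasing in \<open>s\<close>, and the critical
  exponents exist and are unique (\<open>expo_root\<close>).
\<close>

section \<open>Covering numbers\<close>

lemma covering_number_le:
  fixes S :: "'a::metric_space set"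
  assumes "finite \<C>" "S \<subseteq> \<Union>\<C>" "\<And>U. U \<in> \<C> \<Longrightarrow> bounded U \<and> diameter U \<le> \<delta>"
  shows "covering_number S \<delta> \<le> card \<C>"
  unfolding covering_number_def by (rule Least_le) (use assms in blast)

lemma finite_cover_exists:
  fixes S :: "'a::real_normed_vector set"
  assumes "compact S" "\<delta> > 0"
  shows "\<exists>\<C>. finite \<C> \<and> S \<subseteq> \<Union>\<C> \<and> (\<forall>U\<in>\<C>. bounded U \<and> diameter U \<le> \<delta>)"
proof -
  obtain k where k: "finite k" "S \<subseteq> (\<Union>x\<in>k. ball x (\<delta>/2))"
    using assms compact_eq_totally_bounded[of S] half_gt_zero by metis
  have "diameter (ball x (\<delta>/2)) \<le> \<delta>" for x :: 'a
  proof (rule diameter_le)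
    fix y z assume "y \<in> ball x (\<delta>/2)" "z \<in> ball x (\<delta>/2)"
    then show "norm (y - z) \<le> \<delta>"
      by (metis (no_types, opaque_lifting) dist_commute dist_norm dist_triangle_half_r less_eq_real_def mem_ball)
  qed (use assms in auto)
  then show ?thesis
    using k by (intro exI[of _ "(\<lambda>x. ball x (\<delta>/2)) ` k"]) auto
qed

lemma optimal_cover:
  fixes S :: "'a::real_normed_vector set"
  assumes "compact S" "\<delta> > 0"
  obtains \<C> where "finite \<C>" "card \<C> = covering_number S \<delta>" "S \<subseteq> \<Union>\<C>"
    "\<And>U. U \<in> \<C> \<Longrightarrow> bounded U" "\<And>U. U \<in> \<C> \<Longrightarrow> diameter U \<le> \<delta>"
proof -
  have "\<exists>n \<C>. finite \<C> \<and> card \<C> = n \<and> S \<subseteq> \<Union>\<C> \<and> (\<forall>U\<in>\<C>. bounded U \<and> diameter U \<le> \<delta>)"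
    using finite_cover_exists[OF assms] by blast
  from LeastI_ex[OF this] show ?thesis
    using that unfolding covering_number_def by blast
qed

lemma covering_number_mono:
  fixes S S' :: "'a::real_normed_vector set"
  assumes "S \<subseteq> S'" "compact S'" "0 < \<delta>" "\<delta> \<le> \<delta>'"
  shows "covering_number S \<delta>' \<le> covering_number S' \<delta>"
proof -
  obtain \<C> where C: "finite \<C>" "card \<C> = covering_number S' \<delta>" "S' \<subseteq> \<Union>\<C>"
    "\<And>U. U \<in> \<C> \<Longrightarrow> bounded U" "\<And>U. U \<in> \<C> \<Longrightarrow> diameter U \<le> \<delta>"
    using optimal_cover assms by metis
  have "covering_number S \<delta>' \<le> card \<C>"
  proof (rule covering_number_le)
    show "S \<subseteq> \<Union>\<C>" using C(3) assms(1) by simp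
    show "bounded U \<and> diameter U \<le> \<delta>'" if "U \<in> \<C>" for U
      using C(4,5)[OF that] assms(4) by simp
  qed (rule C(1))
  then show ?thesis using C by simp
qed

lemma covering_number_ge_1:
  fixes S :: "'a::real_normed_vector set"
  assumes "compact S" "S \<noteq> {}" "\<delta> > 0"
  shows "1 \<le> covering_number S \<delta>"
proof -
  obtain \<C> where "finite \<C>" "card \<C> = covering_number S \<delta>" "S \<subseteq> \<Union>\<C>"
    using optimal_cover assms by metis
  then show ?thesis using assms(2) by (cases "\<C> = {}") (auto simp: Suc_le_eq card_gt_0_iff)
qed

lemma covering_number_le_1:
  fixes S :: "'a::real_normed_vector set"
  assumes "bounded S" "diameter S \<le> \<delta>"
  shows "covering_number S \<delta> \<le> 1"
  using covering_number_le[of "{S}" S \<delta>] assms by auto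

lemma bounded_diameter_le:
  fixes W :: "'a::real_normed_vector set"
  assumes "\<And>y z. y \<in> W \<Longrightarrow> z \<in> W \<Longrightarrow> dist y z \<le> d" "0 \<le> d"
  shows "bounded W \<and> diameter W \<le> d"
proof
  show "bounded W"
  proof (cases "W = {}")
    case False
    then obtain w where "w \<in> W" by auto
    then have "\<forall>y\<in>W. dist w y \<le> d" using assms(1) by auto
    then show ?thesis unfolding bounded_def by blast
  qed auto
  show "diameter W \<le> d" using assms by (intro diameter_le) (auto simp: dist_norm)
qed

lemma bounded_diameter_image_le:
  fixes f :: "'a::real_normed_vector \<Rightarrow> 'b::real_normed_vector"
  assumes "bounded U" "L \<ge> 0" "\<And>y z. dist (f y) (f z) \<le> L * dist y z"
  shows "bounded (f ` U) \<and> diameter (f ` U) \<le> L * diameter U"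
proof (rule bounded_diameter_le)
  fix a b assume "a \<in> f ` U" "b \<in> f ` U"
  then obtain y z where yz: "y \<in> U" "z \<in> U" "a = f y" "b = f z" by blast
  have "L * dist y z \<le> L * diameter U"
    using diameter_bounded_bound[OF assms(1) yz(1,2)] assms(2) by (rule mult_left_mono)
  then show "dist a b \<le> L * diameter U" using assms(3)[of y z] yz by simp
qed (use assms(2) diameter_ge_0[OF assms(1)] in simp)

lemma covering_number_lipschitz_image:
  fixes f :: "'a::real_normed_vector \<Rightarrow> 'b::real_normed_vector"
  assumes "compact S" "\<delta> > 0" "L \<ge> 0" "\<And>y z. dist (f y) (f z) \<le> L * dist y z" "L * \<delta> \<le> \<delta>'"
  shows "covering_number (f ` S) \<delta>' \<le> covering_number S \<delta>"
proof -
  obtain \<C> where C: "finite \<C>" "card \<C> = covering_number S \<delta>" "S \<subseteq> \<Union>\<C>"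
    "\<And>U. U \<in> \<C> \<Longrightarrow> bounded U" "\<And>U. U \<in> \<C> \<Longrightarrow> diameter U \<le> \<delta>"
    using optimal_cover assms by metis
  have "covering_number (f ` S) \<delta>' \<le> card ((`) f ` \<C>)"
  proof (rule covering_number_le)
    fix V assume "V \<in> (`) f ` \<C>"
    then obtain U where U: "U \<in> \<C>" "V = f ` U" by auto
    have "L * diameter U \<le> \<delta>'" using C(5)[OF U(1)] assms(3,5) mult_left_mono by fastforce
    then show "bounded V \<and> diameter V \<le> \<delta>'"
      using bounded_diameter_image_le[of U L f] C(4)[OF U(1)] assms(3,4) U(2) by auto
  next
    show "f ` S \<subseteq> \<Union>((`) f ` \<C>)" using C(3) by blast
  qed (use C in auto)
  then show ?thesis using C card_image_le[of \<C> "(`) f"] by simp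
qed

lemma covering_number_UN_le:
  fixes S :: "'i \<Rightarrow> 'a::real_normed_vector set"
  assumes "finite I" "\<And>i. i \<in> I \<Longrightarrow> compact (S i)" "\<delta> > 0"
  shows "covering_number (\<Union>i\<in>I. S i) \<delta> \<le> (\<Sum>i\<in>I. covering_number (S i) \<delta>)"
proof -
  have "\<forall>i\<in>I. \<exists>\<C>. finite \<C> \<and> card \<C> = covering_number (S i) \<delta> \<and> S i \<subseteq> \<Union>\<C> \<and>
      (\<forall>U\<in>\<C>. bounded U \<and> diameter U \<le> \<delta>)"
    using optimal_cover assms by metis
  from bchoice[OF this] obtain \<C> where
    C: "\<forall>i\<in>I. finite (\<C> i) \<and> card (\<C> i) = covering_number (S i) \<delta> \<and>
      S i \<subseteq> \<Union>(\<C> i) \<and> (\<forall>U\<in>\<C> i. bounded U \<and> diameter U \<le> \<delta>)" by blast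
  have "covering_number (\<Union>i\<in>I. S i) \<delta> \<le> card (\<Union>i\<in>I. \<C> i)"
  proof (rule covering_number_le)
    show "(\<Union>i\<in>I. S i) \<subseteq> \<Union>(\<Union>i\<in>I. \<C> i)" using C by (force simp: subset_iff)
  qed (use assms(1) C in auto)
  also have "\<dots> \<le> (\<Sum>i\<in>I. card (\<C> i))" using assms(1) by (rule card_UN_le)
  also have "\<dots> = (\<Sum>i\<in>I. covering_number (S i) \<delta>)" using C by (intro sum.cong) auto
  finally show ?thesis .
qed

lemma covering_number_unit_interval:
  assumes "0 < \<delta>" "\<delta> \<le> 1"
  shows "real (covering_number {0..1::real} \<delta>) \<le> 2 * \<delta> powr (- 1)"
proof -
  define n where "n = nat \<lfloor>1 / \<delta>\<rfloor>"
  have n: "real n \<le> 1 / \<delta>" "1 / \<delta> < real n + 1" using assms by (auto simp: n_def of_nat_nat)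
  have "covering_number {0..1::real} \<delta> \<le> card ((\<lambda>k. {real k * \<delta>..real k * \<delta> + \<delta>}) ` {..n})"
  proof (rule covering_number_le)
    show "{0..1} \<subseteq> \<Union>((\<lambda>k. {real k * \<delta>..real k * \<delta> + \<delta>}) ` {..n})"
    proof
      fix z :: real assume z: "z \<in> {0..1}"
      define k where "k = nat \<lfloor>z / \<delta>\<rfloor>"
      have k: "real k \<le> z / \<delta>" "z / \<delta> \<le> real k + 1" using z assms by (auto simp: k_def of_nat_nat)
      have "z / \<delta> \<le> 1 / \<delta>" using z assms by (simp add: divide_right_mono)
      then have "k \<le> n" unfolding k_def n_def by (intro nat_mono floor_mono)
      moreover have "z \<in> {real k * \<delta>..real k * \<delta> + \<delta>}" using k assms by (auto simp: field_simps)
      ultimately show "z \<in> \<Union>((\<lambda>k. {real k * \<delta>..real k * \<delta> + \<delta>}) ` {..n})" by blast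
    qed
  qed (use assms in auto)
  also have "\<dots> \<le> card {..n}" by (rule card_image_le) simp
  finally have "real (covering_number {0..1::real} \<delta>) \<le> real n + 1" by simp
  also have "\<dots> \<le> 1 / \<delta> + 1 / \<delta>" using n(1) assms by (intro add_mono) (auto simp: field_simps)
  also have "\<dots> = 2 * \<delta> powr (- 1)" using assms by (simp add: powr_minus_divide)
  finally show ?thesis .
qed

section \<open>Products of covering numbers\<close>

text \<open>
  A separated set of largest cardinality: half-size balls around its points cover, for otherwise a
  point could be added. Cardinalities are bounded because a set of diameter at most \<open>\<delta>/2\<close> contains
  at most one of its points.
\<close>

lemma maximal_separated_set:
  fixes S :: "'a::real_normed_vector set"
  assumes "compact S" "\<delta> > 0"
  obtains A where "finite A" "A \<subseteq> S" "\<And>y z. y \<in> A \<Longrightarrow> z \<in> A \<Longrightarrow> y \<noteq> z \<Longrightarrow> \<delta> / 2 < dist y z"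
    "covering_number S \<delta> \<le> card A"
proof -
  define Sep where "Sep A \<longleftrightarrow> finite A \<and> A \<subseteq> S \<and> (\<forall>y\<in>A. \<forall>z\<in>A. y \<noteq> z \<longrightarrow> \<delta> / 2 < dist y z)" for A
  obtain \<C> where C: "finite \<C>" "card \<C> = covering_number S (\<delta>/2)" "S \<subseteq> \<Union>\<C>"
    "\<And>U. U \<in> \<C> \<Longrightarrow> bounded U" "\<And>U. U \<in> \<C> \<Longrightarrow> diameter U \<le> \<delta>/2"
    using optimal_cover[OF assms(1), of "\<delta>/2"] assms(2) by auto
  have bound: "card A < Suc (card \<C>)" if A: "Sep A" for A
  proof -
    have "\<forall>y\<in>A. \<exists>U. U \<in> \<C> \<and> y \<in> U" using A C(3) by (force simp: Sep_def)
    from bchoice[OF this] obtain U where U: "\<forall>y\<in>A. U y \<in> \<C> \<and> y \<in> U y" by blast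
    have "inj_on U A"
    proof (rule inj_onI, rule ccontr)
      fix y z assume yz: "y \<in> A" "z \<in> A" "U y = U z" "y \<noteq> z"
      have "dist y z \<le> diameter (U y)"
        using U yz C(4)[of "U y"] by (intro diameter_bounded_bound) auto
      moreover have "\<delta> / 2 < dist y z" using A yz by (simp add: Sep_def)
      ultimately show False using C(5)[of "U y"] U yz(1) by simp
    qed
    moreover have "U ` A \<subseteq> \<C>" using U by blast
    ultimately show ?thesis using card_inj_on_le[of U A \<C>] C(1) by simp
  qed
  have "Sep {}" by (simp add: Sep_def)
  from ex_has_greatest_nat[of Sep, OF this, of card] bound
  obtain A where A: "Sep A" "\<And>B. Sep B \<Longrightarrow> card B \<le> card A" by blast
  have cover: "\<exists>y\<in>A. dist y s \<le> \<delta>/2" if s: "s \<in> S" for s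
  proof (rule ccontr)
    assume n: "\<not> ?thesis"
    then have "s \<notin> A" using assms(2) by force
    moreover have "Sep (insert s A)" using A(1) n s unfolding Sep_def by (auto simp: dist_commute not_le)
    ultimately show False using A(1) A(2)[of "insert s A"] unfolding Sep_def by simp
  qed
  have "covering_number S \<delta> \<le> card ((\<lambda>y. cball y (\<delta>/2)) ` A)"
  proof (rule covering_number_le)
    show "S \<subseteq> \<Union>((\<lambda>y. cball y (\<delta>/2)) ` A)" using cover by auto
    show "bounded U \<and> diameter U \<le> \<delta>" if U: "U \<in> (\<lambda>y. cball y (\<delta>/2)) ` A" for U
    proof -
      obtain y where y: "U = cball y (\<delta>/2)" using U by blast
      have "diameter U \<le> \<delta>"
      proof (rule diameter_le)
        fix a b assume "a \<in> U" "b \<in> U"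
        then have "dist y a \<le> \<delta>/2" "dist y b \<le> \<delta>/2" by (auto simp: y)
        then show "norm (a - b) \<le> \<delta>"
          using dist_triangle3[of a b y] by (simp add: dist_norm)
      qed (use assms in auto)
      then show ?thesis by (simp add: y)
    qed
  qed (use A in \<open>auto simp: Sep_def\<close>)
  then show ?thesis
    using that[of A] A(1) card_image_le[of A "\<lambda>y. cball y (\<delta>/2)"] unfolding Sep_def by fastforce
qed

text \<open>
  If \<open>S\<close> contains near each of its points a not too small copy of \<open>S'\<close>, then the copies near the
  points of a separated set are so far apart that a set of diameter \<open>\<eta>\<close> meets at most one of them.
  The left inverse \<open>g\<close> with its Lipschitz constant measures the size of the copies.
\<close>

lemma covering_number_mult_le:
  fixes S :: "'a::real_normed_vector set" and S' :: "'b::real_normed_vector set"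
  assumes S: "compact S" and pos: "0 < \<delta>" "0 < \<eta>" "\<eta> \<le> \<delta> / 4" "L \<ge> 0" "L * \<eta> \<le> \<epsilon>"
    and pieces: "\<And>s. s \<in> S \<Longrightarrow> \<exists>f g. f ` S' \<subseteq> S \<inter> cball s (\<delta>/8) \<and> compact (f ` S') \<and>
      (\<forall>y. g (f y) = y) \<and> (\<forall>y z. dist (g y) (g z) \<le> L * dist y z)"
  shows "covering_number S \<delta> * covering_number S' \<epsilon> \<le> covering_number S \<eta>"
proof -
  obtain A where A: "finite A" "A \<subseteq> S" "\<And>y z. y \<in> A \<Longrightarrow> z \<in> A \<Longrightarrow> y \<noteq> z \<Longrightarrow> \<delta> / 2 < dist y z"
    "covering_number S \<delta> \<le> card A"
    using maximal_separated_set[OF S pos(1)] by metis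
  obtain \<C> where C: "finite \<C>" "card \<C> = covering_number S \<eta>" "S \<subseteq> \<Union>\<C>"
    "\<And>U. U \<in> \<C> \<Longrightarrow> bounded U" "\<And>U. U \<in> \<C> \<Longrightarrow> diameter U \<le> \<eta>"
    using optimal_cover[OF S pos(2)] by metis
  define \<D> where "\<D> s = {U \<in> \<C>. \<exists>y\<in>U. dist s y \<le> \<delta>/8}" for s
  have ge: "covering_number S' \<epsilon> \<le> card (\<D> s)" if s: "s \<in> A" for s
  proof -
    obtain f g where fg: "f ` S' \<subseteq> S \<inter> cball s (\<delta>/8)" "compact (f ` S')" "\<And>y. g (f y) = y"
      "\<And>y z. dist (g y) (g z) \<le> L * dist y z" using pieces[of s] s A(2) by blast
    have "covering_number (g ` f ` S') \<epsilon> \<le> covering_number (f ` S') \<eta>"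
      using covering_number_lipschitz_image[OF fg(2) pos(2,4) fg(4) pos(5)] .
    also have "g ` f ` S' = S'" using fg(3) by (simp add: image_image)
    also have "covering_number (f ` S') \<eta> \<le> card (\<D> s)"
    proof (rule covering_number_le)
      show "f ` S' \<subseteq> \<Union>(\<D> s)"
      proof
        fix y assume y: "y \<in> f ` S'"
        then obtain U where "U \<in> \<C>" "y \<in> U" using fg(1) C(3) by blast
        moreover have "dist s y \<le> \<delta>/8" using y fg(1) by auto
        ultimately show "y \<in> \<Union>(\<D> s)" by (auto simp: \<D>_def)
      qed
    qed (use C in \<open>auto simp: \<D>_def\<close>)
    finally show ?thesis .
  qed
  have disj: "\<D> s \<inter> \<D> s' = {}" if ss: "s \<in> A" "s' \<in> A" "s \<noteq> s'" for s s'
  proof (rule ccontr)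
    assume "\<not> ?thesis"
    then obtain U y z where U: "U \<in> \<C>" "y \<in> U" "z \<in> U" "dist s y \<le> \<delta>/8" "dist s' z \<le> \<delta>/8"
      by (auto simp: \<D>_def)
    have "dist y z \<le> \<eta>" using diameter_bounded_bound[OF C(4) U(2,3)] C(5) U(1) by force
    moreover have "dist s s' \<le> dist s y + dist y z + dist s' z"
      using dist_triangle[of s s' y] dist_triangle[of y s' z] by (simp add: dist_commute)
    ultimately show False using A(3)[OF ss] U(4,5) pos by linarith
  qed
  have "covering_number S \<delta> * covering_number S' \<epsilon> \<le> card A * covering_number S' \<epsilon>"
    using A(4) by (rule mult_right_mono) simp
  also have "\<dots> = (\<Sum>s\<in>A. covering_number S' \<epsilon>)" by simp
  also have "\<dots> \<le> (\<Sum>s\<in>A. card (\<D> s))" using ge by (intro sum_mono)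
  also have "\<dots> = card (\<Union>s\<in>A. \<D> s)"
    using A(1) C(1) disj by (intro card_UN_disjoint[symmetric]) (auto simp: \<D>_def)
  also have "\<dots> \<le> card \<C>" using C(1) by (intro card_mono) (auto simp: \<D>_def)
  finally show ?thesis using C(2) by simp
qed

section \<open>Box dimension and power laws\<close>

lemma powr_between:
  fixes z :: real
  assumes "0 < l" "l \<le> z" "z \<le> h"
  shows "min (l powr e) (h powr e) \<le> z powr e" "z powr e \<le> max (l powr e) (h powr e)"
proof -
  have "(l powr e \<le> z powr e \<and> z powr e \<le> h powr e) \<or> (h powr e \<le> z powr e \<and> z powr e \<le> l powr e)"
    using assms powr_mono2[of e l z] powr_mono2[of e z h] powr_mono2'[of e l z] powr_mono2'[of e z h]
    by (cases "e \<ge> 0") auto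
  then show "min (l powr e) (h powr e) \<le> z powr e" "z powr e \<le> max (l powr e) (h powr e)" by auto
qed

text \<open>
  The definition of box dimension controls only small \<open>\<delta>\<close>; monotonicity of the covering number
  extends the bounds to any bounded range of scales at the cost of a constant.
\<close>

lemma has_box_dimension_power_bounds:
  fixes S :: "'a::real_normed_vector set"
  assumes S: "compact S" "S \<noteq> {}" and d: "has_box_dimension S d" and "\<epsilon> > 0" "\<Delta> > 0"
  shows "\<exists>K>0. \<forall>\<delta>. 0 < \<delta> \<and> \<delta> \<le> \<Delta> \<longrightarrow> real (covering_number S \<delta>) \<le> K * \<delta> powr (- d - \<epsilon>)" (is ?upper)
    and "\<exists>K>0. \<forall>\<delta>. 0 < \<delta> \<and> \<delta> \<le> \<Delta> \<longrightarrow> K * \<delta> powr (- d + \<epsilon>) \<le> real (covering_number S \<delta>)" (is ?lower)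
proof -
  let ?N = "\<lambda>\<delta>. real (covering_number S \<delta>)"
  have "\<forall>\<^sub>F \<delta> in at_right 0. dist (ln (?N \<delta>) / (- ln \<delta>)) d < \<epsilon>"
    using d \<open>\<epsilon> > 0\<close> unfolding has_box_dimension_def by (rule tendstoD)
  then obtain b where b: "b > 0" "\<And>\<delta>. 0 < \<delta> \<Longrightarrow> \<delta> < b \<Longrightarrow> dist (ln (?N \<delta>) / (- ln \<delta>)) d < \<epsilon>"
    unfolding eventually_at_right_field by blast
  define \<delta>\<^sub>0 where "\<delta>\<^sub>0 = min (b/2) (min \<Delta> (1/2))"
  have \<delta>0: "0 < \<delta>\<^sub>0" "\<delta>\<^sub>0 < b" "\<delta>\<^sub>0 \<le> \<Delta>" "\<delta>\<^sub>0 < 1" using b \<open>\<Delta> > 0\<close> by (auto simp: \<delta>\<^sub>0_def)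
  have N1: "?N \<delta> \<ge> 1" if "\<delta> > 0" for \<delta> using covering_number_ge_1[OF S that] by simp
  have small: "?N \<delta> \<le> \<delta> powr (- d - \<epsilon>) \<and> \<delta> powr (- d + \<epsilon>) \<le> ?N \<delta>" if "0 < \<delta>" "\<delta> \<le> \<delta>\<^sub>0" for \<delta>
  proof -
    have l: "ln \<delta> < 0" using that \<delta>0 by simp
    have "dist (ln (?N \<delta>) / (- ln \<delta>)) d < \<epsilon>" using b that \<delta>0 by auto
    then have "ln (?N \<delta>) / (- ln \<delta>) < d + \<epsilon>" "d - \<epsilon> < ln (?N \<delta>) / (- ln \<delta>)"
      by (auto simp: dist_real_def abs_if split: if_splits)
    then have "ln (?N \<delta>) \<le> ln (\<delta> powr (- d - \<epsilon>))" "ln (\<delta> powr (- d + \<epsilon>)) \<le> ln (?N \<delta>)"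
      using l that by (auto simp: field_simps ln_powr)
    then show ?thesis using that N1[of \<delta>] by (auto simp del: ln_powr simp: ln_le_cancel_iff)
  qed
  have large: "?N \<delta> \<le> ?N \<delta>\<^sub>0" if "\<delta>\<^sub>0 \<le> \<delta>" for \<delta>
    using covering_number_mono[of S S \<delta>\<^sub>0 \<delta>] S \<delta>0 that by auto
  show ?upper
  proof -
    define m where "m = min (\<delta>\<^sub>0 powr (- d - \<epsilon>)) (\<Delta> powr (- d - \<epsilon>))"
    have m: "m > 0" using \<delta>0 \<open>\<Delta> > 0\<close> by (auto simp: m_def)
    define K where "K = max 1 (?N \<delta>\<^sub>0 / m)"
    have "?N \<delta> \<le> K * \<delta> powr (- d - \<epsilon>)" if "0 < \<delta>" "\<delta> \<le> \<Delta>" for \<delta>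
    proof (cases "\<delta> \<le> \<delta>\<^sub>0")
      case True
      have "?N \<delta> \<le> 1 * \<delta> powr (- d - \<epsilon>)" using small that True by auto
      also have "\<dots> \<le> K * \<delta> powr (- d - \<epsilon>)" by (intro mult_right_mono) (auto simp: K_def)
      finally show ?thesis .
    next
      case False
      have "m \<le> \<delta> powr (- d - \<epsilon>)" unfolding m_def using powr_between[of \<delta>\<^sub>0 \<delta> \<Delta>] False that \<delta>0 by auto
      then have "(?N \<delta>\<^sub>0 / m) * m \<le> K * \<delta> powr (- d - \<epsilon>)"
        by (intro mult_mono) (use m in \<open>auto simp: K_def\<close>)
      then show ?thesis using large[of \<delta>] m False by auto
    qed
    moreover have "K > 0" by (auto simp: K_def)
    ultimately show ?thesis by blast
  qed
  show ?lower
  proof -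
    define m where "m = max (\<delta>\<^sub>0 powr (- d + \<epsilon>)) (\<Delta> powr (- d + \<epsilon>))"
    have m: "m > 0" using \<delta>0 by (auto simp: m_def less_max_iff_disj)
    define K where "K = min 1 (1 / m)"
    have "K * \<delta> powr (- d + \<epsilon>) \<le> ?N \<delta>" if "0 < \<delta>" "\<delta> \<le> \<Delta>" for \<delta>
    proof (cases "\<delta> \<le> \<delta>\<^sub>0")
      case True
      have "K * \<delta> powr (- d + \<epsilon>) \<le> 1 * \<delta> powr (- d + \<epsilon>)" by (intro mult_right_mono) (auto simp: K_def)
      also have "\<dots> \<le> ?N \<delta>" using small that True by auto
      finally show ?thesis .
    next
      case False
      have "\<delta> powr (- d + \<epsilon>) \<le> m" unfolding m_def using powr_between[of \<delta>\<^sub>0 \<delta> \<Delta>] False that \<delta>0 by auto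
      then have "K * \<delta> powr (- d + \<epsilon>) \<le> (1 / m) * m"
        by (intro mult_mono) (use m in \<open>auto simp: K_def\<close>)
      then show ?thesis using N1[of \<delta>] that m by auto
    qed
    moreover have "K > 0" using m by (auto simp: K_def)
    ultimately show ?thesis by blast
  qed
qed

lemma tendsto_const_over_neg_ln_at_0: "((\<lambda>\<delta>::real. c / (- ln \<delta>)) \<longlongrightarrow> 0) (at_right 0)"
proof -
  have "filterlim (\<lambda>\<delta>::real. - ln \<delta>) at_top (at_right 0)"
    by (rule filterlim_compose[OF filterlim_uminus_at_top_at_bot ln_at_0])
  then show ?thesis by (intro real_tendsto_divide_at_top[OF tendsto_const])
qed

lemma has_box_dimensionI:
  fixes S :: "'a::real_normed_vector set"
  assumes S: "compact S" "S \<noteq> {}"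
    and upper: "\<And>s. s > d \<Longrightarrow> \<exists>K>0. \<forall>\<^sub>F \<delta> in at_right 0. real (covering_number S \<delta>) \<le> K * \<delta> powr (- s)"
    and lower: "\<And>s. s < d \<Longrightarrow> \<exists>K>0. \<forall>\<^sub>F \<delta> in at_right 0. K * \<delta> powr (- s) \<le> real (covering_number S \<delta>)"
  shows "has_box_dimension S d"
  unfolding has_box_dimension_def
proof (rule order_tendstoI)
  let ?N = "\<lambda>\<delta>. real (covering_number S \<delta>)"
  have unit: "\<forall>\<^sub>F \<delta> in at_right (0::real). 0 < \<delta> \<and> \<delta> < 1"
    unfolding eventually_at_right_field by (intro exI[of _ 1]) auto
  {
    fix a assume a: "a < d"
    define s where "s = (a + d) / 2"
    have s: "a < s" "s < d" using a by (auto simp: s_def)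
    obtain K where K: "K > 0" "\<forall>\<^sub>F \<delta> in at_right 0. K * \<delta> powr (- s) \<le> ?N \<delta>"
      using lower[OF s(2)] by auto
    have "\<forall>\<^sub>F \<delta> in at_right 0. a - s < ln K / (- ln \<delta>)"
      using s by (intro order_tendstoD(1)[OF tendsto_const_over_neg_ln_at_0]) auto
    then show "\<forall>\<^sub>F \<delta> in at_right 0. a < ln (?N \<delta>) / - ln \<delta>"
      using K(2) unit
    proof eventually_elim
      case (elim \<delta>)
      have l: "- ln \<delta> > 0" using elim by simp
      have "0 < K * \<delta> powr (- s)" using K elim by simp
      then have "ln (K * \<delta> powr (- s)) \<le> ln (?N \<delta>)" using elim by (subst ln_le_cancel_iff) auto
      then have "ln K + s * (- ln \<delta>) \<le> ln (?N \<delta>)" using K elim by (simp add: ln_mult ln_powr)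
      then have "(ln K + s * (- ln \<delta>)) / (- ln \<delta>) \<le> ln (?N \<delta>) / (- ln \<delta>)"
        using l by (intro divide_right_mono) auto
      also have "(ln K + s * (- ln \<delta>)) / (- ln \<delta>) = ln K / (- ln \<delta>) + s" using l by (simp add: field_simps)
      finally show ?case using elim by linarith
    qed
  next
    fix a assume a: "d < a"
    define s where "s = (a + d) / 2"
    have s: "s < a" "d < s" using a by (auto simp: s_def)
    obtain K where K: "K > 0" "\<forall>\<^sub>F \<delta> in at_right 0. ?N \<delta> \<le> K * \<delta> powr (- s)"
      using upper[OF s(2)] by auto
    have "\<forall>\<^sub>F \<delta> in at_right 0. ln K / (- ln \<delta>) < a - s"
      using s by (intro order_tendstoD(2)[OF tendsto_const_over_neg_ln_at_0]) auto
    then show "\<forall>\<^sub>F \<delta> in at_right 0. ln (?N \<delta>) / - ln \<delta> < a"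
      using K(2) unit
    proof eventually_elim
      case (elim \<delta>)
      have l: "- ln \<delta> > 0" using elim by simp
      have "0 < ?N \<delta>" using covering_number_ge_1[OF S, of \<delta>] elim by simp
      then have "ln (?N \<delta>) \<le> ln (K * \<delta> powr (- s))" using elim K by (subst ln_le_cancel_iff) auto
      then have "ln (?N \<delta>) \<le> ln K + s * (- ln \<delta>)" using K elim by (simp add: ln_mult ln_powr)
      then have "ln (?N \<delta>) / (- ln \<delta>) \<le> (ln K + s * (- ln \<delta>)) / (- ln \<delta>)"
        using l by (intro divide_right_mono) auto
      also have "(ln K + s * (- ln \<delta>)) / (- ln \<delta>) = ln K / (- ln \<delta>) + s" using l by (simp add: field_simps)
      finally show ?case using elim by linarith
    qed
  }
qed

lemma has_box_dimension_unique:
  assumes "has_box_dimension S d" "has_box_dimension S d'"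
  shows "d = d'"
  using assms unfolding has_box_dimension_def by (rule tendsto_unique[OF trivial_limit_at_right_real])

lemma box_dimension_eq: "has_box_dimension S d \<Longrightarrow> box_dimension S = d"
  unfolding box_dimension_def using has_box_dimension_unique by blast

lemma exponent_le_of_power_le:
  fixes a b :: real
  assumes "K > 0" "\<delta>\<^sub>0 > 0" "\<And>\<delta>. 0 < \<delta> \<Longrightarrow> \<delta> < \<delta>\<^sub>0 \<Longrightarrow> K * \<delta> powr (- a) \<le> C * \<delta> powr (- b)"
  shows "a \<le> b"
proof (rule ccontr)
  assume "\<not> a \<le> b"
  then have ab: "a - b > 0" by simp
  have "((\<lambda>\<delta>::real. C * \<delta> powr (a - b)) \<longlongrightarrow> C * 0) (at_right 0)"
    using ab by (intro tendsto_intros tendsto_zero_powrI[where b = "a - b"] tendsto_ident_at)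
      (auto simp: eventually_at_right_field intro: exI[of _ 1])
  then have "\<forall>\<^sub>F \<delta> in at_right 0. C * \<delta> powr (a - b) < K" using assms(1) by (intro order_tendstoD(2)) auto
  then obtain \<delta>\<^sub>1 where d1: "\<delta>\<^sub>1 > 0" "\<And>\<delta>. 0 < \<delta> \<Longrightarrow> \<delta> < \<delta>\<^sub>1 \<Longrightarrow> C * \<delta> powr (a - b) < K"
    unfolding eventually_at_right_field by auto
  define \<delta> where "\<delta> = min \<delta>\<^sub>0 \<delta>\<^sub>1 / 2"
  have d: "0 < \<delta>" "\<delta> < \<delta>\<^sub>0" "\<delta> < \<delta>\<^sub>1" using assms(2) d1(1) by (auto simp: \<delta>_def)
  have "K * \<delta> powr (- a) * \<delta> powr a \<le> C * \<delta> powr (- b) * \<delta> powr a"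
    using assms(3)[OF d(1,2)] by (intro mult_right_mono) auto
  then have "K \<le> C * \<delta> powr (a - b)" using d(1) by (simp add: powr_diff powr_minus field_simps)
  then show False using d1(2)[OF d(1,3)] by simp
qed

text \<open>
  Fekete's lemma on the half-line, with a loss \<open>\<kappa>\<close> in the argument. The limit is the supremum of
  \<open>f s / (s + \<kappa>)\<close>: along multiples of \<open>t + \<kappa>\<close> the function grows at least as fast as the ratio at \<open>t\<close>
  predicts, and monotonicity fills the gaps.
\<close>

lemma tendsto_of_superadditive_with_delay:
  fixes f :: "real \<Rightarrow> real"
  assumes mono: "\<And>s t. 0 \<le> s \<Longrightarrow> s \<le> t \<Longrightarrow> f s \<le> f t"
    and nonneg: "\<And>s. 0 \<le> s \<Longrightarrow> 0 \<le> f s"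
    and super: "\<And>s t. 0 \<le> s \<Longrightarrow> 0 \<le> t \<Longrightarrow> f s + f t \<le> f (s + t + \<kappa>)"
    and linear: "\<And>s. 0 \<le> s \<Longrightarrow> f s \<le> A + B * s"
    and "\<kappa> > 0"
  shows "\<exists>L. ((\<lambda>s. f s / s) \<longlongrightarrow> L) at_top"
proof -
  define L where "L = (SUP s\<in>{0..}. f s / (s + \<kappa>))"
  have B0: "\<bar>A\<bar> / \<kappa> + \<bar>B\<bar> \<ge> f s / (s + \<kappa>)" if "s \<ge> 0" for s
  proof -
    have "f s \<le> \<bar>A\<bar> + \<bar>B\<bar> * s" using linear[OF that] that
      by (smt (verit) mult_right_mono)
    also have "\<dots> \<le> (\<bar>A\<bar> / \<kappa> + \<bar>B\<bar>) * (s + \<kappa>)" using that \<open>\<kappa> > 0\<close> by (auto simp: field_simps)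
    finally show ?thesis using that \<open>\<kappa> > 0\<close> by (simp add: divide_le_eq)
  qed
  have bdd: "bdd_above ((\<lambda>s. f s / (s + \<kappa>)) ` {0..})"
    using B0 by (intro bdd_aboveI[of _ "\<bar>A\<bar> / \<kappa> + \<bar>B\<bar>"]) auto
  have L_ub: "f s / (s + \<kappa>) \<le> L" if "s \<ge> 0" for s
    unfolding L_def using bdd that by (intro cSUP_upper) auto
  have iter: "real (Suc n) * f t \<le> f (real (Suc n) * t + real n * \<kappa>)" if t: "t \<ge> 0" for n t
  proof (induction n)
    case (Suc n)
    have "real (Suc (Suc n)) * f t = real (Suc n) * f t + f t" by (simp add: algebra_simps)
    also have "\<dots> \<le> f (real (Suc n) * t + real n * \<kappa>) + f t" using Suc by simp
    also have "\<dots> \<le> f ((real (Suc n) * t + real n * \<kappa>) + t + \<kappa>)"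
      using t \<open>\<kappa> > 0\<close> by (intro super) auto
    finally show ?case by (simp add: algebra_simps)
  qed auto
  have iter': "(s / (t + \<kappa>) - 1) * f t \<le> f s" if st: "s \<ge> 0" "t \<ge> 0" for s t
  proof (cases "s / (t + \<kappa>) < 1")
    case True
    then have "(s / (t + \<kappa>) - 1) * f t \<le> 0" using nonneg[OF st(2)] by (intro mult_nonpos_nonneg) auto
    then show ?thesis using nonneg[OF st(1)] by linarith
  next
    case False
    define n where "n = nat \<lfloor>s / (t + \<kappa>)\<rfloor> - 1"
    have "\<lfloor>s / (t + \<kappa>)\<rfloor> \<ge> 1" using False by linarith
    then have n: "real (Suc n) \<le> s / (t + \<kappa>)" "s / (t + \<kappa>) - 1 \<le> real (Suc n)"
      unfolding n_def by linarith+
    have "real (Suc n) * t + real n * \<kappa> \<le> real (Suc n) * (t + \<kappa>)" using \<open>\<kappa> > 0\<close> by (simp add: algebra_simps)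
    also have "\<dots> \<le> s" using n(1) st \<open>\<kappa> > 0\<close> by (simp add: field_simps)
    finally have le: "real (Suc n) * t + real n * \<kappa> \<le> s" .
    have "(s / (t + \<kappa>) - 1) * f t \<le> real (Suc n) * f t" using n(2) nonneg[OF st(2)] by (intro mult_right_mono) auto
    also have "\<dots> \<le> f (real (Suc n) * t + real n * \<kappa>)" by (rule iter[OF st(2)])
    also have "\<dots> \<le> f s" using le st \<open>\<kappa> > 0\<close> by (intro mono) auto
    finally show ?thesis .
  qed
  have "((\<lambda>s. f s / s) \<longlongrightarrow> L) at_top"
  proof (rule order_tendstoI)
    fix a assume "a < L"
    then obtain t where t: "t \<ge> 0" "a < f t / (t + \<kappa>)"
      unfolding L_def using less_cSUP_iff[OF _ bdd] by auto
    have "((\<lambda>s. f t / (t + \<kappa>) - f t / s) \<longlongrightarrow> f t / (t + \<kappa>) - 0) at_top"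
      by (intro tendsto_intros real_tendsto_divide_at_top[OF tendsto_const] filterlim_ident)
    then have "\<forall>\<^sub>F s in at_top. a < f t / (t + \<kappa>) - f t / s"
      using t by (intro order_tendstoD(1)) auto
    then show "\<forall>\<^sub>F s in at_top. a < f s / s"
      using eventually_gt_at_top[of 0]
    proof eventually_elim
      case (elim s)
      have "f t / (t + \<kappa>) - f t / s = ((s / (t + \<kappa>) - 1) * f t) / s" using elim by (simp add: field_simps)
      also have "\<dots> \<le> f s / s" using iter'[of s t] elim t by (intro divide_right_mono) auto
      finally show ?case using elim by simp
    qed
  next
    fix a assume "L < a"
    have "((\<lambda>s. L + L * \<kappa> / s) \<longlongrightarrow> L + 0) at_top"
      by (intro tendsto_intros real_tendsto_divide_at_top[OF tendsto_const] filterlim_ident)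
    then have "\<forall>\<^sub>F s in at_top. L + L * \<kappa> / s < a" using \<open>L < a\<close> by (intro order_tendstoD(2)) auto
    then show "\<forall>\<^sub>F s in at_top. f s / s < a"
      using eventually_gt_at_top[of 0]
    proof eventually_elim
      case (elim s)
      have "f s \<le> L * (s + \<kappa>)" using L_ub[of s] elim \<open>\<kappa> > 0\<close> by (simp add: divide_le_eq)
      then have "f s / s \<le> L + L * \<kappa> / s" using elim by (simp add: field_simps)
      then show ?case using elim by simp
    qed
  qed
  then show ?thesis by blast
qed

text \<open>
  In the logarithmic scale \<open>\<delta> = exp (- s)\<close> supermultiplicativity becomes superadditivity, and the
  factor \<open>c\<close> becomes the delay \<open>- ln c\<close>.
\<close>

lemma has_box_dimension_of_supermultiplicative:
  fixes S :: "'a::real_normed_vector set"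
  assumes S: "compact S" "S \<noteq> {}"
    and c: "0 < c" "c < 1"
    and super: "\<And>\<delta> \<epsilon>. 0 < \<delta> \<Longrightarrow> \<delta> \<le> 1 \<Longrightarrow> 0 < \<epsilon> \<Longrightarrow> \<epsilon> \<le> 1 \<Longrightarrow>
      covering_number S \<delta> * covering_number S \<epsilon> \<le> covering_number S (c * \<delta> * \<epsilon>)"
    and poly: "\<And>\<delta>. 0 < \<delta> \<Longrightarrow> \<delta> \<le> 1 \<Longrightarrow> real (covering_number S \<delta>) \<le> A * \<delta> powr (- B)"
    and "A > 0"
  shows "\<exists>d. has_box_dimension S d"
proof -
  let ?N = "\<lambda>\<delta>. real (covering_number S \<delta>)"
  define f where "f s = ln (?N (exp (- s)))" for s
  have N1: "?N \<delta> \<ge> 1" if "\<delta> > 0" for \<delta> using covering_number_ge_1[OF S that] by simp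
  have "\<exists>L. ((\<lambda>s. f s / s) \<longlongrightarrow> L) at_top"
  proof (rule tendsto_of_superadditive_with_delay)
    fix s t :: real assume st: "0 \<le> s" "0 \<le> t"
    have "?N (exp (- s)) * ?N (exp (- t)) \<le> ?N (c * exp (- s) * exp (- t))"
      using super[of "exp (-s)" "exp (-t)"] st by (simp flip: of_nat_mult)
    also have "c * exp (- s) * exp (- t) = exp (- (s + t + (- ln c)))"
      using c by (simp add: exp_add exp_diff exp_minus field_simps)
    finally have "?N (exp (- s)) * ?N (exp (- t)) \<le> ?N (exp (- (s + t + (- ln c))))" .
    moreover have "0 < ?N (exp (- s)) * ?N (exp (- t))"
      using N1[of "exp (-s)"] N1[of "exp (-t)"] by (intro mult_pos_pos) auto
    ultimately have "ln (?N (exp (- s)) * ?N (exp (- t))) \<le> f (s + t + (- ln c))"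
      unfolding f_def by (subst ln_le_cancel_iff) linarith+
    then show "f s + f t \<le> f (s + t + (- ln c))"
      using N1[of "exp (-s)"] N1[of "exp (-t)"] by (auto simp: f_def ln_mult)
  next
    fix s t :: real assume st: "0 \<le> s" "s \<le> t"
    have "covering_number S (exp (-s)) \<le> covering_number S (exp (-t))"
      using S st by (intro covering_number_mono) auto
    then show "f s \<le> f t" unfolding f_def using N1[of "exp (-s)"] by (subst ln_le_cancel_iff) auto
  next
    fix s :: real assume s: "0 \<le> s"
    show "0 \<le> f s" unfolding f_def using N1[of "exp (-s)"] by simp
    have "?N (exp (-s)) \<le> A * exp (-s) powr (- B)" using poly s by simp
    then have "f s \<le> ln (A * exp (-s) powr (- B))"
      unfolding f_def using N1[of "exp (-s)"] \<open>A > 0\<close> by (subst ln_le_cancel_iff) auto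
    also have "\<dots> = ln A + B * s" using \<open>A > 0\<close> by (simp add: ln_mult ln_powr)
    finally show "f s \<le> ln A + B * s" .
  qed (use c in auto)
  then obtain L where L: "((\<lambda>s. f s / s) \<longlongrightarrow> L) at_top" by auto
  have "filterlim (\<lambda>\<delta>::real. - ln \<delta>) at_top (at_right 0)"
    by (rule filterlim_compose[OF filterlim_uminus_at_top_at_bot ln_at_0])
  from filterlim_compose[OF L this]
  have "((\<lambda>\<delta>. f (- ln \<delta>) / (- ln \<delta>)) \<longlongrightarrow> L) (at_right 0)" .
  moreover have "\<forall>\<^sub>F \<delta> in at_right 0. f (- ln \<delta>) / (- ln \<delta>) = ln (?N \<delta>) / (- ln \<delta>)"
    unfolding eventually_at_right_field f_def by (intro exI[of _ 1]) auto
  ultimately show ?thesis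
    unfolding has_box_dimension_def by (intro exI[of _ L]) (rule Lim_transform_eventually)
qed

section \<open>Uniform constants over finite sets\<close>

lemma finite_uniform_upper:
  fixes Q :: "'a \<Rightarrow> real \<Rightarrow> bool"
  assumes "finite A" "\<And>a. a \<in> A \<Longrightarrow> \<exists>K>0. Q a K" "\<And>a K K'. Q a K \<Longrightarrow> K \<le> K' \<Longrightarrow> Q a K'"
  shows "\<exists>K>0. \<forall>a\<in>A. Q a K"
  using assms(1,2)
proof (induction A rule: finite_induct)
  case empty
  then show ?case by (intro exI[of _ 1]) simp
next
  case (insert a A)
  obtain K where K: "K > 0" "Q a K" using insert.prems[of a] by auto
  obtain K' where K': "K' > 0" "\<forall>a\<in>A. Q a K'" using insert.IH insert.prems by auto
  show ?case
    using K K' assms(3)[OF K(2), of "max K K'"] assms(3)[of _ K' "max K K'"]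
    by (intro exI[of _ "max K K'"]) auto
qed

lemma finite_uniform_lower:
  fixes Q :: "'a \<Rightarrow> real \<Rightarrow> bool"
  assumes "finite A" "\<And>a. a \<in> A \<Longrightarrow> \<exists>K>0. Q a K" "\<And>a K K'. Q a K \<Longrightarrow> 0 < K' \<Longrightarrow> K' \<le> K \<Longrightarrow> Q a K'"
  shows "\<exists>K>0. \<forall>a\<in>A. Q a K"
  using assms(1,2)
proof (induction A rule: finite_induct)
  case empty
  then show ?case by (intro exI[of _ 1]) simp
next
  case (insert a A)
  obtain K where K: "K > 0" "Q a K" using insert.prems[of a] by auto
  obtain K' where K': "K' > 0" "\<forall>a\<in>A. Q a K'" using insert.IH insert.prems by auto
  show ?case
    using K K' assms(3)[OF K(2), of "min K K'"] assms(3)[of _ K' "min K K'"]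
    by (intro exI[of _ "min K K'"]) auto
qed

section \<open>Spectral radius of nonnegative matrices\<close>

abbreviation cmat :: "nat \<Rightarrow> (nat \<Rightarrow> nat \<Rightarrow> real) \<Rightarrow> complex Matrix.mat" where
  "cmat n M \<equiv> Matrix.mat n n (\<lambda>(i, j). complex_of_real (M i j))"

lemma cmat_mult_vec_index:
  assumes "i < n" "z \<in> carrier_vec n"
  shows "Matrix.vec_index (cmat n M *\<^sub>v z) i = (\<Sum>j<n. complex_of_real (M i j) * Matrix.vec_index z j)"
proof -
  have "Matrix.vec_index (cmat n M *\<^sub>v z) i = scalar_prod (Matrix.row (cmat n M) i) z"
    using assms by (intro index_mult_mat_vec) auto
  also have "\<dots> = (\<Sum>j\<in>{0..<n}. complex_of_real (M i j) * Matrix.vec_index z j)"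
    using assms unfolding scalar_prod_def by (intro sum.cong) auto
  finally show ?thesis by (simp add: lessThan_atLeast0)
qed

lemma cmat_power_mult_vec:
  "(cmat n M ^\<^sub>m k) *\<^sub>v Matrix.vec n (\<lambda>i. complex_of_real (f i))
     = Matrix.vec n (\<lambda>i. complex_of_real (((\<lambda>f i. \<Sum>j<n. M i j * f j) ^^ k) f i))"
proof (induction k arbitrary: f)
  case 0
  then show ?case by simp
next
  case (Suc k)
  let ?v = "Matrix.vec n (\<lambda>i. complex_of_real (f i))"
  have "cmat n M *\<^sub>v ?v = Matrix.vec n (\<lambda>i. complex_of_real (\<Sum>j<n. M i j * f j))"
    by (rule eq_vecI) (auto simp: cmat_mult_vec_index simp del: index_mult_mat_vec)
  moreover have "(cmat n M ^\<^sub>m Suc k) *\<^sub>v ?v = (cmat n M ^\<^sub>m k) *\<^sub>v (cmat n M *\<^sub>v ?v)"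
    by simp (rule assoc_mult_mat_vec[of _ n n _ n], auto intro: pow_carrier_mat)
  ultimately show ?case
    by (simp only: Suc[of "\<lambda>i. \<Sum>j<n. M i j * f j"] funpow_Suc_right comp_apply)
qed

lemma spectral_radius_cmat_eigenvector:
  assumes "n > 0"
  obtains z ev where "z \<in> carrier_vec n" "z \<noteq> 0\<^sub>v n" "cmat n M *\<^sub>v z = ev \<cdot>\<^sub>v z"
    "cmod ev = spectral_radius (cmat n M)"
proof -
  have "cmat n M \<in> carrier_mat n n" by simp
  from spectral_radius_mem_max(1)[OF this assms] obtain ev where
    "eigenvalue (cmat n M) ev" "cmod ev = spectral_radius (cmat n M)"
    by (auto simp: spectrum_def)
  then show ?thesis using that unfolding eigenvalue_def eigenvector_def by auto
qed

lemma spectral_radius_nonneg: "n > 0 \<Longrightarrow> 0 \<le> spectral_radius (cmat n M)"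
  by (metis norm_ge_zero spectral_radius_cmat_eigenvector)

text \<open>
  The triangle inequality, applied to the eigenvalue equation of an eigenvalue of largest modulus,
  shows that the moduli of the entries of the eigenvector are subinvariant.
\<close>

lemma spectral_radius_subinvariant:
  assumes n: "n > 0" and M: "\<And>i j. i < n \<Longrightarrow> j < n \<Longrightarrow> 0 \<le> M i j"
  obtains h where "\<And>i. 0 \<le> h i" "\<exists>i<n. 0 < h i"
    "\<And>i. i < n \<Longrightarrow> spectral_radius (cmat n M) * h i \<le> (\<Sum>j<n. M i j * h j)"
proof -
  obtain z ev where z: "z \<in> carrier_vec n" "z \<noteq> 0\<^sub>v n" "cmat n M *\<^sub>v z = ev \<cdot>\<^sub>v z"
    "cmod ev = spectral_radius (cmat n M)" using spectral_radius_cmat_eigenvector[OF n] by metis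
  define h where "h i = cmod (Matrix.vec_index z i)" for i
  have "\<exists>i<n. 0 < h i"
  proof (rule ccontr)
    assume "\<not> ?thesis"
    then have "z = 0\<^sub>v n" using z(1) by (intro eq_vecI) (auto simp: h_def)
    then show False using z(2) by simp
  qed
  moreover have "spectral_radius (cmat n M) * h i \<le> (\<Sum>j<n. M i j * h j)" if "i < n" for i
  proof -
    have "ev * Matrix.vec_index z i = (\<Sum>j<n. complex_of_real (M i j) * Matrix.vec_index z j)"
      using cmat_mult_vec_index[OF that z(1), of M] that z(1,3) by simp
    then have "spectral_radius (cmat n M) * h i = cmod (\<Sum>j<n. complex_of_real (M i j) * Matrix.vec_index z j)"
      using z(4) by (metis h_def norm_mult)
    also have "\<dots> \<le> (\<Sum>j<n. cmod (complex_of_real (M i j) * Matrix.vec_index z j))" by (rule norm_sum)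
    also have "\<dots> = (\<Sum>j<n. M i j * h j)"
      using M that by (intro sum.cong) (auto simp: norm_mult h_def)
    finally show ?thesis .
  qed
  ultimately show ?thesis using that[of h] by (auto simp: h_def)
qed

lemma spectral_radius_cmat_scale_less_1:
  assumes n: "n > 0" and r: "spectral_radius (cmat n M) < r"
  shows "spectral_radius (cmat n (\<lambda>i j. M i j / r)) < 1"
proof -
  have r0: "r > 0" using spectral_radius_nonneg[OF n, of M] r by simp
  let ?A = "cmat n M" and ?B = "cmat n (\<lambda>i j. M i j / r)"
  obtain z ev where z: "z \<in> carrier_vec n" "z \<noteq> 0\<^sub>v n" "?B *\<^sub>v z = ev \<cdot>\<^sub>v z"
    "cmod ev = spectral_radius ?B" using spectral_radius_cmat_eigenvector[OF n] by metis
  have "?A *\<^sub>v z = (complex_of_real r * ev) \<cdot>\<^sub>v z"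
  proof (rule eq_vecI)
    fix i assume "i < dim_vec ((complex_of_real r * ev) \<cdot>\<^sub>v z)"
    then have i: "i < n" using z(1) by simp
    have "Matrix.vec_index (?A *\<^sub>v z) i = complex_of_real r * Matrix.vec_index (?B *\<^sub>v z) i"
      using r0 unfolding cmat_mult_vec_index[OF i z(1)] by (simp add: sum_distrib_left)
    then show "Matrix.vec_index (?A *\<^sub>v z) i = Matrix.vec_index ((complex_of_real r * ev) \<cdot>\<^sub>v z) i"
      using z(1) i unfolding z(3) by simp
  qed (use z(1) in auto)
  then have "eigenvalue ?A (complex_of_real r * ev)"
    using z(1,2) unfolding eigenvalue_def eigenvector_def by auto
  then have "cmod (complex_of_real r * ev) \<le> spectral_radius ?A"
    using spectral_radius_mem_max(2)[of ?A n] n by (auto simp: spectrum_def)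
  then have "r * spectral_radius ?B \<le> spectral_radius ?A"
    unfolding z(4)[symmetric] using r0 by (simp add: norm_mult)
  then have "r * spectral_radius ?B < r * 1" using r by linarith
  then show ?thesis using r0 by (simp only: mult_less_cancel_left_pos)
qed

text \<open>
  After division by a number \<open>r'\<close> between the spectral radius and \<open>r\<close>, the powers of the matrix stay
  bounded, so some power of \<open>M / r\<close> maps the constant vector 1 below 1. The sum of the lower
  powers applied to 1 is superinvariant: applying \<open>M / r\<close> drops the first term, which is 1, and adds
  a last one, which is at most 1.
\<close>

lemma spectral_radius_superinvariant:
  assumes n: "n > 0" and M: "\<And>i j. i < n \<Longrightarrow> j < n \<Longrightarrow> 0 \<le> M i j"
    and r: "spectral_radius (cmat n M) < r"
  obtains g where "\<And>i. i < n \<Longrightarrow> 1 \<le> g i" "\<And>i. i < n \<Longrightarrow> (\<Sum>j<n. M i j * g j) \<le> r * g i"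
proof -
  define r' where "r' = (spectral_radius (cmat n M) + r) / 2"
  have r': "spectral_radius (cmat n M) < r'" "r' < r" "r' > 0"
    using r spectral_radius_nonneg[OF n, of M] by (auto simp: r'_def)
  define B where "B i j = M i j / r'" for i j
  have B: "\<And>i j. i < n \<Longrightarrow> j < n \<Longrightarrow> 0 \<le> B i j" using M r' by (auto simp: B_def)
  have "spectral_radius (cmat n B) < 1"
    using spectral_radius_cmat_scale_less_1[OF n r'(1)] unfolding B_def .
  from spectral_radius_jnf_norm_bound_less_1_upper_triangular[OF _ this, of n]
  obtain c where c: "\<And>k. norm_bound (cmat n B ^\<^sub>m k) c" by auto
  define F where "F f i = (\<Sum>j<n. B i j * f j)" for f i
  define p where "p k = (F ^^ k) (\<lambda>_. 1)" for k
  have p_Suc: "p (Suc k) i = (\<Sum>j<n. B i j * p k j)" for k i by (simp add: p_def F_def)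
  have p0: "0 \<le> p k i" if "i < n" for k i
    using that by (induction k arbitrary: i) (auto simp: p_Suc B intro!: sum_nonneg, simp add: p_def)
  have p_le: "p k i \<le> real n * c" if i: "i < n" for k i
  proof -
    let ?A = "cmat n B ^\<^sub>m k"
    have A: "?A \<in> carrier_mat n n" by (intro pow_carrier_mat) auto
    have e: "?A *\<^sub>v Matrix.vec n (\<lambda>i. 1) = Matrix.vec n (\<lambda>i. complex_of_real (p k i))"
      using cmat_power_mult_vec[of n B k "\<lambda>_. 1"] unfolding p_def F_def by simp
    have "complex_of_real (p k i) = Matrix.vec_index (?A *\<^sub>v Matrix.vec n (\<lambda>i. 1)) i"
      using e i by simp
    also have "\<dots> = (\<Sum>j\<in>{0..<n}. ?A $$ (i, j))"
      using A i by (simp add: scalar_prod_def)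
    finally have "p k i = cmod (\<Sum>j\<in>{0..<n}. ?A $$ (i, j))" using p0[OF i, of k] by (metis abs_of_nonneg norm_of_real)
    also have "\<dots> \<le> (\<Sum>j\<in>{0..<n}. cmod (?A $$ (i, j)))" by (rule norm_sum)
    also have "\<dots> \<le> (\<Sum>j\<in>{0..<n}. c)" using c[of k] A i by (intro sum_mono) (auto simp: norm_bound_def)
    finally show ?thesis by simp
  qed
  \<comment> \<open>The bound on the powers of \<open>M / r'\<close> turns into geometric decay of those of \<open>M / r\<close>.\<close>
  define q where "q = r' / r"
  have q: "0 < q" "q < 1" using r' by (auto simp: q_def)
  have "(\<lambda>k. q ^ k * (real n * c)) \<longlonglongrightarrow> 0 * (real n * c)"
    using q by (intro tendsto_intros LIMSEQ_power_zero) auto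
  then have "\<forall>\<^sub>F k in sequentially. q ^ k * (real n * c) < 1" by (intro order_tendstoD) auto
  then obtain k0 where k0: "\<And>k. k \<ge> k0 \<Longrightarrow> q ^ k * (real n * c) < 1" unfolding eventually_sequentially by auto
  define k where "k = Suc k0"
  have k: "q ^ k * (real n * c) < 1" using k0[of k] by (simp add: k_def del: power_Suc)
  define g where "g i = (\<Sum>m<k. q ^ m * p m i)" for i
  have g1: "1 \<le> g i" if "i < n" for i
  proof -
    have "q ^ 0 * p 0 i \<le> g i" unfolding g_def
      using p0[OF that] q by (intro member_le_sum) (auto simp: k_def)
    then show ?thesis by (simp add: p_def)
  qed
  have "(\<Sum>j<n. M i j * g j) \<le> r * g i" if i: "i < n" for i
  proof -
    have "(\<Sum>j<n. M i j * g j) = (\<Sum>j<n. \<Sum>m<k. r * (q ^ Suc m * (B i j * p m j)))"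
      using r' unfolding g_def sum_distrib_left B_def q_def by (intro sum.cong) (auto simp: field_simps)
    also have "\<dots> = (\<Sum>m<k. \<Sum>j<n. r * (q ^ Suc m * (B i j * p m j)))" by (rule sum.swap)
    also have "\<dots> = r * (\<Sum>m<k. q ^ Suc m * p (Suc m) i)"
      by (simp add: p_Suc sum_distrib_left)
    also have "(\<Sum>m<k. q ^ Suc m * p (Suc m) i) = (\<Sum>m<Suc k. q ^ m * p m i) - q ^ 0 * p 0 i"
      by (subst sum.lessThan_Suc_shift) simp
    also have "\<dots> = g i + q ^ k * p k i - 1" by (simp add: g_def p_def)
    also have "r * \<dots> \<le> r * g i"
    proof (rule mult_left_mono)
      have "q ^ k * p k i \<le> q ^ k * (real n * c)" using q p_le[OF i] by (intro mult_left_mono) auto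
      then show "g i + q ^ k * p k i - 1 \<le> g i" using k by linarith
    qed (use r' in auto)
    finally show ?thesis .
  qed
  then show ?thesis using that g1 by blast
qed

text \<open>
  Otherwise there is a positive vector \<open>g\<close> with \<open>M g \<le> r' g\<close> for some \<open>r' < r\<close>, and the inequalities
  for \<open>h\<close> and \<open>g\<close> contradict each other at an index where \<open>h / g\<close> is maximal.
\<close>

lemma le_spectral_radius_if_subinvariant:
  assumes n: "n > 0" and M: "\<And>i j. i < n \<Longrightarrow> j < n \<Longrightarrow> 0 \<le> M i j"
    and h: "\<And>i. i < n \<Longrightarrow> 0 \<le> h i" "\<exists>i<n. 0 < h i"
    and sub: "\<And>i. i < n \<Longrightarrow> r * h i \<le> (\<Sum>j<n. M i j * h j)"
  shows "r \<le> spectral_radius (cmat n M)"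
proof (rule ccontr)
  assume "\<not> ?thesis"
  then have lt: "spectral_radius (cmat n M) < r" by simp
  define r' where "r' = (spectral_radius (cmat n M) + r) / 2"
  have r': "spectral_radius (cmat n M) < r'" "r' < r" using lt by (auto simp: r'_def)
  obtain g where g: "\<And>i. i < n \<Longrightarrow> 1 \<le> g i" "\<And>i. i < n \<Longrightarrow> (\<Sum>j<n. M i j * g j) \<le> r' * g i"
    using spectral_radius_superinvariant[where M = M, OF n M r'(1)] by blast
  let ?Q = "(\<lambda>i. h i / g i) ` {..<n}"
  define t where "t = Max ?Q"
  have "t \<in> ?Q" unfolding t_def using n by (intro Max_in) auto
  then obtain i where i: "i < n" "t = h i / g i" by auto
  have t: "h j / g j \<le> t" if "j < n" for j unfolding t_def using that by (intro Max_ge) auto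
  have le: "h j \<le> t * g j" if "j < n" for j using t[OF that] g(1)[OF that] by (simp add: divide_le_eq)
  obtain j where j: "j < n" "0 < h j" using h(2) by auto
  have "0 < t" using t[OF j(1)] g(1)[OF j(1)] j(2) by (smt (verit) divide_pos_pos)
  then have hi: "0 < h i" "h i = t * g i" using i g(1)[OF i(1)] by (auto simp: field_simps)
  have "r * h i \<le> (\<Sum>j<n. M i j * h j)" by (rule sub[OF i(1)])
  also have "\<dots> \<le> (\<Sum>j<n. M i j * (t * g j))"
    using M[OF i(1)] le by (intro sum_mono mult_left_mono) auto
  also have "\<dots> = t * (\<Sum>j<n. M i j * g j)" by (simp add: sum_distrib_left algebra_simps)
  also have "\<dots> \<le> t * (r' * g i)" using g(2)[OF i(1)] \<open>0 < t\<close> by (intro mult_left_mono) auto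
  also have "\<dots> = r' * h i" using hi(2) by simp
  finally show False using hi(1) r'(2) by simp
qed

section \<open>Diagonal maps and the carpets\<close>

lemma ex_other_axis: "\<exists>i::2. i \<noteq> j"
  by (cases "j = 1") (auto intro: exI[of _ 2] exI[of _ 1])

lemma UNIV_two_axes: "i \<noteq> j \<Longrightarrow> (UNIV :: 2 set) = {i, j}"
  using exhaust_2[of i] exhaust_2[of j] UNIV_2 by auto

text \<open>
  The product is componentwise, so this is the diagonal affine map with (signed) scaling factors \<open>x\<close>.
  Edge maps have this form, and the componentwise product makes their composition a ring
  computation.
\<close>

definition diag_map :: "real^2 \<Rightarrow> real^2 \<Rightarrow> real^2 \<Rightarrow> real^2" where
  "diag_map x q \<xi> = x * \<xi> + q"

text \<open>
  The weight of a rectangle with side lengths \<open>\<bar>x $ 1\<bar>\<close> and \<open>\<bar>x $ 2\<bar>\<close>; for \<open>x\<close> the diagonal of \<open>T e\<close> it is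
  the entry of the transfer matrix that belongs to \<open>e\<close>.
\<close>

definition weight :: "(2 \<Rightarrow> real) \<Rightarrow> real^2 \<Rightarrow> real" where
  "weight \<alpha> x = (\<Prod>i\<in>UNIV. \<bar>x $ i\<bar> powr \<alpha> i)"

definition scales :: "(real^2) set" where
  "scales = {x. \<forall>i. 0 < \<bar>x $ i\<bar> \<and> \<bar>x $ i\<bar> \<le> 1}"

lemma diag_map_nth [simp]: "diag_map x q \<xi> $ i = x $ i * \<xi> $ i + q $ i"
  by (simp add: diag_map_def)

lemma diag_map_comp: "diag_map x q (diag_map y p \<xi>) = diag_map (x * y) (x * p + q) \<xi>"
  by (simp add: vec_eq_iff algebra_simps)

lemma diag_map_1_0 [simp]: "diag_map 1 0 = id"
  by (auto simp: diag_map_def)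

lemma weight_mult: "weight \<alpha> (x * y) = weight \<alpha> x * weight \<alpha> y"
  by (simp add: weight_def abs_mult powr_mult prod.distrib)

lemma weight_nonneg: "0 \<le> weight \<alpha> x"
  by (auto simp: weight_def intro!: prod_nonneg)

lemma weight_two_axes: "i \<noteq> j \<Longrightarrow> weight \<alpha> x = \<bar>x $ i\<bar> powr \<alpha> i * \<bar>x $ j\<bar> powr \<alpha> j"
  by (simp add: weight_def UNIV_two_axes)

lemma weight_1 [simp]: "weight \<alpha> 1 = 1"
  by (simp add: weight_def)

lemma scales_mult: "x \<in> scales \<Longrightarrow> y \<in> scales \<Longrightarrow> x * y \<in> scales"
  by (auto simp: scales_def abs_mult intro: mult_le_one)

lemma one_in_scales: "1 \<in> scales"
  by (auto simp: scales_def)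

lemma scales_nonzero: "x \<in> scales \<Longrightarrow> x $ i \<noteq> 0"
  by (auto simp: scales_def)

lemma weight_pos: "x \<in> scales \<Longrightarrow> 0 < weight \<alpha> x"
  using scales_nonzero by (auto simp: weight_def intro!: prod_pos)

lemma continuous_on_diag_map: "continuous_on S (diag_map x q)"
proof -
  have "diag_map x q = (\<lambda>\<xi>. \<chi> i. x $ i * \<xi> $ i + q $ i)" by (auto simp: vec_eq_iff)
  then show ?thesis by (auto intro!: continuous_intros)
qed

lemma inj_diag_map: "x \<in> scales \<Longrightarrow> inj (diag_map x q)"
  using scales_nonzero by (auto simp: inj_def vec_eq_iff)

lemma open_unit_square_eq_box: "open_unit_square = box 0 1"
  by (auto simp: open_unit_square_def mem_box_cart)

lemma open_diag_map_image:
  assumes "x \<in> scales" "open S"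
  shows "open (diag_map x q ` S)"
proof -
  let ?g = "\<lambda>\<zeta>::real^2. \<chi> i. (\<zeta> $ i - q $ i) / x $ i"
  have nz: "x $ i \<noteq> 0" for i using scales_nonzero[OF assms(1)] .
  have gd: "?g (diag_map x q \<xi>) = \<xi>" and dg: "diag_map x q (?g \<zeta>) = \<zeta>" for \<xi> \<zeta>
    by (simp_all add: vec_eq_iff nz)
  have "diag_map x q ` S = ?g -` S"
  proof (intro Set.set_eqI iffI)
    fix \<zeta> assume "\<zeta> \<in> ?g -` S"
    then show "\<zeta> \<in> diag_map x q ` S" using imageI[of "?g \<zeta>" S "diag_map x q"] unfolding dg by simp
  next
    fix \<zeta> assume "\<zeta> \<in> diag_map x q ` S"
    then show "\<zeta> \<in> ?g -` S" using gd by force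
  qed
  moreover have "continuous_on UNIV ?g"
    using nz by (auto intro!: continuous_intros)
  ultimately show ?thesis using open_vimage[OF assms(2), of ?g] by simp
qed

locale box_carpet =
  fixes G :: "('v, 'e) pre_digraph"
    and T :: "'e \<Rightarrow> real^2^2" and t :: "'e \<Rightarrow> real^2"
    and X :: "'v \<Rightarrow> (real^2) set"
  assumes box: "diagonal_box_like_gifs G T"
    and conn: "strongly_conn G"
    and rosc: "rosc G T t"
    and carpet: "carpet_family G T t X"
    and verts_nonempty: "verts G \<noteq> {}"
begin

lemma fin: "fin_digraph G"
  using box by (simp add: diagonal_box_like_gifs_def gifs_graph_def)

lemma finite_verts: "finite (verts G)"
  using fin by (rule fin_digraph.finite_verts)

lemma finite_arcs: "finite (arcs G)"
  using fin by (rule fin_digraph.finite_arcs)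

lemma finite_out: "finite (out_arcs G v)"
  using finite_arcs by (simp add: out_arcs_def)

lemma out_nonempty: "v \<in> verts G \<Longrightarrow> out_arcs G v \<noteq> {}"
  using box by (simp add: diagonal_box_like_gifs_def gifs_graph_def)

lemma head_in: "e \<in> out_arcs G v \<Longrightarrow> head G e \<in> verts G"
  using fin by (simp add: fin_digraph_def wf_digraph_def)

lemma arc_of_out: "e \<in> out_arcs G v \<Longrightarrow> e \<in> arcs G"
  by simp

lemma arcs_nonempty: "arcs G \<noteq> {}"
  using verts_nonempty out_nonempty by (auto simp: out_arcs_def)

definition ratio :: "'e \<Rightarrow> real^2" where
  "ratio e = (\<chi> i. T e $ i $ i)"

definition rmin :: real where
  "rmin = Min ((\<lambda>(e, i). \<bar>ratio e $ i\<bar>) ` (arcs G \<times> UNIV))"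

definition rmax :: real where
  "rmax = Max ((\<lambda>(e, i). \<bar>ratio e $ i\<bar>) ` (arcs G \<times> UNIV))"

lemma abs_ratio: "e \<in> arcs G \<Longrightarrow> 0 < \<bar>ratio e $ i\<bar> \<and> \<bar>ratio e $ i\<bar> < 1"
  using box exhaust_2[of i] unfolding diagonal_box_like_gifs_def ratio_def by auto

lemma ratio_in_scales: "e \<in> arcs G \<Longrightarrow> ratio e \<in> scales"
  using abs_ratio[of e] by (auto simp: scales_def intro: less_imp_le)

lemma finite_ratios: "finite ((\<lambda>(e, i). \<bar>ratio e $ i\<bar>) ` (arcs G \<times> (UNIV::2 set)))"
  using finite_arcs by simp

lemma ratio_bounds:
  assumes "e \<in> arcs G"
  shows "rmin \<le> \<bar>ratio e $ i\<bar>" "\<bar>ratio e $ i\<bar> \<le> rmax"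
  using assms finite_ratios unfolding rmin_def rmax_def by (auto intro!: Min_le Max_ge)

lemma rmin_pos: "0 < rmin" and rmax_less_1: "rmax < 1"
proof -
  have "rmin \<in> (\<lambda>(e, i). \<bar>ratio e $ i\<bar>) ` (arcs G \<times> (UNIV::2 set))"
    and "rmax \<in> (\<lambda>(e, i). \<bar>ratio e $ i\<bar>) ` (arcs G \<times> (UNIV::2 set))"
    unfolding rmin_def rmax_def
    using arcs_nonempty by (intro Min_in Max_in finite_ratios, simp)+
  then show "0 < rmin" "rmax < 1" using abs_ratio by auto
qed

lemma rmin_le_rmax: "rmin \<le> rmax"
  using arcs_nonempty ratio_bounds by (metis all_not_in_conv order_trans)

lemma rmax_pos: "0 < rmax" and rmin_less_1: "rmin < 1"
  using rmin_le_rmax rmin_pos rmax_less_1 by linarith+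

lemma gifs_map_eq: "e \<in> arcs G \<Longrightarrow> gifs_map T t e = diag_map (ratio e) (t e)"
  using box unfolding diagonal_box_like_gifs_def
  by (auto simp: fun_eq_iff vec_eq_iff forall_2 gifs_map_def ratio_def matrix_vector_mult_def sum_2)

lemma compact_X: "v \<in> verts G \<Longrightarrow> compact (X v)" and X_nonempty: "v \<in> verts G \<Longrightarrow> X v \<noteq> {}"
  using carpet by (auto simp: carpet_family_def)

lemma X_eq: "v \<in> verts G \<Longrightarrow> X v = (\<Union>e\<in>out_arcs G v. diag_map (ratio e) (t e) ` X (head G e))"
  using carpet gifs_map_eq by (simp add: carpet_family_def)

lemma diag_map_X_eq:
  assumes "v \<in> verts G"
  shows "diag_map x q ` X v = (\<Union>e\<in>out_arcs G v. diag_map (x * ratio e) (x * t e + q) ` X (head G e))"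
  by (subst X_eq[OF assms]) (simp add: image_UN image_image diag_map_comp)

lemma rosc_subset:
  assumes "v \<in> verts G" "e \<in> out_arcs G v"
  shows "diag_map (x * ratio e) (x * t e + q) ` open_unit_square \<subseteq> diag_map x q ` open_unit_square"
proof -
  have "diag_map (ratio e) (t e) ` open_unit_square \<subseteq> open_unit_square"
    using rosc assms unfolding rosc_def gifs_map_eq[OF arc_of_out[OF assms(2)], symmetric] by blast
  then show ?thesis by (auto simp flip: diag_map_comp intro!: imageI)
qed

lemma rosc_disjoint:
  assumes "v \<in> verts G" "x \<in> scales"
  shows "disjoint_family_on (\<lambda>e. diag_map (x * ratio e) (x * t e + q) ` open_unit_square) (out_arcs G v)"
proof -
  have "disjoint_family_on (\<lambda>e. diag_map (ratio e) (t e) ` open_unit_square) (out_arcs G v)"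
    using rosc assms(1) gifs_map_eq unfolding rosc_def disjoint_family_on_def by (metis arc_of_out)
  then have "disjoint_family_on (\<lambda>e. diag_map x q ` diag_map (ratio e) (t e) ` open_unit_square) (out_arcs G v)"
    unfolding disjoint_family_on_def using inj_diag_map[OF assms(2)] by (metis image_Int image_empty)
  then show ?thesis by (simp add: image_image diag_map_comp)
qed

text \<open>
  The open set condition concerns points with both coordinates in the open interval; the other
  coordinate is set to \<open>1/2\<close>, and the end points are reached by continuity.
\<close>

lemma axis_map_unit_interval:
  assumes e: "e \<in> arcs G" and s: "s \<in> {0..1}"
  shows "ratio e $ i * s + t e $ i \<in> {0..1}"
proof -
  have v: "tail G e \<in> verts G" "e \<in> out_arcs G (tail G e)"
    using e fin by (auto simp: fin_digraph_def wf_digraph_def)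
  let ?f = "\<lambda>s. ratio e $ i * s + t e $ i"
  have "?f ` {0<..<1} \<subseteq> {0..1}"
  proof
    fix z assume "z \<in> ?f ` {0<..<1}"
    then obtain s where s: "0 < s" "s < 1" "z = ?f s" by auto
    have "(\<chi> j. if j = i then s else 1/2) \<in> open_unit_square"
      using s by (auto simp: open_unit_square_def)
    then have "diag_map (ratio e) (t e) (\<chi> j. if j = i then s else 1/2) \<in> open_unit_square"
      using rosc_subset[OF v, of 1 0] by auto
    then show "z \<in> {0..1}" using s(3) by (auto simp: open_unit_square_def dest: spec[of _ i])
  qed
  then have "?f ` closure {0<..<1} \<subseteq> {0..1}"
    by (intro image_closure_subset) (auto intro!: continuous_intros)
  then have "?f ` {0..1} \<subseteq> {0..1}" by simp
  then show ?thesis using s by blast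
qed

definition proj_X :: "2 \<Rightarrow> 'v \<Rightarrow> real set" where
  "proj_X i v = (\<lambda>\<xi>. \<xi> $ i) ` X v"

lemma compact_proj_X: "v \<in> verts G \<Longrightarrow> compact (proj_X i v)"
  unfolding proj_X_def by (intro compact_continuous_image compact_X) (auto intro!: continuous_intros)

lemma proj_X_nonempty: "v \<in> verts G \<Longrightarrow> proj_X i v \<noteq> {}"
  using X_nonempty by (simp add: proj_X_def)

lemma proj_X_eq:
  "v \<in> verts G \<Longrightarrow> proj_X i v = (\<Union>e\<in>out_arcs G v. (\<lambda>z. ratio e $ i * z + t e $ i) ` proj_X i (head G e))"
  unfolding proj_X_def by (subst X_eq) (auto simp: image_UN image_image)

text \<open>
  The maps contract the distance to the unit interval, and this distance attains its maximum on the
  union of the projections; so the maximum is 0.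
\<close>

lemma proj_X_unit_interval:
  assumes "v \<in> verts G"
  shows "proj_X i v \<subseteq> {0..1}"
proof -
  let ?K = "\<Union>v\<in>verts G. proj_X i v"
  define g where "g z = max 0 (max (z - 1) (- z))" for z :: real
  have "compact ?K" using finite_verts compact_proj_X by (intro compact_UN) auto
  moreover have "?K \<noteq> {}" using assms proj_X_nonempty by auto
  moreover have "continuous_on ?K g" unfolding g_def by (intro continuous_intros)
  ultimately obtain z where z: "z \<in> ?K" "\<And>y. y \<in> ?K \<Longrightarrow> g y \<le> g z"
    using continuous_attains_sup by metis
  then obtain u where u: "u \<in> verts G" "z \<in> proj_X i u" by auto
  then obtain e y where e: "e \<in> out_arcs G u" "y \<in> proj_X i (head G e)" "z = ratio e $ i * y + t e $ i"
    using proj_X_eq by auto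
  \<comment> \<open>The point of the unit interval that is nearest to \<open>y\<close>.\<close>
  define y' where "y' = min 1 (max 0 y)"
  have y': "y' \<in> {0..1}" "\<bar>y - y'\<bar> = g y" by (auto simp: y'_def g_def)
  have "ratio e $ i * y' + t e $ i \<in> {0..1}" using axis_map_unit_interval[OF _ y'(1)] e(1) by auto
  then have "g z \<le> \<bar>z - (ratio e $ i * y' + t e $ i)\<bar>" by (auto simp: g_def)
  also have "\<dots> = \<bar>ratio e $ i\<bar> * g y" unfolding e(3) y'(2)[symmetric] by (simp flip: abs_mult add: algebra_simps)
  also have "\<dots> \<le> \<bar>ratio e $ i\<bar> * g z" using z(2) e(2) head_in[OF e(1)] by (intro mult_left_mono) auto
  finally have "(1 - \<bar>ratio e $ i\<bar>) * g z \<le> 0" by (simp add: algebra_simps)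
  then have "g z \<le> 0" using abs_ratio[of e i] e(1) by (simp add: mult_le_0_iff)
  moreover have "g y \<le> g z" if "y \<in> proj_X i v" for y using z(2) that assms by blast
  ultimately show ?thesis by (force simp: g_def)
qed

lemma X_unit_square: "v \<in> verts G \<Longrightarrow> \<xi> \<in> X v \<Longrightarrow> \<xi> $ i \<in> {0..1}"
  using proj_X_unit_interval[of v i] by (auto simp: proj_X_def)

text \<open>
  By strong connectivity every carpet contains a non-degenerate diagonal copy of every other one.
\<close>

lemma copy_along_walk:
  assumes "u \<in> verts G" "v \<in> verts G"
  shows "\<exists>x\<in>scales. \<exists>q. diag_map x q ` X u \<subseteq> X v"
proof -
  have walk: "\<exists>x\<in>scales. \<exists>q. diag_map x q ` X u \<subseteq> X v"
    if "v \<in> verts G" "set w \<subseteq> arcs G" "pre_digraph.cas G v w u" for w v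
    using that
  proof (induction w arbitrary: v)
    case Nil
    then have "v = u" by (simp add: pre_digraph.cas.simps)
    then show ?case using one_in_scales by (intro bexI[of _ 1] exI[of _ 0]) auto
  next
    case (Cons e w)
    then have e: "e \<in> out_arcs G v" "pre_digraph.cas G (head G e) w u" by (auto simp: pre_digraph.cas.simps)
    then obtain x q where x: "x \<in> scales" "diag_map x q ` X u \<subseteq> X (head G e)"
      using Cons.IH[of "head G e"] Cons.prems head_in by auto
    have "diag_map (ratio e * x) (ratio e * q + t e) ` X u = diag_map (ratio e) (t e) ` diag_map x q ` X u"
      by (simp add: image_image diag_map_comp)
    also have "\<dots> \<subseteq> X v" using x(2) e(1) X_eq[OF Cons.prems(1)] by blast
    finally show ?case
      using scales_mult[OF ratio_in_scales x(1)] e(1) by auto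
  qed
  obtain w where "pre_digraph.awalk G v w u" using conn assms by (auto simp: strongly_conn_def)
  then show ?thesis using walk by (auto simp: pre_digraph.awalk_def)
qed

end

section \<open>Box dimensions of the projections to the axes\<close>

context box_carpet
begin

text \<open>
  Descend along a path through \<open>s\<close> until the contraction ratio is at most \<open>\<delta>\<close> for the first time; then it
  is still at least \<open>rmin * \<delta>\<close>. The number \<open>n\<close> bounds the remaining steps.
\<close>

lemma axis_piece:
  assumes "v \<in> verts G" "s \<in> proj_X i v" "0 < \<delta>" "\<delta> < 1" "rmax ^ n \<le> \<delta>"
  shows "\<exists>x q. \<exists>u\<in>verts G. rmin * \<delta> \<le> \<bar>x\<bar> \<and> \<bar>x\<bar> \<le> \<delta> \<and>
    (\<lambda>z. x * z + q) ` proj_X i u \<subseteq> proj_X i v \<and> s \<in> (\<lambda>z. x * z + q) ` proj_X i u"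
  using assms
proof (induction n arbitrary: v s \<delta>)
  case 0
  then show ?case by simp
next
  case (Suc n)
  obtain e y where e: "e \<in> out_arcs G v" "y \<in> proj_X i (head G e)" "s = ratio e $ i * y + t e $ i"
    using Suc.prems(1,2) proj_X_eq by auto
  have sub: "(\<lambda>z. ratio e $ i * z + t e $ i) ` proj_X i (head G e) \<subseteq> proj_X i v"
    using proj_X_eq[OF Suc.prems(1)] e(1) by blast
  have r: "rmin \<le> \<bar>ratio e $ i\<bar>" "\<bar>ratio e $ i\<bar> \<le> rmax" "0 < \<bar>ratio e $ i\<bar>"
    using ratio_bounds abs_ratio e(1) by auto
  show ?case
  proof (cases "\<bar>ratio e $ i\<bar> \<le> \<delta>")
    case True
    have "rmin * \<delta> \<le> rmin * 1" using Suc.prems(4) rmin_pos by (intro mult_left_mono) auto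
    then show ?thesis
      using sub e True r(1) head_in
      by (intro exI[of _ "ratio e $ i"] exI[of _ "t e $ i"] bexI[of _ "head G e"]) auto
  next
    case False
    define \<delta>' where "\<delta>' = \<delta> / \<bar>ratio e $ i\<bar>"
    have \<delta>': "0 < \<delta>'" "\<delta>' < 1" "\<delta> = \<bar>ratio e $ i\<bar> * \<delta>'"
      using False Suc.prems(3) r(3) by (auto simp: \<delta>'_def divide_less_eq)
    have "rmax ^ n * \<bar>ratio e $ i\<bar> \<le> rmax ^ n * rmax"
      using r(2) rmax_pos by (intro mult_left_mono) auto
    then have "rmax ^ n \<le> \<delta>'"
      using Suc.prems(5) r(3) by (simp add: \<delta>'_def le_divide_eq algebra_simps)
    then obtain x q u where IH: "u \<in> verts G" "rmin * \<delta>' \<le> \<bar>x\<bar>" "\<bar>x\<bar> \<le> \<delta>'"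
      "(\<lambda>z. x * z + q) ` proj_X i u \<subseteq> proj_X i (head G e)" "y \<in> (\<lambda>z. x * z + q) ` proj_X i u"
      using Suc.IH[of "head G e" y \<delta>'] e head_in \<delta>' by blast
    let ?x = "ratio e $ i * x" and ?q = "ratio e $ i * q + t e $ i"
    have comp: "(\<lambda>z. ?x * z + ?q) ` proj_X i u = (\<lambda>z. ratio e $ i * z + t e $ i) ` (\<lambda>z. x * z + q) ` proj_X i u"
      by (simp add: image_image algebra_simps)
    have "(\<lambda>z. ?x * z + ?q) ` proj_X i u \<subseteq> proj_X i v" unfolding comp using IH(4) sub by blast
    moreover have "s \<in> (\<lambda>z. ?x * z + ?q) ` proj_X i u" unfolding comp e(3) using IH(5) by blast
    moreover have "rmin * \<delta> \<le> \<bar>?x\<bar>" "\<bar>?x\<bar> \<le> \<delta>"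
      using mult_left_mono[OF IH(2), of "\<bar>ratio e $ i\<bar>"] mult_left_mono[OF IH(3), of "\<bar>ratio e $ i\<bar>"]
      by (auto simp: \<delta>'(3) abs_mult algebra_simps)
    ultimately show ?thesis using IH(1) by blast
  qed
qed

lemma uniform_axis_copies:
  obtains c where "0 < c" "\<And>i u v. u \<in> verts G \<Longrightarrow> v \<in> verts G \<Longrightarrow>
    \<exists>x q. c \<le> \<bar>x\<bar> \<and> (\<lambda>z. x * z + q) ` proj_X i u \<subseteq> proj_X i v"
proof -
  let ?Q = "\<lambda>(i, u, v) c. \<exists>x q. c \<le> \<bar>x\<bar> \<and> (\<lambda>z. x * z + q) ` proj_X i u \<subseteq> proj_X i v"
  have "\<exists>c>0. \<forall>a\<in>UNIV \<times> verts G \<times> verts G. ?Q a c"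
  proof (rule finite_uniform_lower)
    fix a assume "a \<in> (UNIV :: 2 set) \<times> verts G \<times> verts G"
    then obtain i u v where a: "a = (i, u, v)" "u \<in> verts G" "v \<in> verts G" by auto
    obtain x q where x: "x \<in> scales" "diag_map x q ` X u \<subseteq> X v" using copy_along_walk a by blast
    have "(\<lambda>z. x $ i * z + q $ i) ` proj_X i u = (\<lambda>\<xi>. \<xi> $ i) ` diag_map x q ` X u"
      by (simp add: proj_X_def image_image)
    then have "(\<lambda>z. x $ i * z + q $ i) ` proj_X i u \<subseteq> proj_X i v" using x(2) unfolding proj_X_def by auto
    then have "?Q a \<bar>x $ i\<bar>" unfolding a by auto
    then show "\<exists>c>0. ?Q a c" using scales_nonzero[OF x(1), of i] by (intro exI[of _ "\<bar>x $ i\<bar>"]) auto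
  next
    show "\<And>a K K'. ?Q a K \<Longrightarrow> 0 < K' \<Longrightarrow> K' \<le> K \<Longrightarrow> ?Q a K'" by (auto, meson order_trans)
  qed (use finite_verts in simp)
  then obtain c where "0 < c" "\<forall>a\<in>UNIV \<times> verts G \<times> verts G. ?Q a c" by auto
  then show ?thesis using that[of c] by auto
qed

text \<open>
  The piece of size about \<open>\<delta>\<close> around \<open>s\<close> belongs to some vertex; inside it there is a copy that belongs
  to the prescribed vertex \<open>u\<close>, at a bounded cost.
\<close>

lemma axis_copies_near_points:
  obtains c where "0 < c" "c \<le> 1" "\<And>i u v s \<delta>. u \<in> verts G \<Longrightarrow> v \<in> verts G \<Longrightarrow> s \<in> proj_X i v \<Longrightarrow>
     0 < \<delta> \<Longrightarrow> \<delta> < 1 \<Longrightarrow> \<exists>x q. c * \<delta> \<le> \<bar>x\<bar> \<and> (\<lambda>z. x * z + q) ` proj_X i u \<subseteq> proj_X i v \<inter> cball s \<delta>"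
proof -
  obtain c0 where c0: "c0 > 0" "\<And>i u v. u \<in> verts G \<Longrightarrow> v \<in> verts G \<Longrightarrow>
      \<exists>x q. c0 \<le> \<bar>x\<bar> \<and> (\<lambda>z. x * z + q) ` proj_X i u \<subseteq> proj_X i v"
    by (rule uniform_axis_copies, rule that) auto
  define c where "c = min 1 (c0 * rmin)"
  have c: "0 < c" "c \<le> 1" "c \<le> c0 * rmin" using c0 rmin_pos by (auto simp: c_def)
  have "\<exists>x q. c * \<delta> \<le> \<bar>x\<bar> \<and> (\<lambda>z. x * z + q) ` proj_X i u \<subseteq> proj_X i v \<inter> cball s \<delta>"
    if A: "u \<in> verts G" "v \<in> verts G" "s \<in> proj_X i v" "0 < \<delta>" "\<delta> < 1" for i u v s \<delta>
  proof -
    obtain n where "rmax ^ n < \<delta>" using real_arch_pow_inv[OF A(4) rmax_less_1] by blast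
    then obtain x q w where x: "w \<in> verts G" "rmin * \<delta> \<le> \<bar>x\<bar>" "\<bar>x\<bar> \<le> \<delta>"
      "(\<lambda>z. x * z + q) ` proj_X i w \<subseteq> proj_X i v" "s \<in> (\<lambda>z. x * z + q) ` proj_X i w"
      using axis_piece[OF A(2-5), of n] by auto
    obtain y p where y: "c0 \<le> \<bar>y\<bar>" "(\<lambda>z. y * z + p) ` proj_X i u \<subseteq> proj_X i w" using c0(2) A(1) x(1) by blast
    let ?f = "\<lambda>z. (x * y) * z + (x * p + q)"
    have comp: "?f ` proj_X i u = (\<lambda>z. x * z + q) ` (\<lambda>z. y * z + p) ` proj_X i u"
      by (simp add: image_image algebra_simps)
    then have sub: "?f ` proj_X i u \<subseteq> (\<lambda>z. x * z + q) ` proj_X i w" using y(2) by (simp add: image_mono)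
    have "(\<lambda>z. x * z + q) ` proj_X i w \<subseteq> cball s \<delta>"
    proof
      fix a assume "a \<in> (\<lambda>z. x * z + q) ` proj_X i w"
      then obtain z z' where z: "z \<in> proj_X i w" "z' \<in> proj_X i w" "a = x * z + q" "s = x * z' + q" using x(5) by auto
      then have "z \<in> {0..1}" "z' \<in> {0..1}" using proj_X_unit_interval[OF x(1), of i] by auto
      then have "\<bar>z' - z\<bar> \<le> 1" by auto
      then have "\<bar>x\<bar> * \<bar>z' - z\<bar> \<le> \<delta> * 1" using x(3) by (intro mult_mono) auto
      then show "a \<in> cball s \<delta>" by (simp add: z(3,4) dist_real_def flip: abs_mult right_diff_distrib)
    qed
    moreover have "c * \<delta> \<le> \<bar>x * y\<bar>"
    proof -
      have "c * \<delta> \<le> (c0 * rmin) * \<delta>" using c A by (intro mult_right_mono) auto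
      also have "\<dots> = (rmin * \<delta>) * c0" by simp
      also have "\<dots> \<le> \<bar>x\<bar> * \<bar>y\<bar>" using x(2) y(1) c0(1) by (intro mult_mono) auto
      finally show ?thesis by (simp add: abs_mult)
    qed
    moreover have "?f ` proj_X i u \<subseteq> proj_X i v \<inter> cball s \<delta>" using sub x(4) calculation(1) by (meson Int_greatest order_trans)
    ultimately show ?thesis by (intro exI conjI)
  qed
  then show ?thesis using that[OF c(1,2)] by blast
qed

lemma covering_number_proj_X_mult:
  obtains c where "0 < c" "c < 1" "\<And>i u v \<delta> \<epsilon>. u \<in> verts G \<Longrightarrow> v \<in> verts G \<Longrightarrow> 0 < \<delta> \<Longrightarrow> \<delta> \<le> 1 \<Longrightarrow>
    0 < \<epsilon> \<Longrightarrow> \<epsilon> \<le> 1 \<Longrightarrow>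
    covering_number (proj_X i v) \<delta> * covering_number (proj_X i u) \<epsilon> \<le> covering_number (proj_X i v) (c * \<delta> * \<epsilon>)"
proof -
  obtain c where c: "0 < c" "c \<le> 1" and near: "\<And>i u v s \<delta>. u \<in> verts G \<Longrightarrow> v \<in> verts G \<Longrightarrow> s \<in> proj_X i v \<Longrightarrow>
      0 < \<delta> \<Longrightarrow> \<delta> < 1 \<Longrightarrow> \<exists>x q. c * \<delta> \<le> \<bar>x\<bar> \<and> (\<lambda>z. x * z + q) ` proj_X i u \<subseteq> proj_X i v \<inter> cball s \<delta>"
    by (rule axis_copies_near_points, rule that) auto
  have "covering_number (proj_X i v) \<delta> * covering_number (proj_X i u) \<epsilon> \<le> covering_number (proj_X i v) (c / 8 * \<delta> * \<epsilon>)"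
    if A: "u \<in> verts G" "v \<in> verts G" "0 < \<delta>" "\<delta> \<le> 1" "0 < \<epsilon>" "\<epsilon> \<le> 1" for i u v \<delta> \<epsilon>
  proof (rule covering_number_mult_le)
    have "c * \<epsilon> \<le> 1" using c A by (simp add: mult_le_one)
    then have "\<delta> * (c * \<epsilon>) \<le> \<delta> * 1" using A by (intro mult_left_mono) auto
    then show "c / 8 * \<delta> * \<epsilon> \<le> \<delta> / 4" using A by (simp add: algebra_simps)
    show "8 / (c * \<delta>) * (c / 8 * \<delta> * \<epsilon>) \<le> \<epsilon>" using c A by simp
    fix s assume s: "s \<in> proj_X i v"
    obtain x q where x: "c * (\<delta>/8) \<le> \<bar>x\<bar>" "(\<lambda>z. x * z + q) ` proj_X i u \<subseteq> proj_X i v \<inter> cball s (\<delta>/8)"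
      using near[OF A(1,2) s, of "\<delta>/8"] A by auto
    have x0: "0 < \<bar>x\<bar>" using x(1) c A by (smt (verit) divide_pos_pos mult_pos_pos)
    have "dist ((y - q) / x) ((z - q) / x) \<le> 8 / (c * \<delta>) * dist y z" for y z
    proof -
      have "1 / \<bar>x\<bar> \<le> 1 / (c * (\<delta> / 8))" using x(1) x0 c A by (intro divide_left_mono) auto
      then have "(1 / \<bar>x\<bar>) * dist y z \<le> 8 / (c * \<delta>) * dist y z" by (intro mult_right_mono) auto
      moreover have "dist ((y - q) / x) ((z - q) / x) = (1 / \<bar>x\<bar>) * dist y z"
        by (simp add: dist_real_def diff_divide_distrib[symmetric])
      ultimately show ?thesis by simp
    qed
    moreover have "compact ((\<lambda>z. x * z + q) ` proj_X i u)"
      by (intro compact_continuous_image compact_proj_X A) (auto intro!: continuous_intros)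
    ultimately have "\<exists>g. (\<lambda>z. x * z + q) ` proj_X i u \<subseteq> proj_X i v \<inter> cball s (\<delta> / 8) \<and>
        compact ((\<lambda>z. x * z + q) ` proj_X i u) \<and> (\<forall>y. g (x * y + q) = y) \<and>
        (\<forall>y z. dist (g y) (g z) \<le> 8 / (c * \<delta>) * dist y z)"
      using x x0 by (intro exI[of _ "\<lambda>y. (y - q) / x"]) auto
    then show "\<exists>f g. f ` proj_X i u \<subseteq> proj_X i v \<inter> cball s (\<delta> / 8) \<and> compact (f ` proj_X i u) \<and>
        (\<forall>y. g (f y) = y) \<and> (\<forall>y z. dist (g y) (g z) \<le> 8 / (c * \<delta>) * dist y z)"
      by (rule exI[of _ "\<lambda>z. x * z + q"])
  qed (use A c compact_proj_X in auto)
  then show ?thesis using c by (intro that[of "c / 8"]) auto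
qed

text \<open>
  Existence at one vertex is supermultiplicativity for \<open>u = v\<close>; the dimension is the same at all
  vertices by the case \<open>\<delta> = 1\<close> with different vertices.
\<close>

lemma axis_dimension_exists: "\<exists>d. \<forall>v\<in>verts G. has_box_dimension (proj_X i v) d"
proof -
  obtain c where c: "0 < c" "c < 1" and mult: "\<And>i u v \<delta> \<epsilon>. u \<in> verts G \<Longrightarrow> v \<in> verts G \<Longrightarrow> 0 < \<delta> \<Longrightarrow> \<delta> \<le> 1 \<Longrightarrow>
      0 < \<epsilon> \<Longrightarrow> \<epsilon> \<le> 1 \<Longrightarrow>
      covering_number (proj_X i v) \<delta> * covering_number (proj_X i u) \<epsilon> \<le> covering_number (proj_X i v) (c * \<delta> * \<epsilon>)"
    by (rule covering_number_proj_X_mult, rule that) auto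
  have ex: "\<exists>d. has_box_dimension (proj_X i v) d" if v: "v \<in> verts G" for v
  proof (rule has_box_dimension_of_supermultiplicative[OF compact_proj_X[OF v] proj_X_nonempty[OF v] c])
    fix \<delta> :: real assume \<delta>: "0 < \<delta>" "\<delta> \<le> 1"
    have "covering_number (proj_X i v) \<delta> \<le> covering_number {0..1::real} \<delta>"
      using proj_X_unit_interval[OF v] \<delta> by (intro covering_number_mono) auto
    then show "real (covering_number (proj_X i v) \<delta>) \<le> 2 * \<delta> powr (- 1)"
      using covering_number_unit_interval[OF \<delta>] by linarith
  qed (use mult v in auto)
  have le: "d \<le> d'" if d: "u \<in> verts G" "v \<in> verts G" "has_box_dimension (proj_X i u) d" "has_box_dimension (proj_X i v) d'"
    for u v d d'
  proof (rule field_le_epsilon)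
    fix \<epsilon> :: real assume \<epsilon>: "0 < \<epsilon>"
    obtain K where K: "K > 0" "\<And>\<delta>. 0 < \<delta> \<Longrightarrow> \<delta> \<le> 1 \<Longrightarrow>
        K * \<delta> powr (- d + \<epsilon>/2) \<le> real (covering_number (proj_X i u) \<delta>)"
      using has_box_dimension_power_bounds(2)[OF compact_proj_X proj_X_nonempty d(3), of "\<epsilon>/2" 1] d(1) \<epsilon> by auto
    obtain K' where K': "K' > 0" "\<And>\<delta>. 0 < \<delta> \<Longrightarrow> \<delta> \<le> 1 \<Longrightarrow>
        real (covering_number (proj_X i v) \<delta>) \<le> K' * \<delta> powr (- d' - \<epsilon>/2)"
      using has_box_dimension_power_bounds(1)[OF compact_proj_X proj_X_nonempty d(4), of "\<epsilon>/2" 1] d(2) \<epsilon> by auto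
    have "d - \<epsilon>/2 \<le> d' + \<epsilon>/2"
    proof (rule exponent_le_of_power_le[OF K(1), of 1])
      fix \<delta> :: real assume \<delta>: "0 < \<delta>" "\<delta> < 1"
      have "1 * covering_number (proj_X i u) \<delta> \<le> covering_number (proj_X i v) 1 * covering_number (proj_X i u) \<delta>"
        using covering_number_ge_1[OF compact_proj_X proj_X_nonempty, OF d(2) d(2), of 1 i] by (intro mult_right_mono) auto
      also have "\<dots> \<le> covering_number (proj_X i v) (c * \<delta>)" using mult[OF d(1,2), of 1 \<delta>] \<delta> by simp
      finally have "real (covering_number (proj_X i u) \<delta>) \<le> real (covering_number (proj_X i v) (c * \<delta>))" by simp
      also have "\<dots> \<le> K' * (c * \<delta>) powr (- d' - \<epsilon>/2)"
        using \<delta> c by (intro K'(2)) (auto intro: mult_le_one)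
      finally have "real (covering_number (proj_X i u) \<delta>) \<le> (K' * c powr (- d' - \<epsilon>/2)) * \<delta> powr (- d' - \<epsilon>/2)"
        using c \<delta> by (simp add: powr_mult)
      then show "K * \<delta> powr (- (d - \<epsilon>/2)) \<le> (K' * c powr (- d' - \<epsilon>/2)) * \<delta> powr (- (d' + \<epsilon>/2))"
        using K(2)[of \<delta>] \<delta> by (simp add: algebra_simps)
    qed simp
    then show "d \<le> d' + \<epsilon>" by simp
  qed
  obtain v0 where v0: "v0 \<in> verts G" using verts_nonempty by auto
  then obtain d where d: "has_box_dimension (proj_X i v0) d" using ex by blast
  have "has_box_dimension (proj_X i v) d" if v: "v \<in> verts G" for v
  proof -
    obtain d' where d': "has_box_dimension (proj_X i v) d'" using ex v by blast
    then have "d' = d" using le[OF v v0 d' d] le[OF v0 v d d'] by simp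
    then show ?thesis using d' by simp
  qed
  then show ?thesis by blast
qed

definition axis_dim :: "2 \<Rightarrow> real" where
  "axis_dim i = (SOME d. \<forall>v\<in>verts G. has_box_dimension (proj_X i v) d)"

lemma has_box_dimension_proj_X: "v \<in> verts G \<Longrightarrow> has_box_dimension (proj_X i v) (axis_dim i)"
  using someI_ex[OF axis_dimension_exists[of i]] unfolding axis_dim_def by blast

lemma covering_number_proj_X_upper:
  assumes "\<epsilon> > 0" "\<Delta> > 0"
  shows "\<exists>K>0. \<forall>i. \<forall>v\<in>verts G. \<forall>\<delta>. 0 < \<delta> \<and> \<delta> \<le> \<Delta> \<longrightarrow>
    real (covering_number (proj_X i v) \<delta>) \<le> K * \<delta> powr (- axis_dim i - \<epsilon>)"
proof -
  let ?Q = "\<lambda>(i, v) K. \<forall>\<delta>. 0 < \<delta> \<and> \<delta> \<le> \<Delta> \<longrightarrow> real (covering_number (proj_X i v) \<delta>) \<le> K * \<delta> powr (- axis_dim i - \<epsilon>)"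
  have "\<exists>K>0. \<forall>a\<in>UNIV \<times> verts G. ?Q a K"
  proof (rule finite_uniform_upper)
    fix a assume "a \<in> (UNIV :: 2 set) \<times> verts G"
    then obtain i v where "a = (i, v)" "v \<in> verts G" by auto
    then show "\<exists>K>0. ?Q a K"
      using has_box_dimension_power_bounds(1)[OF compact_proj_X proj_X_nonempty has_box_dimension_proj_X assms] by simp
  next
    fix a :: "2 \<times> 'v" and K K' assume Q: "?Q a K" and le: "K \<le> K'"
    obtain i v where a: "a = (i, v)" by (cases a)
    have "K * \<delta> powr e \<le> K' * \<delta> powr e" for \<delta> e :: real using le by (intro mult_right_mono) auto
    then show "?Q a K'" using Q unfolding a prod.case by (meson order_trans)
  qed (use finite_verts in simp)
  then show ?thesis by auto
qed

lemma covering_number_proj_X_lower: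
  assumes "\<epsilon> > 0" "\<Delta> > 0"
  shows "\<exists>K>0. \<forall>i. \<forall>v\<in>verts G. \<forall>\<delta>. 0 < \<delta> \<and> \<delta> \<le> \<Delta> \<longrightarrow>
    K * \<delta> powr (- axis_dim i + \<epsilon>) \<le> real (covering_number (proj_X i v) \<delta>)"
proof -
  let ?Q = "\<lambda>(i, v) K. \<forall>\<delta>. 0 < \<delta> \<and> \<delta> \<le> \<Delta> \<longrightarrow> K * \<delta> powr (- axis_dim i + \<epsilon>) \<le> real (covering_number (proj_X i v) \<delta>)"
  have "\<exists>K>0. \<forall>a\<in>UNIV \<times> verts G. ?Q a K"
  proof (rule finite_uniform_lower)
    fix a assume "a \<in> (UNIV :: 2 set) \<times> verts G"
    then obtain i v where "a = (i, v)" "v \<in> verts G" by auto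
    then show "\<exists>K>0. ?Q a K"
      using has_box_dimension_power_bounds(2)[OF compact_proj_X proj_X_nonempty has_box_dimension_proj_X assms] by simp
  next
    fix a :: "2 \<times> 'v" and K K' :: real assume Q: "?Q a K" and le: "K' \<le> K"
    obtain i v where a: "a = (i, v)" by (cases a)
    have "K' * \<delta> powr e \<le> K * \<delta> powr e" for \<delta> e :: real using le by (intro mult_right_mono) auto
    then show "?Q a K'" using Q unfolding a prod.case by (meson order_trans)
  qed (use finite_verts in simp)
  then show ?thesis by auto
qed

end

section \<open>Supports of the projected measures\<close>

context box_carpet
begin

lemma edge_map_contracts:
  assumes "e \<in> arcs G"
  shows "dist (diag_map (ratio e) (t e) \<xi>) (diag_map (ratio e) (t e) \<zeta>) \<le> rmax * dist \<xi> \<zeta>"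
proof -
  have "norm (diag_map (ratio e) (t e) \<xi> - diag_map (ratio e) (t e) \<zeta>) \<le> norm (rmax *\<^sub>R (\<xi> - \<zeta>))"
  proof (rule norm_le_componentwise_cart)
    fix i
    have "\<bar>ratio e $ i\<bar> * \<bar>\<xi> $ i - \<zeta> $ i\<bar> \<le> rmax * \<bar>\<xi> $ i - \<zeta> $ i\<bar>"
      using ratio_bounds(2)[OF assms] by (intro mult_right_mono) auto
    then show "norm ((diag_map (ratio e) (t e) \<xi> - diag_map (ratio e) (t e) \<zeta>) $ i) \<le> norm ((rmax *\<^sub>R (\<xi> - \<zeta>)) $ i)"
      using rmax_pos by (simp add: abs_mult flip: right_diff_distrib)
  qed
  then show ?thesis using rmax_pos by (simp add: dist_norm)
qed

lemma X_subset_cball: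
  assumes "v \<in> verts G" "\<xi> \<in> X v"
  shows "X v \<subseteq> cball \<xi> 2"
proof
  fix \<zeta> assume z: "\<zeta> \<in> X v"
  have "norm (\<xi> - \<zeta>) \<le> (\<Sum>i\<in>UNIV. \<bar>(\<xi> - \<zeta>) $ i\<bar>)" by (rule norm_le_l1_cart)
  also have "\<dots> \<le> (\<Sum>i\<in>(UNIV::2 set). 1)"
  proof (rule sum_mono)
    fix i :: 2
    show "\<bar>(\<xi> - \<zeta>) $ i\<bar> \<le> 1"
      using X_unit_square[OF assms, of i] X_unit_square[OF assms(1) z, of i] by auto
  qed
  finally show "\<zeta> \<in> cball \<xi> 2" by (simp add: dist_norm)
qed

text \<open>
  The hypothesis on \<open>A\<close> is a form of \<open>A\<close> being a neighbourhood of \<open>\<xi>\<close> that pulls back along edge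
  maps: after \<open>n\<close> steps the preimage of \<open>A\<close> contains the whole carpet, which has measure 1, and each
  step costs a factor \<open>p e > 0\<close>.
\<close>

lemma measure_ball_pos:
  assumes p: "associated_vector G p" and \<mu>: "measure_family G T t X p \<mu>"
    and "v \<in> verts G" "\<xi> \<in> X v" "A \<in> sets borel" "cball \<xi> (2 * rmax ^ n) \<subseteq> A"
  shows "0 < measure (\<mu> v) A"
  using assms(3-)
proof (induction n arbitrary: v \<xi> A)
  case 0
  then interpret prob_space "\<mu> v" using \<mu> by (simp add: measure_family_def)
  have s: "sets (\<mu> v) = sets borel" and n: "emeasure (\<mu> v) (- X v) = 0"
    using \<mu> 0 by (auto simp: measure_family_def)
  then have sp: "space (\<mu> v) = UNIV" using sets_eq_imp_space_eq by fastforce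
  have "- A \<subseteq> - X v" using X_subset_cball[OF 0(1,2)] 0(4) by auto
  moreover have "- X v \<in> sets (\<mu> v)" 
    using s borel_open[OF open_Compl[OF compact_imp_closed[OF compact_X[OF 0(1)]]]] by simp
  ultimately have "emeasure (\<mu> v) (- A) \<le> emeasure (\<mu> v) (- X v)" by (intro emeasure_mono)
  then have "prob (- A) = 0" using n by (simp add: measure_def)
  moreover have "prob (space (\<mu> v) - A) = 1 - prob A" using s 0(3) by (intro prob_compl) auto
  ultimately show ?case using sp by (simp add: Compl_eq_Diff_UNIV)
next
  case (Suc n)
  obtain e \<zeta> where e: "e \<in> out_arcs G v" "\<zeta> \<in> X (head G e)" "\<xi> = diag_map (ratio e) (t e) \<zeta>"
    using X_eq[OF Suc.prems(1)] Suc.prems(2) by blast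
  let ?B = "\<lambda>e. gifs_map T t e -` A"
  have ae: "e \<in> arcs G" using e(1) by simp
  have "continuous_on UNIV (gifs_map T t e)" using gifs_map_eq[OF ae] continuous_on_diag_map by simp
  then have "gifs_map T t e \<in> borel_measurable borel" by (rule borel_measurable_continuous_onI)
  then have "?B e \<in> sets borel" using measurable_sets[of _ borel borel A] Suc.prems(3) by simp
  moreover have "cball \<zeta> (2 * rmax ^ n) \<subseteq> ?B e"
  proof
    fix \<omega> assume "\<omega> \<in> cball \<zeta> (2 * rmax ^ n)"
    then have "rmax * dist \<zeta> \<omega> \<le> rmax * (2 * rmax ^ n)" using rmax_pos by (intro mult_left_mono) auto
    then have "diag_map (ratio e) (t e) \<omega> \<in> cball \<xi> (2 * rmax ^ Suc n)"
      using edge_map_contracts[OF ae, of \<zeta> \<omega>] e(3) by simp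
    then show "\<omega> \<in> ?B e" using Suc.prems(4) gifs_map_eq[OF ae] by auto
  qed
  ultimately have pos: "0 < measure (\<mu> (head G e)) (?B e)"
    using Suc.IH head_in[OF e(1)] e(2) by blast
  have pp: "0 < p e'" if "e' \<in> out_arcs G v" for e' using p that by (auto simp: associated_vector_def)
  have "0 < p e * measure (\<mu> (head G e)) (?B e)" using pos pp[OF e(1)] by simp
  also have "\<dots> \<le> (\<Sum>e'\<in>out_arcs G v. p e' * measure (\<mu> (head G e')) (?B e'))"
    using e(1) pp by (intro member_le_sum finite_out mult_nonneg_nonneg) (auto intro: less_imp_le)
  also have "\<dots> = measure (\<mu> v) A"
    using \<mu> Suc.prems(1,3) unfolding measure_family_def by simp
  finally show ?case .
qed

lemma measure_support_proj:
  assumes p: "associated_vector G p" and \<mu>: "measure_family G T t X p \<mu>" and v: "v \<in> verts G"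
  shows "measure_support (proj_measure i (\<mu> v)) = proj_X i v"
proof -
  interpret prob_space "\<mu> v" using \<mu> v by (simp add: measure_family_def)
  have s: "sets (\<mu> v) = sets borel" and n: "emeasure (\<mu> v) (- X v) = 0"
    using \<mu> v by (auto simp: measure_family_def)
  then have sp: "space (\<mu> v) = UNIV" using sets_eq_imp_space_eq by fastforce
  let ?\<pi> = "\<lambda>\<xi>::real^2. \<xi> $ i"
  have cont: "continuous_on UNIV ?\<pi>" by (intro continuous_intros)
  then have "?\<pi> \<in> borel_measurable borel" by (rule borel_measurable_continuous_onI)
  then have meas: "?\<pi> \<in> borel_measurable (\<mu> v)" using s by (simp cong: measurable_cong_sets)
  have em: "emeasure (proj_measure i (\<mu> v)) U = emeasure (\<mu> v) (?\<pi> -` U)" if "open U" for U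
    using that meas sp unfolding proj_measure_def by (subst emeasure_distr) auto
  show ?thesis
  proof (intro equalityI subsetI)
    fix z assume z: "z \<in> measure_support (proj_measure i (\<mu> v))"
    show "z \<in> proj_X i v"
    proof (rule ccontr)
      assume nz: "z \<notin> proj_X i v"
      have op: "open (- proj_X i v)" using compact_proj_X[OF v] compact_imp_closed by blast
      have "- X v \<in> sets (\<mu> v)" 
        using s borel_open[OF open_Compl[OF compact_imp_closed[OF compact_X[OF v]]]] by simp
      then have "emeasure (\<mu> v) (?\<pi> -` (- proj_X i v)) \<le> emeasure (\<mu> v) (- X v)"
        by (intro emeasure_mono) (auto simp: proj_X_def)
      then show False using z op nz em[OF op] n unfolding measure_support_def by force
    qed
  next
    fix z assume "z \<in> proj_X i v"
    then obtain \<xi> where \<xi>: "\<xi> \<in> X v" "z = \<xi> $ i" by (auto simp: proj_X_def)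
    have "0 < emeasure (proj_measure i (\<mu> v)) U" if U: "open U" "z \<in> U" for U
    proof -
      have op: "open (?\<pi> -` U)" using open_vimage[OF U(1) cont] .
      moreover have "\<xi> \<in> ?\<pi> -` U" using U(2) \<xi>(2) by simp
      ultimately obtain \<epsilon> where \<epsilon>: "\<epsilon> > 0" "cball \<xi> \<epsilon> \<subseteq> ?\<pi> -` U"
        unfolding open_contains_cball by blast
      obtain n where "rmax ^ n < \<epsilon> / 2" using real_arch_pow_inv[of "\<epsilon>/2", OF _ rmax_less_1] \<epsilon> by auto
      then have "cball \<xi> (2 * rmax ^ n) \<subseteq> ?\<pi> -` U" using \<epsilon>(2) by (force simp: subset_iff)
      then have "0 < measure (\<mu> v) (?\<pi> -` U)"
        using measure_ball_pos[OF p \<mu> v \<xi>(1)] op by (meson borel_open)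
      then show ?thesis unfolding em[OF U(1)] by (simp add: emeasure_eq_measure)
    qed
    then show "z \<in> measure_support (proj_measure i (\<mu> v))" by (simp add: measure_support_def)
  qed
qed

section \<open>The transfer matrices\<close>

text \<open>
  The spectral radius of the transfer matrix, with the two exponents collected in one function
  on the axes.
\<close>

definition \<rho> :: "(2 \<Rightarrow> real) \<Rightarrow> real" where
  "\<rho> \<alpha> = spectral_radius (matrix_F G T (\<alpha> 1) (\<alpha> 2))"

definition F_entry :: "(2 \<Rightarrow> real) \<Rightarrow> nat \<Rightarrow> nat \<Rightarrow> real" where
  "F_entry \<alpha> k l = (if head G (arc_list G ! k) = tail G (arc_list G ! l)
     then weight \<alpha> (ratio (arc_list G ! l)) else 0)"

lemma arc_list: "distinct (arc_list G)" "set (arc_list G) = arcs G" "length (arc_list G) = card (arcs G)"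
proof -
  have "\<exists>es. distinct es \<and> set es = arcs G" using finite_distinct_list[OF finite_arcs] by blast
  from someI_ex[OF this] show 1: "distinct (arc_list G)" "set (arc_list G) = arcs G"
    unfolding arc_list_def by auto
  show "length (arc_list G) = card (arcs G)" using distinct_card[OF 1(1)] 1(2) by simp
qed

lemma card_arcs_pos: "card (arcs G) > 0"
  using arcs_nonempty finite_arcs by (simp add: card_gt_0_iff)

lemma bij_arc_list: "bij_betw (\<lambda>k. arc_list G ! k) {..<card (arcs G)} (arcs G)"
  using bij_betw_nth[OF arc_list(1)] arc_list by simp

lemma arc_list_in: "k < card (arcs G) \<Longrightarrow> arc_list G ! k \<in> arcs G"
  using arc_list nth_mem by metis

lemma rho_eq: "\<rho> \<alpha> = spectral_radius (cmat (card (arcs G)) (F_entry \<alpha>))"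
proof -
  have "matrix_F G T (\<alpha> 1) (\<alpha> 2) = cmat (card (arcs G)) (F_entry \<alpha>)"
    unfolding matrix_F_def
    by (intro cong_mat) (auto simp: F_entry_def weight_def ratio_def UNIV_2 Let_def)
  then show ?thesis by (simp add: \<rho>_def)
qed

lemma F_entry_nonneg: "0 \<le> F_entry \<alpha> k l"
  by (simp add: F_entry_def weight_nonneg)

text \<open>
  Applying the transfer matrix to a function on the edges amounts to a weighted sum over the edges
  that leave the terminal vertex; the result no longer refers to the enumeration of the edges.
\<close>

lemma F_entry_row_sum:
  assumes "k < card (arcs G)"
  shows "(\<Sum>l<card (arcs G). F_entry \<alpha> k l * f (arc_list G ! l)) =
    (\<Sum>e'\<in>out_arcs G (head G (arc_list G ! k)). weight \<alpha> (ratio e') * f e')"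
proof -
  let ?e = "arc_list G ! k"
  have "(\<Sum>l<card (arcs G). F_entry \<alpha> k l * f (arc_list G ! l)) =
      (\<Sum>l<card (arcs G). (\<lambda>e'. if head G ?e = tail G e' then weight \<alpha> (ratio e') * f e' else 0) (arc_list G ! l))"
    by (intro sum.cong) (auto simp: F_entry_def)
  also have "\<dots> = (\<Sum>e'\<in>arcs G. if head G ?e = tail G e' then weight \<alpha> (ratio e') * f e' else 0)"
    by (rule sum.reindex_bij_betw[OF bij_arc_list])
  also have "\<dots> = (\<Sum>e'\<in>{e' \<in> arcs G. head G ?e = tail G e'}. weight \<alpha> (ratio e') * f e')"
    by (rule sum.inter_filter[OF finite_arcs, symmetric])
  also have "{e' \<in> arcs G. head G ?e = tail G e'} = out_arcs G (head G ?e)" by (auto simp: out_arcs_def)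
  finally show ?thesis .
qed

lemma edge_subinvariant:
  obtains h where "\<And>e. 0 \<le> h e" "\<exists>e\<in>arcs G. 0 < h e"
    "\<And>e. e \<in> arcs G \<Longrightarrow> \<rho> \<alpha> * h e \<le> (\<Sum>e'\<in>out_arcs G (head G e). weight \<alpha> (ratio e') * h e')"
proof -
  let ?n = "card (arcs G)"
  obtain h where h: "\<And>k. 0 \<le> h k" "\<exists>k<?n. 0 < h k"
    "\<And>k. k < ?n \<Longrightarrow> \<rho> \<alpha> * h k \<le> (\<Sum>l<?n. F_entry \<alpha> k l * h l)"
    by (rule spectral_radius_subinvariant[OF card_arcs_pos, of "F_entry \<alpha>"])
      (simp add: F_entry_nonneg, rule that, auto simp: rho_eq)
  define h' where "h' e = h (inv_into {..<?n} (\<lambda>k. arc_list G ! k) e)" for e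
  have h': "h' (arc_list G ! k) = h k" if "k < ?n" for k
    using bij_betw_imp_inj_on[OF bij_arc_list] that unfolding h'_def by (subst inv_into_f_f) auto
  show ?thesis
  proof (rule that)
    show "0 \<le> h' e" for e by (simp add: h'_def h)
    show "\<exists>e\<in>arcs G. 0 < h' e" using h(2) h' arc_list_in by metis
    fix e assume "e \<in> arcs G"
    then obtain k where k: "k < ?n" "e = arc_list G ! k" using arc_list by (metis in_set_conv_nth)
    have "\<rho> \<alpha> * h' e \<le> (\<Sum>l<?n. F_entry \<alpha> k l * h l)" using h(3)[OF k(1)] h'[OF k(1)] k(2) by simp
    also have "\<dots> = (\<Sum>l<?n. F_entry \<alpha> k l * h' (arc_list G ! l))" using h' by (intro sum.cong) auto
    also have "\<dots> = (\<Sum>e'\<in>out_arcs G (head G e). weight \<alpha> (ratio e') * h' e')"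
      unfolding k(2) by (rule F_entry_row_sum[OF k(1)])
    finally show "\<rho> \<alpha> * h' e \<le> (\<Sum>e'\<in>out_arcs G (head G e). weight \<alpha> (ratio e') * h' e')" .
  qed
qed

lemma le_rho_if_edge_subinvariant:
  assumes "\<And>e. 0 \<le> h e" "\<exists>e\<in>arcs G. 0 < h e"
    "\<And>e. e \<in> arcs G \<Longrightarrow> r * h e \<le> (\<Sum>e'\<in>out_arcs G (head G e). weight \<alpha> (ratio e') * h e')"
  shows "r \<le> \<rho> \<alpha>"
  unfolding rho_eq
proof (rule le_spectral_radius_if_subinvariant[OF card_arcs_pos F_entry_nonneg])
  show "0 \<le> h (arc_list G ! k)" for k using assms(1) .
  show "\<exists>k<card (arcs G). 0 < h (arc_list G ! k)"
    using assms(2) arc_list by (metis in_set_conv_nth)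
  show "r * h (arc_list G ! k) \<le> (\<Sum>l<card (arcs G). F_entry \<alpha> k l * h (arc_list G ! l))"
    if "k < card (arcs G)" for k
    using assms(3)[OF arc_list_in[OF that]] unfolding F_entry_row_sum[OF that] .
qed

lemma edge_superinvariant:
  assumes "\<rho> \<alpha> < 1"
  obtains g where "\<And>e. e \<in> arcs G \<Longrightarrow> 0 < g e"
    "\<And>e. e \<in> arcs G \<Longrightarrow> (\<Sum>e'\<in>out_arcs G (head G e). weight \<alpha> (ratio e') * g e') \<le> g e"
proof -
  let ?n = "card (arcs G)"
  obtain h where h: "\<And>k. k < ?n \<Longrightarrow> 1 \<le> h k"
    "\<And>k. k < ?n \<Longrightarrow> (\<Sum>l<?n. F_entry \<alpha> k l * h l) \<le> 1 * h k"
    using spectral_radius_superinvariant[OF card_arcs_pos, of "F_entry \<alpha>" 1] F_entry_nonneg assms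
    unfolding rho_eq by metis
  define h' where "h' e = h (inv_into {..<?n} (\<lambda>k. arc_list G ! k) e)" for e
  have h': "h' (arc_list G ! k) = h k" if "k < ?n" for k
    using bij_betw_imp_inj_on[OF bij_arc_list] that unfolding h'_def by (subst inv_into_f_f) auto
  show ?thesis
  proof (rule that)
    fix e assume "e \<in> arcs G"
    then obtain k where k: "k < ?n" "e = arc_list G ! k" using arc_list by (metis in_set_conv_nth)
    show "0 < h' e" using h(1)[OF k(1)] h'[OF k(1)] k(2) by simp
    have "(\<Sum>e'\<in>out_arcs G (head G e). weight \<alpha> (ratio e') * h' e') = (\<Sum>l<?n. F_entry \<alpha> k l * h' (arc_list G ! l))"
      unfolding k(2) by (rule F_entry_row_sum[OF k(1), symmetric])
    also have "\<dots> = (\<Sum>l<?n. F_entry \<alpha> k l * h l)" using h' by (intro sum.cong) auto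
    also have "\<dots> \<le> h' e" using h(2)[OF k(1)] h'[OF k(1)] k(2) by simp
    finally show "(\<Sum>e'\<in>out_arcs G (head G e). weight \<alpha> (ratio e') * h' e') \<le> h' e" .
  qed
qed

lemma rho_mono:
  assumes "\<And>e. e \<in> arcs G \<Longrightarrow> c * weight \<alpha> (ratio e) \<le> weight \<beta> (ratio e)"  "0 \<le> c"
  shows "c * \<rho> \<alpha> \<le> \<rho> \<beta>"
proof -
  obtain h where h: "\<And>e. 0 \<le> h e" "\<exists>e\<in>arcs G. 0 < h e"
    "\<And>e. e \<in> arcs G \<Longrightarrow> \<rho> \<alpha> * h e \<le> (\<Sum>e'\<in>out_arcs G (head G e). weight \<alpha> (ratio e') * h e')"
    by (rule edge_subinvariant[of \<alpha>]) blast
  show ?thesis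
  proof (rule le_rho_if_edge_subinvariant[OF h(1,2)])
    fix e assume e: "e \<in> arcs G"
    have "c * \<rho> \<alpha> * h e \<le> c * (\<Sum>e'\<in>out_arcs G (head G e). weight \<alpha> (ratio e') * h e')"
      using mult_left_mono[OF h(3)[OF e] assms(2)] by (simp add: mult.assoc)
    also have "\<dots> = (\<Sum>e'\<in>out_arcs G (head G e). (c * weight \<alpha> (ratio e')) * h e')"
      by (simp add: sum_distrib_left mult.assoc)
    also have "\<dots> \<le> (\<Sum>e'\<in>out_arcs G (head G e). weight \<beta> (ratio e') * h e')"
      using assms(1) h(1) by (intro sum_mono mult_right_mono) auto
    finally show "c * \<rho> \<alpha> * h e \<le> (\<Sum>e'\<in>out_arcs G (head G e). weight \<beta> (ratio e') * h e')" .
  qed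
qed

text \<open>
  As every vertex has an outgoing edge, the constant function 1 satisfies the subinvariance condition
  with the smallest weight as factor.
\<close>

lemma rho_pos: "0 < \<rho> \<alpha>"
proof -
  define c where "c = Min ((\<lambda>e. weight \<alpha> (ratio e)) ` arcs G)"
  have c: "c \<le> weight \<alpha> (ratio e)" if "e \<in> arcs G" for e
    unfolding c_def using that finite_arcs by (intro Min_le) auto
  have "c \<in> (\<lambda>e. weight \<alpha> (ratio e)) ` arcs G" unfolding c_def using finite_arcs arcs_nonempty by (intro Min_in) auto
  then have "0 < c" using weight_pos ratio_in_scales by auto
  have "c \<le> \<rho> \<alpha>"
  proof (rule le_rho_if_edge_subinvariant[of "\<lambda>_. 1"])
    fix e assume e: "e \<in> arcs G"
    then have "head G e \<in> verts G" using head_in[of e "tail G e"] by simp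
    then obtain e' where e': "e' \<in> out_arcs G (head G e)" using out_nonempty by blast
    have "c * 1 \<le> weight \<alpha> (ratio e') * 1" using c e' by simp
    also have "\<dots> \<le> (\<Sum>e'\<in>out_arcs G (head G e). weight \<alpha> (ratio e') * 1)"
      by (rule member_le_sum[OF e' _ finite_out]) (simp add: weight_nonneg)
    finally show "c * 1 \<le> (\<Sum>e'\<in>out_arcs G (head G e). weight \<alpha> (ratio e') * 1)" .
  qed (use arcs_nonempty in auto)
  then show ?thesis using \<open>0 < c\<close> by simp
qed

text \<open>
  Raising the exponents by \<open>s\<close> multiplies every weight by a number between the two powers.
\<close>

lemma rho_shift:
  assumes "\<And>i. 0 \<le> s i"
  shows "rmin powr (s 1 + s 2) * \<rho> \<alpha> \<le> \<rho> (\<lambda>i. \<alpha> i + s i)" (is ?lower)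
    and "\<rho> (\<lambda>i. \<alpha> i + s i) \<le> rmax powr (s 1 + s 2) * \<rho> \<alpha>" (is ?upper)
proof -
  have weight_add: "weight (\<lambda>i. \<alpha> i + s i) x = weight \<alpha> x * weight s x" for x
    by (simp add: weight_def powr_add prod.distrib)
  have lo: "rmin powr (s 1 + s 2) \<le> weight s (ratio e)" and hi: "weight s (ratio e) \<le> rmax powr (s 1 + s 2)"
    if e: "e \<in> arcs G" for e
  proof -
    have "(\<Prod>i\<in>UNIV. rmin powr s i) \<le> weight s (ratio e)" "weight s (ratio e) \<le> (\<Prod>i\<in>UNIV. rmax powr s i)"
      unfolding weight_def using assms ratio_bounds[OF e] rmin_pos
      by (auto intro!: prod_mono powr_mono2)
    then show "rmin powr (s 1 + s 2) \<le> weight s (ratio e)" "weight s (ratio e) \<le> rmax powr (s 1 + s 2)"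
      by (auto simp: UNIV_2 powr_add)
  qed
  show ?lower
  proof (rule rho_mono)
    show "rmin powr (s 1 + s 2) * weight \<alpha> (ratio e) \<le> weight (\<lambda>i. \<alpha> i + s i) (ratio e)" if "e \<in> arcs G" for e
      unfolding weight_add using mult_right_mono[OF lo[OF that] weight_nonneg] by (simp add: mult.commute)
  qed simp
  let ?c = "rmax powr (s 1 + s 2)"
  have c: "?c > 0" using rmax_pos by simp
  have "(1 / ?c) * \<rho> (\<lambda>i. \<alpha> i + s i) \<le> \<rho> \<alpha>"
  proof (rule rho_mono)
    fix e assume "e \<in> arcs G"
    have "weight \<alpha> (ratio e) * weight s (ratio e) \<le> weight \<alpha> (ratio e) * ?c"
      using hi[OF \<open>e \<in> arcs G\<close>] by (intro mult_left_mono weight_nonneg)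
    then show "(1 / ?c) * weight (\<lambda>i. \<alpha> i + s i) (ratio e) \<le> weight \<alpha> (ratio e)"
      unfolding weight_add using c by (simp add: divide_le_eq)
  qed simp
  then show ?upper using c by (simp add: divide_le_eq mult.commute)
qed

text \<open>
  The inequality for functions on edges turns into one for functions on vertices by summing over the
  edges that leave a vertex.
\<close>

lemma vertex_subinvariant:
  assumes "1 \<le> \<rho> \<alpha>"
  obtains H where "\<And>v. 0 \<le> H v" "\<exists>v\<in>verts G. 0 < H v"
    "\<And>v. v \<in> verts G \<Longrightarrow> H v \<le> (\<Sum>e\<in>out_arcs G v. weight \<alpha> (ratio e) * H (head G e))"
proof -
  obtain h where h: "\<And>e. 0 \<le> h e" "\<exists>e\<in>arcs G. 0 < h e"
    "\<And>e. e \<in> arcs G \<Longrightarrow> \<rho> \<alpha> * h e \<le> (\<Sum>e'\<in>out_arcs G (head G e). weight \<alpha> (ratio e') * h e')"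
    by (rule edge_subinvariant[of \<alpha>]) blast
  define H where "H v = (\<Sum>e\<in>out_arcs G v. weight \<alpha> (ratio e) * h e)" for v
  have le: "h e \<le> H (head G e)" if "e \<in> arcs G" for e
    using h(3)[OF that] mult_right_mono[OF assms h(1)[of e]] by (simp add: H_def)
  show ?thesis
  proof (rule that)
    show "0 \<le> H v" for v unfolding H_def by (intro sum_nonneg mult_nonneg_nonneg weight_nonneg h)
    show "\<exists>v\<in>verts G. 0 < H v" using h(2) le head_in by (metis in_out_arcs_conv order_less_le_trans)
    show "H v \<le> (\<Sum>e\<in>out_arcs G v. weight \<alpha> (ratio e) * H (head G e))" for v
      using le by (subst H_def) (intro sum_mono mult_left_mono weight_nonneg, auto)
  qed
qed

lemma vertex_superinvariant:
  assumes "\<rho> \<alpha> < 1"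
  obtains H where "\<And>v. v \<in> verts G \<Longrightarrow> 0 < H v"
    "\<And>v. v \<in> verts G \<Longrightarrow> (\<Sum>e\<in>out_arcs G v. weight \<alpha> (ratio e) * H (head G e)) \<le> H v"
proof -
  obtain g where g: "\<And>e. e \<in> arcs G \<Longrightarrow> 0 < g e"
    "\<And>e. e \<in> arcs G \<Longrightarrow> (\<Sum>e'\<in>out_arcs G (head G e). weight \<alpha> (ratio e') * g e') \<le> g e"
    using edge_superinvariant[OF assms] by blast
  define H where "H v = (\<Sum>e\<in>out_arcs G v. weight \<alpha> (ratio e) * g e)" for v
  show ?thesis
  proof (rule that)
    show "0 < H v" if "v \<in> verts G" for v
      unfolding H_def using out_nonempty[OF that] g(1) weight_pos ratio_in_scales
      by (intro sum_pos finite_out mult_pos_pos) auto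
    show "(\<Sum>e\<in>out_arcs G v. weight \<alpha> (ratio e) * H (head G e)) \<le> H v" for v
      using g(2) unfolding H_def by (intro sum_mono mult_left_mono weight_nonneg) auto
  qed
qed

end

section \<open>The upper bound\<close>

lemma powr_between_scaled:
  fixes r \<delta> y e :: real
  assumes "0 < r" "r \<le> 1" "0 < \<delta>" "r * \<delta> \<le> y" "y \<le> \<delta>"
  shows "min (r powr e) 1 * \<delta> powr e \<le> y powr e" "y powr e \<le> max (r powr e) 1 * \<delta> powr e"
proof -
  have y: "y = (y / \<delta>) * \<delta>" "r \<le> y / \<delta>" "y / \<delta> \<le> 1" using assms by (auto simp: field_simps)
  have "y / \<delta> > 0" using y(2) assms(1) by linarith
  then have e: "y powr e = (y / \<delta>) powr e * \<delta> powr e" using assms(3) powr_mult[of "y / \<delta>" \<delta> e] by simp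
  show "min (r powr e) 1 * \<delta> powr e \<le> y powr e"
    unfolding e using powr_between(1)[OF assms(1) y(2,3), of e] by (intro mult_right_mono) auto
  show "y powr e \<le> max (r powr e) 1 * \<delta> powr e"
    unfolding e using powr_between(2)[OF assms(1) y(2,3), of e] by (intro mult_right_mono) auto
qed

text \<open>
  The case of a rectangle with sides \<open>x\<close> and \<open>y\<close>, the latter comparable to \<open>\<delta>\<close>: the number of sets needed
  along the first axis is bounded by the weight. Only \<open>y\<close> occurs with the exponent \<open>s - \<tau>\<close>, whose
  sign is unknown, and comparability to \<open>\<delta>\<close> makes the sign irrelevant.
\<close>

lemma upper_weight_bound:
  fixes r c \<tau> s \<epsilon> :: real
  assumes "0 < r" "r \<le> 1" "0 < c" "0 \<le> \<epsilon>"
  shows "\<exists>K>0. \<forall>\<delta> x y. 0 < \<delta> \<longrightarrow> 0 < x \<longrightarrow> x \<le> 1 \<longrightarrow> r * \<delta> \<le> y \<longrightarrow> y \<le> \<delta> \<longrightarrow>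
    c * (\<delta> / x) powr (- \<tau> - \<epsilon>) \<le> K * \<delta> powr (- s - \<epsilon>) * (x powr \<tau> * y powr (s - \<tau>))"
proof -
  define m where "m = min (r powr (s - \<tau>)) 1"
  have m: "0 < m" using assms by (simp add: m_def)
  have "c * (\<delta> / x) powr (- \<tau> - \<epsilon>) \<le> c / m * \<delta> powr (- s - \<epsilon>) * (x powr \<tau> * y powr (s - \<tau>))"
    if A: "0 < \<delta>" "0 < x" "x \<le> 1" "r * \<delta> \<le> y" "y \<le> \<delta>" for \<delta> x y
  proof -
    have "(\<delta> / x) powr (- \<tau> - \<epsilon>) = \<delta> powr (- \<tau> - \<epsilon>) * x powr \<tau> * x powr \<epsilon>"
      using A by (simp add: powr_divide powr_diff powr_minus field_simps)
    also have "\<dots> \<le> \<delta> powr (- \<tau> - \<epsilon>) * x powr \<tau> * 1"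
      using A assms(4) by (intro mult_left_mono) (auto intro: powr_le1)
    also have "\<dots> = \<delta> powr (- s - \<epsilon>) * (x powr \<tau> * \<delta> powr (s - \<tau>))"
      by (simp add: powr_add[symmetric] algebra_simps)
    also have "\<dots> \<le> \<delta> powr (- s - \<epsilon>) * (x powr \<tau> * (y powr (s - \<tau>) / m))"
      using powr_between_scaled(1)[OF assms(1,2) A(1,4,5), of "s - \<tau>"] m
      by (intro mult_left_mono) (auto simp: m_def[symmetric] field_simps)
    finally have "c * (\<delta> / x) powr (- \<tau> - \<epsilon>) \<le> c * (\<delta> powr (- s - \<epsilon>) * (x powr \<tau> * (y powr (s - \<tau>) / m)))"
      using assms(3) by (intro mult_left_mono) auto
    then show ?thesis by simp
  qed
  then show ?thesis using m assms(3) by (intro exI[of _ "c / m"]) auto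
qed

context box_carpet
begin

lemma compact_diag_map_X: "v \<in> verts G \<Longrightarrow> compact (diag_map x q ` X v)"
  by (intro compact_continuous_image continuous_on_diag_map compact_X)

text \<open>
  Products of covering sets of the two projections, rescaled. Their sides are at most \<open>\<delta>\<close>, so their
  diameter is at most \<open>2 * \<delta>\<close>.
\<close>

lemma covering_number_diag_map_X_le:
  assumes v: "v \<in> verts G" and x: "x \<in> scales" and ij: "i \<noteq> j" and \<delta>: "0 < \<delta>"
  shows "covering_number (diag_map x q ` X v) (2 * \<delta>) \<le>
    covering_number (proj_X i v) (\<delta> / \<bar>x $ i\<bar>) * covering_number (proj_X j v) (\<delta> / \<bar>x $ j\<bar>)"
proof -
  have pos: "0 < \<bar>x $ k\<bar>" for k using x by (auto simp: scales_def)
  have ex: "\<exists>\<C>. finite \<C> \<and> card \<C> = covering_number (proj_X k v) (\<delta> / \<bar>x $ k\<bar>) \<and> proj_X k v \<subseteq> \<Union>\<C> \<and>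
      (\<forall>U\<in>\<C>. bounded U \<and> diameter U \<le> \<delta> / \<bar>x $ k\<bar>)" for k
    using optimal_cover[OF compact_proj_X[OF v], of "\<delta> / \<bar>x $ k\<bar>" k] \<delta> pos by (metis divide_pos_pos)
  obtain A where A: "finite A" "card A = covering_number (proj_X i v) (\<delta> / \<bar>x $ i\<bar>)" "proj_X i v \<subseteq> \<Union>A"
    "\<And>U. U \<in> A \<Longrightarrow> bounded U \<and> diameter U \<le> \<delta> / \<bar>x $ i\<bar>" using ex[of i] by auto
  obtain B where B: "finite B" "card B = covering_number (proj_X j v) (\<delta> / \<bar>x $ j\<bar>)" "proj_X j v \<subseteq> \<Union>B"
    "\<And>U. U \<in> B \<Longrightarrow> bounded U \<and> diameter U \<le> \<delta> / \<bar>x $ j\<bar>" using ex[of j] by auto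
  define f where "f k \<zeta> = (\<zeta> $ k - q $ k) / x $ k" for k and \<zeta> :: "real^2"
  define W where "W = (\<lambda>(U, V). {\<zeta>. f i \<zeta> \<in> U \<and> f j \<zeta> \<in> V})"
  have close: "\<bar>(\<zeta> - \<omega>) $ k\<bar> \<le> \<delta>" if "bounded U" "diameter U \<le> \<delta> / \<bar>x $ k\<bar>" "f k \<zeta> \<in> U" "f k \<omega> \<in> U"
    for k U and \<zeta> \<omega> :: "real^2"
  proof -
    have "dist (f k \<zeta>) (f k \<omega>) \<le> \<delta> / \<bar>x $ k\<bar>" using diameter_bounded_bound[OF that(1,3,4)] that(2) by simp
    moreover have "dist (f k \<zeta>) (f k \<omega>) = \<bar>(\<zeta> - \<omega>) $ k\<bar> / \<bar>x $ k\<bar>"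
      by (simp add: f_def dist_real_def diff_divide_distrib[symmetric])
    ultimately show ?thesis using pos[of k] by (simp add: divide_le_cancel)
  qed
  have "covering_number (diag_map x q ` X v) (2 * \<delta>) \<le> card (W ` (A \<times> B))"
  proof (rule covering_number_le)
    show "diag_map x q ` X v \<subseteq> \<Union>(W ` (A \<times> B))"
    proof
      fix \<zeta> assume "\<zeta> \<in> diag_map x q ` X v"
      then obtain \<xi> where \<xi>: "\<xi> \<in> X v" "\<zeta> = diag_map x q \<xi>" by auto
      have "f k \<zeta> = \<xi> $ k" for k using pos[of k] by (simp add: f_def \<xi>(2))
      moreover obtain U V where "U \<in> A" "\<xi> $ i \<in> U" "V \<in> B" "\<xi> $ j \<in> V"
        using A(3) B(3) \<xi>(1) unfolding proj_X_def by blast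
      ultimately show "\<zeta> \<in> \<Union>(W ` (A \<times> B))" by (auto simp: W_def)
    qed
    fix Z assume "Z \<in> W ` (A \<times> B)"
    then obtain U V where UV: "U \<in> A" "V \<in> B" "Z = {\<zeta>. f i \<zeta> \<in> U \<and> f j \<zeta> \<in> V}" by (auto simp: W_def)
    show "bounded Z \<and> diameter Z \<le> 2 * \<delta>"
    proof (rule bounded_diameter_le)
      fix \<zeta> \<omega> assume Z: "\<zeta> \<in> Z" "\<omega> \<in> Z"
      have "dist \<zeta> \<omega> \<le> (\<Sum>k\<in>UNIV. \<bar>(\<zeta> - \<omega>) $ k\<bar>)" unfolding dist_norm by (rule norm_le_l1_cart)
      also have "\<dots> = \<bar>(\<zeta> - \<omega>) $ i\<bar> + \<bar>(\<zeta> - \<omega>) $ j\<bar>" using ij by (simp add: UNIV_two_axes[OF ij])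
      also have "\<dots> \<le> \<delta> + \<delta>"
        using close[of U i \<zeta> \<omega>] close[of V j \<zeta> \<omega>] A(4)[OF UV(1)] B(4)[OF UV(2)] Z UV(3)
        by (intro add_mono) auto
      finally show "dist \<zeta> \<omega> \<le> 2 * \<delta>" by simp
    qed (use \<delta> in simp)
  qed (use A B in simp)
  also have "\<dots> \<le> card (A \<times> B)" using A B by (intro card_image_le) simp
  also have "\<dots> = card A * card B" by (rule card_cartesian_product)
  finally show ?thesis using A B by simp
qed

lemma covering_number_proj_X_le_1:
  assumes "v \<in> verts G" "1 \<le> \<delta>"
  shows "covering_number (proj_X j v) \<delta> \<le> 1"
proof -
  have "bounded (proj_X j v) \<and> diameter (proj_X j v) \<le> 1"
  proof (rule bounded_diameter_le)
    fix y z assume "y \<in> proj_X j v" "z \<in> proj_X j v"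
    then have "y \<in> {0..1}" "z \<in> {0..1}" using proj_X_unit_interval[OF assms(1)] by blast+
    then show "dist y z \<le> 1" by (auto simp: dist_real_def)
  qed simp
  then show ?thesis using assms(2) by (intro covering_number_le_1) auto
qed

text \<open>
  The projection to the short axis is a single covering set.
\<close>

lemma covering_number_thin_le:
  assumes v: "v \<in> verts G" and x: "x \<in> scales" and ij: "i \<noteq> j" and \<delta>: "0 < \<delta>" "\<bar>x $ j\<bar> \<le> \<delta>"
  shows "covering_number (diag_map x q ` X v) (2 * \<delta>) \<le> covering_number (proj_X i v) (\<delta> / \<bar>x $ i\<bar>)"
proof -
  have "0 < \<bar>x $ j\<bar>" using x by (auto simp: scales_def)
  then have "covering_number (proj_X j v) (\<delta> / \<bar>x $ j\<bar>) \<le> 1" using \<delta> by (intro covering_number_proj_X_le_1 v) simp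
  then have "covering_number (proj_X i v) (\<delta> / \<bar>x $ i\<bar>) * covering_number (proj_X j v) (\<delta> / \<bar>x $ j\<bar>)
      \<le> covering_number (proj_X i v) (\<delta> / \<bar>x $ i\<bar>) * 1" by (rule mult_left_mono) simp
  then show ?thesis using covering_number_diag_map_X_le[OF v x ij \<delta>(1), of q] by linarith
qed

lemma covering_number_axis_le:
  assumes v: "v \<in> verts G" and x: "x \<in> scales" and \<delta>: "0 < \<delta>"
  shows "covering_number (proj_X i v) (\<delta> / \<bar>x $ i\<bar>) \<le> covering_number (diag_map x q ` X v) \<delta>"
proof -
  let ?g = "\<lambda>\<zeta>::real^2. (\<zeta> $ i - q $ i) / x $ i"
  have pos: "0 < \<bar>x $ i\<bar>" using x by (auto simp: scales_def)
  have "covering_number (?g ` diag_map x q ` X v) (\<delta> / \<bar>x $ i\<bar>) \<le> covering_number (diag_map x q ` X v) \<delta>"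
  proof (rule covering_number_lipschitz_image[OF compact_diag_map_X[OF v] \<delta>])
    show "dist (?g y) (?g z) \<le> 1 / \<bar>x $ i\<bar> * dist y z" for y z
    proof -
      have "dist (?g y) (?g z) = 1 / \<bar>x $ i\<bar> * \<bar>(y - z) $ i\<bar>"
        by (simp add: dist_real_def diff_divide_distrib[symmetric])
      also have "\<dots> \<le> 1 / \<bar>x $ i\<bar> * dist y z"
        unfolding dist_norm by (intro mult_left_mono component_le_norm_cart) auto
      finally show ?thesis .
    qed
  qed auto
  moreover have "?g ` diag_map x q ` X v = proj_X i v" using pos by (simp add: image_image proj_X_def)
  ultimately show ?thesis by simp
qed

text \<open>
  The exponents of the transfer matrices in the definition of \<open>\<gamma>\<^sub>A\<close> (for \<open>k = 1\<close>) and \<open>\<gamma>\<^sub>B\<close> (for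
  \<open>k = 2\<close>).
\<close>

definition expo :: "2 \<Rightarrow> real \<Rightarrow> 2 \<Rightarrow> real" where
  "expo k s i = (if i = k then axis_dim k else s - axis_dim k)"

text \<open>
  For thin rectangles the bound is that of the weight of the long axis. For the others it follows
  from the bounds for the rectangles of the next generation, because covering numbers are subadditive
  and the functions \<open>H k\<close> are superinvariant.
\<close>

lemma covering_number_X_upper:
  assumes s: "\<And>k. \<rho> (expo k s) < 1" and \<epsilon>: "0 < \<epsilon>"
  shows "\<exists>K>0. \<forall>v\<in>verts G. \<forall>\<delta>. 0 < \<delta> \<and> \<delta> \<le> 1 \<longrightarrow>
    real (covering_number (X v) (2 * \<delta>)) \<le> K * \<delta> powr (- s - \<epsilon>)"
proof -
  have "\<forall>k. \<exists>H. (\<forall>v\<in>verts G. 0 < H v) \<and>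
      (\<forall>v\<in>verts G. (\<Sum>e\<in>out_arcs G v. weight (expo k s) (ratio e) * H (head G e)) \<le> H v)"
    using vertex_superinvariant[OF s] by metis
  then obtain H where H: "\<And>k v. v \<in> verts G \<Longrightarrow> 0 < H k v"
    "\<And>k v. v \<in> verts G \<Longrightarrow> (\<Sum>e\<in>out_arcs G v. weight (expo k s) (ratio e) * H k (head G e)) \<le> H k v"
    by metis
  have "\<exists>h>0. \<forall>a\<in>UNIV \<times> verts G. (\<lambda>(k, v) h. h \<le> H k v) a h"
    using finite_verts H(1) by (intro finite_uniform_lower) auto
  then obtain h0 where h0: "0 < h0" "\<And>k v. v \<in> verts G \<Longrightarrow> h0 \<le> H k v" by auto
  have "\<exists>h>0. \<forall>a\<in>UNIV \<times> verts G. (\<lambda>(k, v) h. H k v \<le> h) a h"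
    using finite_verts H(1) by (intro finite_uniform_upper) auto
  then obtain h1 where h1: "0 < h1" "\<And>k v. v \<in> verts G \<Longrightarrow> H k v \<le> h1" by auto
  obtain C where C: "0 < C" "\<And>i v \<delta>. v \<in> verts G \<Longrightarrow> 0 < \<delta> \<Longrightarrow> \<delta> \<le> 1 / rmin \<Longrightarrow>
      real (covering_number (proj_X i v) \<delta>) \<le> C * \<delta> powr (- axis_dim i - \<epsilon>)"
    using covering_number_proj_X_upper[OF \<epsilon>, of "1 / rmin"] rmin_pos by auto
  define Q where "Q i K \<longleftrightarrow> (\<forall>\<delta> x y. 0 < \<delta> \<longrightarrow> 0 < x \<longrightarrow> x \<le> 1 \<longrightarrow> rmin * \<delta> \<le> y \<longrightarrow> y \<le> \<delta> \<longrightarrow>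
      C * (\<delta> / x) powr (- axis_dim i - \<epsilon>) \<le> K * \<delta> powr (- s - \<epsilon>) * (x powr axis_dim i * y powr (s - axis_dim i)))"
    for i K
  have "\<exists>K>0. \<forall>i\<in>UNIV. Q i K"
  proof (rule finite_uniform_upper)
    show "\<exists>K>0. Q i K" for i
      unfolding Q_def using rmin_pos rmin_less_1 C(1) \<epsilon> by (intro upper_weight_bound) auto
    fix i K K' assume Q: "Q i K" and le: "K \<le> K'"
    have "K * \<delta> powr (- s - \<epsilon>) * (x powr axis_dim i * y powr (s - axis_dim i))
        \<le> K' * \<delta> powr (- s - \<epsilon>) * (x powr axis_dim i * y powr (s - axis_dim i))" for \<delta> x y
      using le by (intro mult_right_mono) auto
    then show "Q i K'" using Q unfolding Q_def by (meson order_trans)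
  qed simp
  then obtain K where K: "0 < K" "\<And>i. Q i K" by auto
  have base: "real (covering_number (diag_map x q ` X v) (2 * \<delta>)) \<le>
      K / h0 * \<delta> powr (- s - \<epsilon>) * (\<Sum>k\<in>UNIV. weight (expo k s) x * H k v)"
    if v: "v \<in> verts G" and x: "x \<in> scales" and \<delta>: "0 < \<delta>" and lo: "\<And>i. rmin * \<delta> \<le> \<bar>x $ i\<bar>"
      and j: "\<bar>x $ j\<bar> \<le> \<delta>" for v x q \<delta> j
  proof -
    obtain i where ij: "i \<noteq> j" using ex_other_axis[of j] by auto
    have pos: "0 < \<bar>x $ i\<bar>" "\<bar>x $ i\<bar> \<le> 1" using x by (auto simp: scales_def)
    have "real (covering_number (diag_map x q ` X v) (2 * \<delta>)) \<le> real (covering_number (proj_X i v) (\<delta> / \<bar>x $ i\<bar>))"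
      using covering_number_thin_le[OF v x ij \<delta> j, of q] by simp
    also have "\<dots> \<le> C * (\<delta> / \<bar>x $ i\<bar>) powr (- axis_dim i - \<epsilon>)"
      using pos \<delta> lo[of i] rmin_pos by (intro C(2)[OF v]) (auto simp: field_simps)
    also have "\<dots> \<le> K * \<delta> powr (- s - \<epsilon>) * (\<bar>x $ i\<bar> powr axis_dim i * \<bar>x $ j\<bar> powr (s - axis_dim i))"
      using K(2)[of i] \<delta> pos lo[of j] j unfolding Q_def by blast
    also have "\<dots> = K * \<delta> powr (- s - \<epsilon>) * weight (expo i s) x"
      using ij by (simp add: weight_two_axes[OF ij] expo_def)
    also have "\<dots> \<le> (K * \<delta> powr (- s - \<epsilon>) * weight (expo i s) x) * (H i v / h0)"
      using K(1) h0(2)[OF v, of i] h0(1) weight_nonneg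
      mult_left_mono[of 1 "H i v / h0" "K * \<delta> powr (- s - \<epsilon>) * weight (expo i s) x"] by simp
    also have "\<dots> = K / h0 * \<delta> powr (- s - \<epsilon>) * (weight (expo i s) x * H i v)" by simp
    also have "\<dots> \<le> K / h0 * \<delta> powr (- s - \<epsilon>) * (\<Sum>k\<in>UNIV. weight (expo k s) x * H k v)"
      using K(1) h0(1) H(1)[OF v] weight_nonneg
      by (intro mult_left_mono member_le_sum mult_nonneg_nonneg) (auto intro: less_imp_le)
    finally show ?thesis .
  qed
  have claim: "real (covering_number (diag_map x q ` X v) (2 * \<delta>)) \<le>
      K / h0 * \<delta> powr (- s - \<epsilon>) * (\<Sum>k\<in>UNIV. weight (expo k s) x * H k v)"
    if "v \<in> verts G" "x \<in> scales" "0 < \<delta>" "\<And>i. rmin * \<delta> \<le> \<bar>x $ i\<bar>" "\<exists>i. rmax ^ n * \<bar>x $ i\<bar> \<le> \<delta>"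
    for n v x q \<delta>
    using that
  proof (induction n arbitrary: v x q)
    case (0 v x q)
    then obtain j where "\<bar>x $ j\<bar> \<le> \<delta>" by auto
    then show ?case using base 0 by blast
  next
    case (Suc n v x q)
    show ?case
    proof (cases "\<exists>j. \<bar>x $ j\<bar> \<le> \<delta>")
      case True
      then show ?thesis using base Suc.prems by blast
    next
      case False
      let ?c = "K / h0 * \<delta> powr (- s - \<epsilon>)"
      have c0: "0 \<le> ?c" using K(1) h0(1) by simp
      have child: "real (covering_number (diag_map (x * ratio e) (x * t e + q) ` X (head G e)) (2 * \<delta>))
          \<le> ?c * (\<Sum>k\<in>UNIV. weight (expo k s) (x * ratio e) * H k (head G e))" if e: "e \<in> out_arcs G v" for e
      proof (rule Suc.IH)
        have ae: "e \<in> arcs G" using e by simp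
        show "head G e \<in> verts G" "x * ratio e \<in> scales"
          using head_in[OF e] scales_mult[OF Suc.prems(2) ratio_in_scales[OF ae]] by auto
        show "rmin * \<delta> \<le> \<bar>(x * ratio e) $ i\<bar>" for i
        proof -
          have "\<delta> * rmin \<le> \<bar>x $ i\<bar> * \<bar>ratio e $ i\<bar>"
            using False ratio_bounds(1)[OF ae] rmin_pos Suc.prems(3) by (intro mult_mono) (auto simp: not_le less_imp_le)
          then show ?thesis by (simp add: abs_mult mult.commute)
        qed
        obtain i where i: "rmax ^ Suc n * \<bar>x $ i\<bar> \<le> \<delta>" using Suc.prems(5) by auto
        have "(rmax ^ n * \<bar>x $ i\<bar>) * \<bar>ratio e $ i\<bar> \<le> (rmax ^ n * \<bar>x $ i\<bar>) * rmax"
          using ratio_bounds(2)[OF ae] rmax_pos by (intro mult_left_mono) auto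
        then have "rmax ^ n * \<bar>(x * ratio e) $ i\<bar> \<le> \<delta>" using i by (simp add: abs_mult algebra_simps)
        then show "\<exists>i. rmax ^ n * \<bar>(x * ratio e) $ i\<bar> \<le> \<delta>" by blast
      qed (rule Suc.prems(3))
      have "covering_number (diag_map x q ` X v) (2 * \<delta>)
          \<le> (\<Sum>e\<in>out_arcs G v. covering_number (diag_map (x * ratio e) (x * t e + q) ` X (head G e)) (2 * \<delta>))"
        unfolding diag_map_X_eq[OF Suc.prems(1)]
        using Suc.prems(3) by (intro covering_number_UN_le finite_out compact_diag_map_X head_in) auto
      then have "real (covering_number (diag_map x q ` X v) (2 * \<delta>))
          \<le> (\<Sum>e\<in>out_arcs G v. real (covering_number (diag_map (x * ratio e) (x * t e + q) ` X (head G e)) (2 * \<delta>)))"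
        by (simp flip: of_nat_sum)
      also have "\<dots> \<le> (\<Sum>e\<in>out_arcs G v. ?c * (\<Sum>k\<in>UNIV. weight (expo k s) (x * ratio e) * H k (head G e)))"
        using child by (rule sum_mono)
      also have "\<dots> = ?c * (\<Sum>k\<in>UNIV. weight (expo k s) x * (\<Sum>e\<in>out_arcs G v. weight (expo k s) (ratio e) * H k (head G e)))"
        unfolding sum_distrib_left weight_mult by (subst sum.swap) (simp add: mult.assoc)
      also have "\<dots> \<le> ?c * (\<Sum>k\<in>UNIV. weight (expo k s) x * H k v)"
        using H(2)[OF Suc.prems(1)] c0 weight_nonneg by (intro mult_left_mono sum_mono) auto
      finally show ?thesis .
    qed
  qed
  have "real (covering_number (X v) (2 * \<delta>)) \<le> (K / h0 * (2 * h1)) * \<delta> powr (- s - \<epsilon>)"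
    if v: "v \<in> verts G" and \<delta>: "0 < \<delta>" "\<delta> \<le> 1" for v \<delta>
  proof -
    obtain n where n: "rmax ^ n < \<delta>" using real_arch_pow_inv[OF \<delta>(1) rmax_less_1] by blast
    have "rmin * \<delta> \<le> 1" using rmin_pos rmin_less_1 \<delta> by (simp add: mult_le_one)
    then have "real (covering_number (diag_map 1 0 ` X v) (2 * \<delta>)) \<le>
        K / h0 * \<delta> powr (- s - \<epsilon>) * (\<Sum>k\<in>UNIV. weight (expo k s) 1 * H k v)"
      using n by (intro claim[OF v one_in_scales \<delta>(1), of n]) auto
    also have "\<dots> \<le> K / h0 * \<delta> powr (- s - \<epsilon>) * (\<Sum>k\<in>(UNIV::2 set). h1)"
      using h1(2)[OF v] K(1) h0(1) by (intro mult_left_mono sum_mono) auto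
    finally show ?thesis by (simp add: algebra_simps)
  qed
  then show ?thesis using K(1) h0(1) h1(1) by (intro exI[of _ "K / h0 * (2 * h1)"]) auto
qed

lemma covering_number_X_trivial_upper:
  assumes \<epsilon>: "0 < \<epsilon>" and v: "v \<in> verts G"
  shows "\<exists>K>0. \<forall>\<delta>. 0 < \<delta> \<and> \<delta> \<le> 1 \<longrightarrow>
    real (covering_number (X v) (2 * \<delta>)) \<le> K * \<delta> powr (- (axis_dim 1 + axis_dim 2) - 2 * \<epsilon>)"
proof -
  obtain C where C: "0 < C" "\<And>i v \<delta>. v \<in> verts G \<Longrightarrow> 0 < \<delta> \<Longrightarrow> \<delta> \<le> 1 \<Longrightarrow>
      real (covering_number (proj_X i v) \<delta>) \<le> C * \<delta> powr (- axis_dim i - \<epsilon>)"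
    using covering_number_proj_X_upper[OF \<epsilon>, of 1] by auto
  have "real (covering_number (X v) (2 * \<delta>)) \<le> (C * C) * \<delta> powr (- (axis_dim 1 + axis_dim 2) - 2 * \<epsilon>)"
    if \<delta>: "0 < \<delta>" "\<delta> \<le> 1" for \<delta>
  proof -
    have "covering_number (diag_map 1 0 ` X v) (2 * \<delta>)
        \<le> covering_number (proj_X 1 v) (\<delta> / \<bar>(1::real^2) $ 1\<bar>) * covering_number (proj_X 2 v) (\<delta> / \<bar>(1::real^2) $ 2\<bar>)"
      by (rule covering_number_diag_map_X_le[OF v one_in_scales _ \<delta>(1)]) simp
    then have "real (covering_number (X v) (2 * \<delta>)) \<le> real (covering_number (proj_X 1 v) \<delta>) * real (covering_number (proj_X 2 v) \<delta>)"
      by (simp flip: of_nat_mult)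
    also have "\<dots> \<le> (C * \<delta> powr (- axis_dim 1 - \<epsilon>)) * (C * \<delta> powr (- axis_dim 2 - \<epsilon>))"
      using C(1) by (intro mult_mono C(2)[OF v \<delta>]) auto
    also have "\<dots> = (C * C) * (\<delta> powr (- axis_dim 1 - \<epsilon>) * \<delta> powr (- axis_dim 2 - \<epsilon>))" by simp
    also have "\<dots> = (C * C) * \<delta> powr (- (axis_dim 1 + axis_dim 2) - 2 * \<epsilon>)"
      by (simp add: powr_add[symmetric] algebra_simps)
    finally show ?thesis .
  qed
  then show ?thesis using C(1) by (intro exI[of _ "C * C"]) auto
qed

end

section \<open>The lower bound\<close>

text \<open>
  The counterpart for lower bounds. Unlike in the upper bound, \<open>a\<close> need not be the dimension \<open>\<tau>\<close> of the
  first projection: for \<open>a \<le> \<tau> + \<eta>\<close> the count \<open>(x / \<delta>) powr \<tau>\<close> still dominates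
  \<open>(x / \<delta>) powr (a - \<eta>)\<close>, because \<open>x / \<delta>\<close> is bounded below. The slack \<open>\<eta>\<close> serves the proof
  that the critical exponents are at most \<open>\<tau>\<^sub>1 + \<tau>\<^sub>2\<close>.
\<close>

lemma lower_weight_bound:
  fixes r c \<tau> a b \<eta> \<epsilon> :: real
  assumes "0 < r" "r \<le> 1" "0 < c" "0 \<le> \<epsilon>" "0 \<le> \<eta>" "a \<le> \<tau> + \<eta>"
  shows "\<exists>K>0. \<forall>\<delta> x y. 0 < \<delta> \<longrightarrow> r * \<delta> \<le> x \<longrightarrow> x \<le> 1 \<longrightarrow> r * \<delta> \<le> y \<longrightarrow> y \<le> \<delta> \<longrightarrow>
    K * \<delta> powr (- (a + b - \<eta> - \<epsilon>)) * (x powr a * y powr b) \<le> c * (\<delta> / x) powr (- \<tau> + \<epsilon>)"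
proof -
  define M where "M = max (r powr b) 1"
  define L where "L = r powr (\<tau> + \<eta> - a)"
  have M: "0 < M" and L: "0 < L" using assms by (auto simp: M_def L_def)
  have "c * L / M * \<delta> powr (- (a + b - \<eta> - \<epsilon>)) * (x powr a * y powr b) \<le> c * (\<delta> / x) powr (- \<tau> + \<epsilon>)"
    if A: "0 < \<delta>" "r * \<delta> \<le> x" "x \<le> 1" "r * \<delta> \<le> y" "y \<le> \<delta>" for \<delta> x y
  proof -
    have x: "0 < x" using A assms(1) by (smt (verit) mult_pos_pos)
    have "\<delta> powr (- (a + b - \<eta> - \<epsilon>)) * (x powr a * y powr b)
        \<le> \<delta> powr (- (a + b - \<eta> - \<epsilon>)) * (x powr a * (M * \<delta> powr b))"
      using powr_between_scaled(2)[OF assms(1,2) A(1,4,5), of b] unfolding M_def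
      by (intro mult_left_mono) auto
    also have "\<dots> = M * (x powr a * \<delta> powr (- (a - \<eta> - \<epsilon>)))"
      by (simp add: powr_add[symmetric] algebra_simps)
    also have "x powr a \<le> x powr (a - \<eta> - \<epsilon>)" using x A(3) assms(4,5) by (intro powr_mono') auto
    then have "M * (x powr a * \<delta> powr (- (a - \<eta> - \<epsilon>))) \<le> M * (x powr (a - \<eta> - \<epsilon>) * \<delta> powr (- (a - \<eta> - \<epsilon>)))"
      using M by (intro mult_left_mono mult_right_mono) auto
    also have "x powr (a - \<eta> - \<epsilon>) * \<delta> powr (- (a - \<eta> - \<epsilon>)) = (x / \<delta>) powr (a - \<eta> - \<epsilon>)"
      using x A(1) powr_divide[of x \<delta> "a - \<eta> - \<epsilon>"] powr_minus_divide[of \<delta> "a - \<eta> - \<epsilon>"] by simp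
    finally have 1: "\<delta> powr (- (a + b - \<eta> - \<epsilon>)) * (x powr a * y powr b) \<le> M * (x / \<delta>) powr (a - \<eta> - \<epsilon>)" .
    have "r \<le> x / \<delta>" using A by (simp add: le_divide_eq)
    then have "L \<le> (x / \<delta>) powr (\<tau> + \<eta> - a)" unfolding L_def using assms by (intro powr_mono2) auto
    then have "(x / \<delta>) powr (a - \<eta> - \<epsilon>) * L \<le> (x / \<delta>) powr (a - \<eta> - \<epsilon>) * (x / \<delta>) powr (\<tau> + \<eta> - a)"
      by (intro mult_left_mono) auto
    also have "\<dots> = (x / \<delta>) powr (\<tau> - \<epsilon>)" by (simp add: powr_add[symmetric])
    also have "\<dots> = (\<delta> / x) powr (- \<tau> + \<epsilon>)"
      using x A(1) by (simp add: powr_divide powr_diff powr_minus powr_add field_simps)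
    finally have 2: "(x / \<delta>) powr (a - \<eta> - \<epsilon>) * L \<le> (\<delta> / x) powr (- \<tau> + \<epsilon>)" .
    have "(c * L / M) * (\<delta> powr (- (a + b - \<eta> - \<epsilon>)) * (x powr a * y powr b))
        \<le> (c * L / M) * (M * (x / \<delta>) powr (a - \<eta> - \<epsilon>))"
      using 1 M L assms(3) by (intro mult_left_mono) auto
    also have "\<dots> = c * ((x / \<delta>) powr (a - \<eta> - \<epsilon>) * L)" using M by simp
    also have "\<dots> \<le> c * (\<delta> / x) powr (- \<tau> + \<epsilon>)" using 2 assms(3) by (intro mult_left_mono) auto
    finally show ?thesis by (simp add: mult.assoc)
  qed
  then show ?thesis using M L assms(3) by (intro exI[of _ "c * L / M"]) auto
qed

text \<open>
  The area of a rectangle inside a neighbourhood of a set of diameter \<open>\<delta>\<close> that contains \<open>u\<close>. The half-width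
  \<open>2 * \<delta>\<close> leaves room for a square of side comparable to \<open>\<delta>\<close> next to any point of that set.
\<close>

definition clip_area :: "real \<Rightarrow> real^2 \<Rightarrow> real^2 \<Rightarrow> real^2 \<Rightarrow> real" where
  "clip_area \<delta> u x q = measure lborel
     (diag_map x q ` open_unit_square \<inter> cbox (\<chi> i. u $ i - 2 * \<delta>) (\<chi> i. u $ i + 2 * \<delta>))"

lemma measure_lborel_square:
  assumes "0 \<le> m"
  shows "measure lborel (cbox l (\<chi> i. l $ i + m) :: (real^2) set) = m\<^sup>2"
proof -
  have "measure lborel (cbox l (\<chi> i. l $ i + m)) = (\<Prod>i\<in>UNIV. (\<chi> i. l $ i + m) $ i - l $ i)"
    using assms by (subst content_cbox_cart) (auto simp: interval_eq_empty_cart)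
  then show ?thesis by (simp add: power2_eq_square UNIV_2)
qed

lemma lmeasurable_clip:
  assumes "x \<in> scales"
  shows "diag_map x q ` open_unit_square \<inter> cbox a b \<in> fmeasurable lborel"
proof -
  have "open (diag_map x q ` open_unit_square)"
    unfolding open_unit_square_eq_box by (rule open_diag_map_image[OF assms open_box])
  then have "diag_map x q ` open_unit_square \<in> sets lborel" by simp
  moreover have "cbox a b \<in> fmeasurable lborel" by (rule fmeasurable_cbox)
  ultimately show ?thesis using fmeasurable_Int_fmeasurable by (metis Int_commute)
qed

lemma clip_area_nonneg: "0 \<le> clip_area \<delta> u x q"
  by (simp add: clip_area_def)

lemma clip_area_le:
  assumes "0 \<le> \<delta>" "x \<in> scales"
  shows "clip_area \<delta> u x q \<le> 16 * \<delta>\<^sup>2"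
proof -
  have e: "(\<chi> i. u $ i + 2 * \<delta>) = (\<chi> i. (\<chi> i. u $ i - 2 * \<delta>) $ i + 4 * \<delta>)" by (simp add: vec_eq_iff)
  have "clip_area \<delta> u x q \<le> measure lborel (cbox (\<chi> i. u $ i - 2 * \<delta>) (\<chi> i. u $ i + 2 * \<delta>))"
    unfolding clip_area_def using fmeasurableD[OF lmeasurable_clip[OF assms(2)]]
    by (intro measure_mono_fmeasurable) auto
  also have "\<dots> = (4 * \<delta>)\<^sup>2"
    unfolding e using assms by (intro measure_lborel_square) auto
  finally show ?thesis by (simp add: power_mult_distrib)
qed

text \<open>
  The interval of length \<open>m\<close> that ends at the given point, shifted to the right if it would otherwise
  leave the interval with end points \<open>q\<close> and \<open>x + q\<close>.
\<close>

lemma interval_in_scaled_interval: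
  fixes x q s m :: real
  assumes "s \<in> {0..1}" "0 < m" "m \<le> \<bar>x\<bar>"
  shows "\<exists>l. \<forall>y. l < y \<and> y < l + m \<longrightarrow> \<bar>y - (x * s + q)\<bar> \<le> m \<and> 0 < (y - q) / x \<and> (y - q) / x < 1"
proof -
  define lo where "lo = min q (x + q)"
  have hi: "max q (x + q) = lo + \<bar>x\<bar>" by (auto simp: lo_def)
  define z where "z = x * s + q"
  have z: "lo \<le> z \<and> z \<le> lo + \<bar>x\<bar>"
  proof (cases "0 < x")
    case True
    then have "0 \<le> x * s" "x * s \<le> x * 1" using assms(1) by (auto simp del: mult_1_right intro!: mult_left_mono)
    then show ?thesis using True by (auto simp: lo_def z_def)
  next
    case False
    then have "x * s \<le> 0" "x * 1 \<le> x * s"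
      using assms(1) mult_left_mono_neg[of s 1 x] by (auto simp: mult_nonpos_nonneg)
    then show ?thesis using False by (auto simp: lo_def z_def)
  qed
  define l where "l = max lo (z - m)"
  have l: "lo \<le> l" "l + m \<le> lo + \<bar>x\<bar>" "z - m \<le> l" "l \<le> z" using z assms by (auto simp: l_def)
  have "\<bar>y - z\<bar> \<le> m \<and> 0 < (y - q) / x \<and> (y - q) / x < 1" if y: "l < y" "y < l + m" for y
  proof (intro conjI)
    show "\<bar>y - z\<bar> \<le> m" using l y by (auto simp: abs_le_iff)
    have yy: "lo < y" "y < lo + \<bar>x\<bar>" using l y by auto
    show "0 < (y - q) / x"
      using yy assms(2,3) by (cases "0 < x") (auto simp: lo_def zero_less_divide_iff)
    show "(y - q) / x < 1"
    proof (cases "0 < x")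
      case True
      then show ?thesis using yy by (simp add: lo_def divide_less_eq)
    next
      case False
      then have "x < 0" using assms(2,3) by auto
      then show ?thesis using yy by (simp add: lo_def divide_less_eq)
    qed
  qed
  then show ?thesis unfolding z_def by blast
qed

lemma clip_area_ge:
  assumes x: "x \<in> scales" and \<xi>: "\<And>i. \<xi> $ i \<in> {0..1}" and m: "0 < m" "m \<le> \<delta>" "\<And>i. m \<le> \<bar>x $ i\<bar>"
    and u: "dist u (diag_map x q \<xi>) \<le> \<delta>"
  shows "m\<^sup>2 \<le> clip_area \<delta> u x q"
proof -
  have "\<forall>i. \<exists>l. \<forall>y. l < y \<and> y < l + m \<longrightarrow> \<bar>y - (x $ i * \<xi> $ i + q $ i)\<bar> \<le> m \<and>
      0 < (y - q $ i) / x $ i \<and> (y - q $ i) / x $ i < 1"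
    using interval_in_scaled_interval[OF \<xi> m(1,3)] by blast
  from choice[OF this] obtain l where l: "\<And>i y. l i < y \<Longrightarrow> y < l i + m \<Longrightarrow>
      \<bar>y - (x $ i * \<xi> $ i + q $ i)\<bar> \<le> m \<and> 0 < (y - q $ i) / x $ i \<and> (y - q $ i) / x $ i < 1" by blast
  let ?l = "\<chi> i. l i"
  let ?B = "box ?l (\<chi> i. ?l $ i + m)"
  have sub: "?B \<subseteq> diag_map x q ` open_unit_square \<inter> cbox (\<chi> i. u $ i - 2 * \<delta>) (\<chi> i. u $ i + 2 * \<delta>)"
  proof
    fix y assume "y \<in> ?B"
    then have y: "l i < y $ i" "y $ i < l i + m" for i by (auto simp: mem_box_cart)
    have "(\<chi> i. (y $ i - q $ i) / x $ i) \<in> open_unit_square"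
      using l[OF y] by (simp add: open_unit_square_def)
    moreover have "y = diag_map x q (\<chi> i. (y $ i - q $ i) / x $ i)"
      using scales_nonzero[OF x] by (simp add: vec_eq_iff)
    ultimately have "y \<in> diag_map x q ` open_unit_square" by (rule image_eqI[rotated])
    have near: "u $ i - 2 * \<delta> \<le> y $ i \<and> y $ i \<le> u $ i + 2 * \<delta>" for i
    proof -
      have "\<bar>(u - diag_map x q \<xi>) $ i\<bar> \<le> \<delta>"
        using component_le_norm_cart[of "u - diag_map x q \<xi>" i] u by (simp add: dist_norm)
      then have "\<bar>u $ i - (x $ i * \<xi> $ i + q $ i)\<bar> \<le> \<delta>" by simp
      moreover have "\<bar>y $ i - (x $ i * \<xi> $ i + q $ i)\<bar> \<le> m" using l[OF y[of i]] by blast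
      ultimately show ?thesis using m(2) by linarith
    qed
    have "y \<in> cbox (\<chi> i. u $ i - 2 * \<delta>) (\<chi> i. u $ i + 2 * \<delta>)"
      using near by (simp add: mem_box_cart)
    with \<open>y \<in> diag_map x q ` open_unit_square\<close>
    show "y \<in> diag_map x q ` open_unit_square \<inter> cbox (\<chi> i. u $ i - 2 * \<delta>) (\<chi> i. u $ i + 2 * \<delta>)" by blast
  qed
  have "m\<^sup>2 = measure lborel (cbox ?l (\<chi> i. ?l $ i + m))" using m(1) by (intro measure_lborel_square[symmetric]) simp
  also have "\<dots> = measure lborel ?B" by (simp only: measure_lborel_box_eq measure_lborel_cbox_eq)
  also have "\<dots> \<le> clip_area \<delta> u x q"
    unfolding clip_area_def using sub lmeasurable_clip[OF x] by (intro measure_mono_fmeasurable) auto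
  finally show ?thesis .
qed

context box_carpet
begin

text \<open>
  The only place where the disjointness in the rectangular open set condition is used.
\<close>

lemma clip_area_sum_le:
  assumes v: "v \<in> verts G" and x: "x \<in> scales"
  shows "(\<Sum>e\<in>out_arcs G v. clip_area \<delta> u (x * ratio e) (x * t e + q)) \<le> clip_area \<delta> u x q"
proof -
  let ?S = "\<lambda>e. diag_map (x * ratio e) (x * t e + q) ` open_unit_square \<inter>
    cbox (\<chi> i. u $ i - 2 * \<delta>) (\<chi> i. u $ i + 2 * \<delta>)"
  have S: "?S e \<in> fmeasurable lborel" if "e \<in> out_arcs G v" for e
    using that by (intro lmeasurable_clip scales_mult[OF x] ratio_in_scales) simp
  have "(\<Sum>e\<in>out_arcs G v. clip_area \<delta> u (x * ratio e) (x * t e + q)) = (\<Sum>e\<in>out_arcs G v. measure lborel (?S e))"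
    by (simp add: clip_area_def)
  also have "\<dots> = measure lborel (\<Union>e\<in>out_arcs G v. ?S e)"
  proof (rule measure_UNION_AE[symmetric])
    show "pairwise (\<lambda>e e'. AE z in lborel. z \<notin> ?S e \<or> z \<notin> ?S e') (out_arcs G v)"
    proof (rule pairwiseI)
      fix e e' assume e: "e \<in> out_arcs G v" "e' \<in> out_arcs G v" "e \<noteq> e'"
      have "?S e \<inter> ?S e' = {}" using disjoint_family_onD[OF rosc_disjoint[OF v x] e] by blast
      then show "AE z in lborel. z \<notin> ?S e \<or> z \<notin> ?S e'" by (intro AE_I2) blast
    qed
  qed (use S finite_out in auto)
  also have "\<dots> \<le> clip_area \<delta> u x q"
    unfolding clip_area_def
  proof (rule measure_mono_fmeasurable)
    show "(\<Union>e\<in>out_arcs G v. ?S e) \<subseteq> diag_map x q ` open_unit_square \<inter>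
        cbox (\<chi> i. u $ i - 2 * \<delta>) (\<chi> i. u $ i + 2 * \<delta>)"
      using rosc_subset[OF v] by blast
    show "(\<Union>e\<in>out_arcs G v. ?S e) \<in> sets lborel" using fmeasurableD[OF S] finite_out by (intro sets.finite_UN)
  qed (rule lmeasurable_clip[OF x])
  finally show ?thesis .
qed

text \<open>
  Fix a cover by sets of diameter at most \<open>\<delta>\<close>. For a thin rectangle, the weight is, up to a factor, a lower bound for the
  number of covering sets that meet it, and each of these contributes at least \<open>(rmin * \<delta>)\<^sup>2\<close> to the sum of
  the clipped areas. Subinvariance of \<open>H\<close> and superadditivity of area carry the resulting inequality
  over to larger rectangles. In the end every clipped area is at most \<open>16 * \<delta>\<^sup>2\<close>. Since \<open>H\<close> may vanish at
  \<open>v\<close>, the argument is applied to a copy of \<open>X w\<close> inside \<open>X v\<close> with \<open>H w > 0\<close>.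
\<close>

lemma covering_number_X_lower:
  assumes \<rho>: "1 \<le> \<rho> \<alpha>" and \<alpha>: "\<And>i. \<alpha> i \<le> axis_dim i + \<eta>" and \<eta>: "0 \<le> \<eta>" and \<epsilon>: "0 < \<epsilon>"
    and v: "v \<in> verts G"
  shows "\<exists>K>0. \<exists>\<delta>\<^sub>0>0. \<forall>\<delta>. 0 < \<delta> \<and> \<delta> < \<delta>\<^sub>0 \<longrightarrow>
    K * \<delta> powr (- (\<alpha> 1 + \<alpha> 2 - \<eta> - \<epsilon>)) \<le> real (covering_number (X v) \<delta>)"
proof -
  define s where "s = \<alpha> 1 + \<alpha> 2 - \<eta> - \<epsilon>"
  obtain H where H: "\<And>v. 0 \<le> H v" "\<exists>v\<in>verts G. 0 < H v"
    "\<And>v. v \<in> verts G \<Longrightarrow> H v \<le> (\<Sum>e\<in>out_arcs G v. weight \<alpha> (ratio e) * H (head G e))"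
    by (rule vertex_subinvariant[OF \<rho>]) blast
  obtain w where w: "w \<in> verts G" "0 < H w" using H(2) by blast
  obtain x0 q0 where x0: "x0 \<in> scales" "diag_map x0 q0 ` X w \<subseteq> X v" using copy_along_walk[OF w(1) v] by blast
  have "\<exists>h>0. \<forall>a\<in>verts G. (\<lambda>v h. H v \<le> h) a h"
  proof (rule finite_uniform_upper[OF finite_verts])
    show "\<exists>h>0. H a \<le> h" for a using H(1)[of a] by (intro exI[of _ "H a + 1"]) auto
  qed auto
  then obtain h1 where h1: "0 < h1" "\<And>v. v \<in> verts G \<Longrightarrow> H v \<le> h1" by auto
  obtain c where c: "0 < c" "\<And>i v \<delta>. v \<in> verts G \<Longrightarrow> 0 < \<delta> \<Longrightarrow> \<delta> \<le> 1 / rmin \<Longrightarrow>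
      c * \<delta> powr (- axis_dim i + \<epsilon>) \<le> real (covering_number (proj_X i v) \<delta>)"
    using covering_number_proj_X_lower[OF \<epsilon>, of "1 / rmin"] rmin_pos by auto
  define Q where "Q = (\<lambda>(i, j) K. i \<noteq> j \<longrightarrow> (\<forall>\<delta> x y. 0 < \<delta> \<longrightarrow> rmin * \<delta> \<le> x \<longrightarrow> x \<le> 1 \<longrightarrow> rmin * \<delta> \<le> y \<longrightarrow> y \<le> \<delta> \<longrightarrow>
      K * \<delta> powr (- (\<alpha> i + \<alpha> j - \<eta> - \<epsilon>)) * (x powr \<alpha> i * y powr \<alpha> j) \<le> c * (\<delta> / x) powr (- axis_dim i + \<epsilon>)))"
  have "\<exists>K>0. \<forall>a\<in>UNIV. Q a K"
  proof (rule finite_uniform_lower)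
    fix a :: "2 \<times> 2"
    obtain i j where a: "a = (i, j)" by (cases a)
    show "\<exists>K>0. Q a K"
      using lower_weight_bound[of rmin c \<epsilon> \<eta> "\<alpha> i" "axis_dim i" "\<alpha> j"] rmin_pos rmin_less_1 c(1) \<epsilon> \<eta> \<alpha>[of i]
      unfolding a Q_def by auto
  next
    fix a :: "2 \<times> 2" and K K' :: real assume Q: "Q a K" and le: "K' \<le> K"
    obtain i j where a: "a = (i, j)" by (cases a)
    have "K' * \<delta> powr (- (\<alpha> i + \<alpha> j - \<eta> - \<epsilon>)) * (x powr \<alpha> i * y powr \<alpha> j)
        \<le> K * \<delta> powr (- (\<alpha> i + \<alpha> j - \<eta> - \<epsilon>)) * (x powr \<alpha> i * y powr \<alpha> j)" for \<delta> x y
      using le by (intro mult_right_mono) auto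
    then show "Q a K'" using Q unfolding Q_def a prod.case by (meson order_trans)
  qed simp
  then obtain K where K: "0 < K" "\<And>i j. Q (i, j) K" by auto
  have two: "\<alpha> i + \<alpha> j - \<eta> - \<epsilon> = s" if "i \<noteq> j" for i j :: 2
    using that exhaust_2[of i] exhaust_2[of j] by (auto simp: s_def)
  have base: "K / h1 * \<delta> powr (- s) * (weight \<alpha> x * H v) * (rmin * \<delta>)\<^sup>2 \<le> (\<Sum>U\<in>\<C>. clip_area \<delta> (u U) x q)"
    if v: "v \<in> verts G" and x: "x \<in> scales" and \<delta>: "0 < \<delta>" and lo: "\<And>i. rmin * \<delta> \<le> \<bar>x $ i\<bar>"
      and j: "\<bar>x $ j\<bar> \<le> \<delta>" and C: "finite \<C>" "\<And>U. U \<in> \<C> \<Longrightarrow> bounded U" "\<And>U. U \<in> \<C> \<Longrightarrow> diameter U \<le> \<delta>"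
      and u: "\<And>U. U \<in> \<C> \<Longrightarrow> U \<noteq> {} \<Longrightarrow> u U \<in> U" and cover: "diag_map x q ` X v \<subseteq> \<Union>\<C>"
    for v x q \<delta> j \<C> u
  proof -
    obtain i where ij: "i \<noteq> j" using ex_other_axis[of j] by auto
    have pos: "0 < \<bar>x $ i\<bar>" "\<bar>x $ i\<bar> \<le> 1" using x by (auto simp: scales_def)
    define \<D> where "\<D> = {U \<in> \<C>. U \<inter> diag_map x q ` X v \<noteq> {}}"
    have fin: "finite \<D>" using C(1) by (simp add: \<D>_def)
    have "K * \<delta> powr (- s) * weight \<alpha> x \<le> c * (\<delta> / \<bar>x $ i\<bar>) powr (- axis_dim i + \<epsilon>)"
      using K(2)[of i j] \<delta> lo[of i] pos(2) lo[of j] j unfolding Q_def prod.case weight_two_axes[OF ij] two[OF ij]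
      using ij by blast
    also have "\<dots> \<le> real (covering_number (proj_X i v) (\<delta> / \<bar>x $ i\<bar>))"
      using pos \<delta> lo[of i] rmin_pos by (intro c(2)[OF v]) (auto simp: field_simps)
    also have "\<dots> \<le> real (covering_number (diag_map x q ` X v) \<delta>)"
      using covering_number_axis_le[OF v x \<delta>, of i q] by simp
    also have "covering_number (diag_map x q ` X v) \<delta> \<le> card \<D>"
    proof (rule covering_number_le[OF fin])
      show "diag_map x q ` X v \<subseteq> \<Union>\<D>" using cover unfolding \<D>_def by blast
    qed (use C in \<open>auto simp: \<D>_def\<close>)
    finally have D: "K * \<delta> powr (- s) * weight \<alpha> x \<le> real (card \<D>)" by simp
    have "K / h1 * \<delta> powr (- s) * (weight \<alpha> x * H v) = (K * \<delta> powr (- s) * weight \<alpha> x) * (H v / h1)" by simp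
    also have "\<dots> \<le> (K * \<delta> powr (- s) * weight \<alpha> x) * 1"
      using h1(1) h1(2)[OF v] K(1) weight_nonneg by (intro mult_left_mono mult_nonneg_nonneg) auto
    also have "\<dots> \<le> real (card \<D>)" using D by simp
    finally have "K / h1 * \<delta> powr (- s) * (weight \<alpha> x * H v) * (rmin * \<delta>)\<^sup>2 \<le> real (card \<D>) * (rmin * \<delta>)\<^sup>2"
      by (intro mult_right_mono) auto
    also have "\<dots> = (\<Sum>U\<in>\<D>. (rmin * \<delta>)\<^sup>2)" by simp
    also have "\<dots> \<le> (\<Sum>U\<in>\<D>. clip_area \<delta> (u U) x q)"
    proof (rule sum_mono)
      fix U assume "U \<in> \<D>"
      then obtain \<xi> where U: "U \<in> \<C>" "\<xi> \<in> X v" "diag_map x q \<xi> \<in> U" by (auto simp: \<D>_def)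
      then have "u U \<in> U" using u by blast
      then have "dist (u U) (diag_map x q \<xi>) \<le> \<delta>"
        using diameter_bounded_bound[OF C(2)[OF U(1)] _ U(3)] C(3)[OF U(1)] by fastforce
      moreover have "rmin * \<delta> \<le> \<delta>" using rmin_less_1 \<delta> by simp
      ultimately show "(rmin * \<delta>)\<^sup>2 \<le> clip_area \<delta> (u U) x q"
        using X_unit_square[OF v U(2)] rmin_pos \<delta> lo by (intro clip_area_ge[OF x, of \<xi>]) auto
    qed
    also have "\<dots> \<le> (\<Sum>U\<in>\<C>. clip_area \<delta> (u U) x q)"
      using C(1) clip_area_nonneg by (intro sum_mono2) (auto simp: \<D>_def)
    finally show ?thesis .
  qed
  have claim: "K / h1 * \<delta> powr (- s) * (weight \<alpha> x * H v) * (rmin * \<delta>)\<^sup>2 \<le> (\<Sum>U\<in>\<C>. clip_area \<delta> (u U) x q)"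
    if "v \<in> verts G" "x \<in> scales" "0 < \<delta>" "\<And>i. rmin * \<delta> \<le> \<bar>x $ i\<bar>" "\<exists>i. rmax ^ n * \<bar>x $ i\<bar> \<le> \<delta>"
      "finite \<C>" "\<And>U. U \<in> \<C> \<Longrightarrow> bounded U" "\<And>U. U \<in> \<C> \<Longrightarrow> diameter U \<le> \<delta>"
      "\<And>U. U \<in> \<C> \<Longrightarrow> U \<noteq> {} \<Longrightarrow> u U \<in> U" "diag_map x q ` X v \<subseteq> \<Union>\<C>"
    for n v x q \<delta> \<C> u
    using that
  proof (induction n arbitrary: v x q)
    case (0 v x q)
    then obtain j where "\<bar>x $ j\<bar> \<le> \<delta>" by auto
    from base[OF 0(1-4) this 0(6-10)] show ?case .
  next
    case (Suc n v x q)
    show ?case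
    proof (cases "\<exists>j. \<bar>x $ j\<bar> \<le> \<delta>")
      case True
      then obtain j where "\<bar>x $ j\<bar> \<le> \<delta>" by auto
      from base[OF Suc.prems(1-4) this Suc.prems(6-10)] show ?thesis .
    next
      case False
      let ?c = "K / h1 * \<delta> powr (- s)"
      have child: "?c * (weight \<alpha> (x * ratio e) * H (head G e)) * (rmin * \<delta>)\<^sup>2
          \<le> (\<Sum>U\<in>\<C>. clip_area \<delta> (u U) (x * ratio e) (x * t e + q))" if e: "e \<in> out_arcs G v" for e
      proof (rule Suc.IH)
        have ae: "e \<in> arcs G" using e by simp
        show "head G e \<in> verts G" "x * ratio e \<in> scales"
          using head_in[OF e] scales_mult[OF Suc.prems(2) ratio_in_scales[OF ae]] by auto
        show "rmin * \<delta> \<le> \<bar>(x * ratio e) $ i\<bar>" for i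
        proof -
          have "\<delta> * rmin \<le> \<bar>x $ i\<bar> * \<bar>ratio e $ i\<bar>"
            using False ratio_bounds(1)[OF ae] rmin_pos Suc.prems(3) by (intro mult_mono) (auto simp: not_le less_imp_le)
          then show ?thesis by (simp add: abs_mult mult.commute)
        qed
        obtain i where i: "rmax ^ Suc n * \<bar>x $ i\<bar> \<le> \<delta>" using Suc.prems(5) by auto
        have "(rmax ^ n * \<bar>x $ i\<bar>) * \<bar>ratio e $ i\<bar> \<le> (rmax ^ n * \<bar>x $ i\<bar>) * rmax"
          using ratio_bounds(2)[OF ae] rmax_pos by (intro mult_left_mono) auto
        then have "rmax ^ n * \<bar>(x * ratio e) $ i\<bar> \<le> \<delta>" using i by (simp add: abs_mult algebra_simps)
        then show "\<exists>i. rmax ^ n * \<bar>(x * ratio e) $ i\<bar> \<le> \<delta>" by blast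
        show "diag_map (x * ratio e) (x * t e + q) ` X (head G e) \<subseteq> \<Union>\<C>"
          using Suc.prems(10) e unfolding diag_map_X_eq[OF Suc.prems(1)] by blast
      qed (use Suc.prems in auto)
      have "?c * (weight \<alpha> x * H v) * (rmin * \<delta>)\<^sup>2
          \<le> ?c * (weight \<alpha> x * (\<Sum>e\<in>out_arcs G v. weight \<alpha> (ratio e) * H (head G e))) * (rmin * \<delta>)\<^sup>2"
        using H(3)[OF Suc.prems(1)] K(1) h1(1) weight_nonneg by (intro mult_right_mono mult_left_mono) auto
      also have "\<dots> = (\<Sum>e\<in>out_arcs G v. ?c * (weight \<alpha> (x * ratio e) * H (head G e)) * (rmin * \<delta>)\<^sup>2)"
        unfolding sum_distrib_left sum_distrib_right weight_mult by (simp add: mult.assoc)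
      also have "\<dots> \<le> (\<Sum>e\<in>out_arcs G v. \<Sum>U\<in>\<C>. clip_area \<delta> (u U) (x * ratio e) (x * t e + q))"
        using child by (rule sum_mono)
      also have "\<dots> = (\<Sum>U\<in>\<C>. \<Sum>e\<in>out_arcs G v. clip_area \<delta> (u U) (x * ratio e) (x * t e + q))"
        by (rule sum.swap)
      also have "\<dots> \<le> (\<Sum>U\<in>\<C>. clip_area \<delta> (u U) x q)"
        by (intro sum_mono clip_area_sum_le Suc.prems)
      finally show ?thesis .
    qed
  qed
  define \<delta>\<^sub>0 where "\<delta>\<^sub>0 = min \<bar>x0 $ 1\<bar> \<bar>x0 $ 2\<bar>"
  have \<delta>0: "0 < \<delta>\<^sub>0" "\<And>i. \<delta>\<^sub>0 \<le> \<bar>x0 $ i\<bar>"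
  proof -
    show "0 < \<delta>\<^sub>0" using x0(1) by (auto simp: \<delta>\<^sub>0_def scales_def)
    show "\<delta>\<^sub>0 \<le> \<bar>x0 $ i\<bar>" for i using exhaust_2[of i] by (auto simp: \<delta>\<^sub>0_def)
  qed
  define L where "L = K / h1 * (weight \<alpha> x0 * H w) * rmin\<^sup>2 / 16"
  have L: "0 < L" using K(1) h1(1) weight_pos[OF x0(1)] w(2) rmin_pos by (simp add: L_def)
  have "L * \<delta> powr (- s) \<le> real (covering_number (X v) \<delta>)" if \<delta>: "0 < \<delta>" "\<delta> < \<delta>\<^sub>0" for \<delta>
  proof -
    obtain \<C> where C: "finite \<C>" "card \<C> = covering_number (X v) \<delta>" "X v \<subseteq> \<Union>\<C>"
      "\<And>U. U \<in> \<C> \<Longrightarrow> bounded U" "\<And>U. U \<in> \<C> \<Longrightarrow> diameter U \<le> \<delta>"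
      using optimal_cover[OF compact_X[OF v] \<delta>(1)] by metis
    define u where "u U = (SOME z. z \<in> U)" for U :: "(real^2) set"
    have u: "u U \<in> U" if "U \<noteq> {}" for U using that some_in_eq unfolding u_def by blast
    obtain n where n: "rmax ^ n < \<delta>" using real_arch_pow_inv[OF \<delta>(1) rmax_less_1] by blast
    have "rmax ^ n * \<bar>x0 $ 1\<bar> \<le> rmax ^ n * 1"
      using x0(1) rmax_pos by (intro mult_left_mono) (auto simp: scales_def)
    then have ex: "\<exists>i. rmax ^ n * \<bar>x0 $ i\<bar> \<le> \<delta>" using n by (intro exI[of _ 1]) simp
    have lo: "rmin * \<delta> \<le> \<bar>x0 $ i\<bar>" for i
    proof -
      have "rmin * \<delta> \<le> 1 * \<delta>" using rmin_less_1 \<delta> by (intro mult_right_mono) auto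
      then show ?thesis using \<delta>(2) \<delta>0(2)[of i] by simp
    qed
    have "K / h1 * \<delta> powr (- s) * (weight \<alpha> x0 * H w) * (rmin * \<delta>)\<^sup>2 \<le> (\<Sum>U\<in>\<C>. clip_area \<delta> (u U) x0 q0)"
      using C u x0(2) by (intro claim[OF w(1) x0(1) \<delta>(1) lo ex]) blast+
    also have "\<dots> \<le> (\<Sum>U\<in>\<C>. 16 * \<delta>\<^sup>2)" using \<delta> x0(1) by (intro sum_mono clip_area_le) auto
    also have "\<dots> = (16 * \<delta>\<^sup>2) * real (covering_number (X v) \<delta>)" using C(2) by simp
    finally have "(16 * \<delta>\<^sup>2) * (L * \<delta> powr (- s)) \<le> (16 * \<delta>\<^sup>2) * real (covering_number (X v) \<delta>)"
      by (simp add: L_def power_mult_distrib algebra_simps)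
    moreover have "0 < 16 * \<delta>\<^sup>2" using \<delta>(1) by simp
    ultimately show ?thesis using mult_le_cancel_left_pos by blast
  qed
  then show ?thesis using L \<delta>0(1) unfolding s_def by blast
qed

end

section \<open>The critical exponents\<close>

lemma root_of_exponentially_decreasing:
  fixes \<phi> :: "real \<Rightarrow> real"
  assumes ab: "0 < a" "b < 1" "0 < b"
    and pos: "\<And>s. 0 < \<phi> s"
    and lo: "\<And>s r. 0 \<le> r \<Longrightarrow> a powr r * \<phi> s \<le> \<phi> (s + r)"
    and hi: "\<And>s r. 0 \<le> r \<Longrightarrow> \<phi> (s + r) \<le> b powr r * \<phi> s"
  obtains \<gamma> where "\<phi> \<gamma> = 1" "\<And>s. \<gamma> < s \<Longrightarrow> \<phi> s < 1" "\<And>s. s < \<gamma> \<Longrightarrow> 1 < \<phi> s"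
proof -
  have decr: "\<phi> r < \<phi> s" if "s < r" for s r
  proof -
    have "\<phi> r \<le> b powr (r - s) * \<phi> s" using hi[of "r - s" s] that by simp
    also have "b powr (r - s) < 1 powr (r - s)" using that ab by (intro powr_less_mono2) auto
    then have "b powr (r - s) * \<phi> s < 1 * \<phi> s" using pos by (intro mult_strict_right_mono) auto
    finally show ?thesis by simp
  qed
  have le: "\<phi> r \<le> \<phi> s" if "s \<le> r" for s r using decr[of s r] that by (cases "s = r") auto
  have cont: "isCont \<phi> s" for s
  proof -
    have l: "\<phi> s * min 1 (a powr (r - s)) \<le> \<phi> r" for r
    proof (cases "s \<le> r")
      case True
      then have "a powr (r - s) * \<phi> s \<le> \<phi> r" using lo[of "r - s" s] by simp
      moreover have "\<phi> s * min 1 (a powr (r - s)) \<le> \<phi> s * a powr (r - s)"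
        using pos[of s] by (intro mult_left_mono) auto
      ultimately show ?thesis by (simp add: mult.commute)
    next
      case False
      have "\<phi> s * min 1 (a powr (r - s)) \<le> \<phi> s * 1" using pos[of s] by (intro mult_left_mono) auto
      also have "\<dots> \<le> \<phi> r" using le[of r s] False by simp
      finally show ?thesis .
    qed
    have u: "\<phi> r \<le> \<phi> s * max 1 (a powr (r - s))" for r
    proof (cases "s \<le> r")
      case True
      have "\<phi> r \<le> \<phi> s * 1" using le[OF True] by simp
      also have "\<dots> \<le> \<phi> s * max 1 (a powr (r - s))" using pos[of s] by (intro mult_left_mono) auto
      finally show ?thesis .
    next
      case False
      then have "a powr (s - r) * \<phi> r \<le> \<phi> s" using lo[of "s - r" r] by simp
      then have "a powr (r - s) * (a powr (s - r) * \<phi> r) \<le> a powr (r - s) * \<phi> s"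
        by (intro mult_left_mono) auto
      moreover have "a powr (r - s) * (a powr (s - r) * \<phi> r) = \<phi> r"
        using ab(1) by (simp flip: powr_add mult.assoc)
      ultimately have "\<phi> r \<le> \<phi> s * a powr (r - s)" by (simp only: mult.commute)
      also have "\<dots> \<le> \<phi> s * max 1 (a powr (r - s))" using pos[of s] by (intro mult_left_mono) auto
      finally show ?thesis .
    qed
    have p: "((\<lambda>r. a powr (r - s)) \<longlongrightarrow> a powr (s - s)) (at s)"
      using ab(1) by (intro tendsto_intros) auto
    have "((\<lambda>r. \<phi> s * min 1 (a powr (r - s))) \<longlongrightarrow> \<phi> s * min 1 (a powr (s - s))) (at s)"
      by (intro tendsto_mult tendsto_min tendsto_const p)
    moreover have "((\<lambda>r. \<phi> s * max 1 (a powr (r - s))) \<longlongrightarrow> \<phi> s * max 1 (a powr (s - s))) (at s)"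
      by (intro tendsto_mult tendsto_max tendsto_const p)
    ultimately have "(\<phi> \<longlongrightarrow> \<phi> s) (at s)"
      using l u ab(1) by (intro tendsto_sandwich[of "\<lambda>r. \<phi> s * min 1 (a powr (r - s))" \<phi> _
        "\<lambda>r. \<phi> s * max 1 (a powr (r - s))"]) auto
    then show ?thesis by (simp add: isCont_def)
  qed
  \<comment> \<open>Chosen such that \<open>b powr R\<close> is at most both \<open>\<phi> 0\<close> and its reciprocal.\<close>
  define R where "R = \<bar>ln (\<phi> 0)\<bar> / (- ln b)"
  have lb: "ln b < 0" using ab by simp
  have R: "0 \<le> R" "b powr R = exp (- \<bar>ln (\<phi> 0)\<bar>)"
  proof -
    show "0 \<le> R" unfolding R_def by (rule divide_nonneg_pos) (use lb in auto)
    show "b powr R = exp (- \<bar>ln (\<phi> 0)\<bar>)" using lb ab by (simp add: R_def powr_def)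
  qed
  have "\<phi> R \<le> b powr R * \<phi> 0" using hi[OF R(1), of 0] by simp
  also have "\<dots> = exp (- \<bar>ln (\<phi> 0)\<bar> + ln (\<phi> 0))" unfolding R(2) exp_add using pos by simp
  also have "\<dots> \<le> 1" by simp
  finally have 1: "\<phi> R \<le> 1" .
  have "\<phi> 0 \<le> b powr R * \<phi> (- R)" using hi[OF R(1), of "- R"] by simp
  then have "exp (ln (\<phi> 0)) \<le> exp (- \<bar>ln (\<phi> 0)\<bar>) * \<phi> (- R)" unfolding R(2) using pos by simp
  moreover have "exp (- \<bar>ln (\<phi> 0)\<bar>) * 1 \<le> exp (ln (\<phi> 0))" by simp
  ultimately have "exp (- \<bar>ln (\<phi> 0)\<bar>) * 1 \<le> exp (- \<bar>ln (\<phi> 0)\<bar>) * \<phi> (- R)" by (rule order_trans[rotated])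
  then have 2: "1 \<le> \<phi> (- R)" using mult_le_cancel_left_pos[OF exp_gt_zero] by blast
  obtain \<gamma> where \<gamma>: "\<phi> \<gamma> = 1"
    using IVT2'[where f = \<phi> and a = "- R" and b = R and y = 1] 1 2 R(1) continuous_at_imp_continuous_on[of "{- R..R}" \<phi>] cont by auto
  then show ?thesis using that[OF \<gamma>] decr by metis
qed


context box_carpet
begin

lemma expo_root:
  obtains \<gamma> where "\<rho> (expo k \<gamma>) = 1" "\<And>s. \<gamma> < s \<Longrightarrow> \<rho> (expo k s) < 1" "\<And>s. s < \<gamma> \<Longrightarrow> 1 < \<rho> (expo k s)"
proof (rule root_of_exponentially_decreasing[of rmin rmax "\<lambda>s. \<rho> (expo k s)"])
  fix s r :: real assume r: "0 \<le> r"
  define d where "d i = (if i = k then 0 else r)" for i :: 2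
  have d: "expo k (s + r) = (\<lambda>i. expo k s i + d i)" "\<And>i. 0 \<le> d i" "d 1 + d 2 = r"
    using r exhaust_2[of k] by (auto simp: expo_def d_def)
  show "rmin powr r * \<rho> (expo k s) \<le> \<rho> (expo k (s + r))" "\<rho> (expo k (s + r)) \<le> rmax powr r * \<rho> (expo k s)"
    using rho_shift[of d "expo k s", OF d(2)] unfolding d(1,3) by auto
qed (use rmin_pos rmax_pos rmax_less_1 rho_pos that in auto)

definition crit :: "2 \<Rightarrow> real" where
  "crit k = (THE \<gamma>. \<rho> (expo k \<gamma>) = 1)"

lemma crit: "\<rho> (expo k (crit k)) = 1" "crit k < s \<Longrightarrow> \<rho> (expo k s) < 1" "s < crit k \<Longrightarrow> 1 < \<rho> (expo k s)"
proof -
  obtain \<gamma> where \<gamma>: "\<rho> (expo k \<gamma>) = 1" "\<And>s. \<gamma> < s \<Longrightarrow> \<rho> (expo k s) < 1" "\<And>s. s < \<gamma> \<Longrightarrow> 1 < \<rho> (expo k s)"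
    using expo_root[of k] by metis
  have "crit k = \<gamma>"
    unfolding crit_def
  proof (rule the_equality)
    show "\<rho> (expo k \<gamma>) = 1" by (rule \<gamma>(1))
    show "s = \<gamma>" if "\<rho> (expo k s) = 1" for s
      using \<gamma>(2)[of s] \<gamma>(3)[of s] that by (cases s \<gamma> rule: linorder_cases) auto
  qed
  then show "\<rho> (expo k (crit k)) = 1" "crit k < s \<Longrightarrow> \<rho> (expo k s) < 1" "s < crit k \<Longrightarrow> 1 < \<rho> (expo k s)"
    using \<gamma> by auto
qed

lemma gamma_A_eq: "gamma_A G T (axis_dim 1) = crit 1"
  by (simp add: gamma_A_def crit_def \<rho>_def expo_def)

lemma gamma_B_eq: "gamma_B G T (axis_dim 2) = crit 2"
  by (simp add: gamma_B_def crit_def \<rho>_def expo_def)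

text \<open>
  Otherwise \<open>\<eta> > 0\<close> can be chosen so that the spectral radius is still at least 1 after both
  exponents are raised by \<open>\<eta>\<close>. The lower bound then gives the exponent \<open>axis_dim 1 + axis_dim 2 + \<eta>\<close>
  up to \<open>\<eta>/4\<close>, whereas the carpet lies in the product of its projections.
\<close>

lemma rho_axis_dim_le_1: "\<rho> axis_dim \<le> 1"
proof (rule ccontr)
  assume "\<not> ?thesis"
  then have gt: "1 < \<rho> axis_dim" by simp
  obtain v where v: "v \<in> verts G" using verts_nonempty by auto
  have ln: "ln rmin < 0" using rmin_pos rmin_less_1 by simp
  \<comment> \<open>The solution of \<open>rmin powr (2 * \<eta>) * \<rho> axis_dim = 1\<close>.\<close>
  define \<eta> where "\<eta> = ln (\<rho> axis_dim) / (- 2 * ln rmin)"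
  have \<eta>: "0 < \<eta>" unfolding \<eta>_def by (rule divide_pos_pos) (use gt ln in simp_all)
  have "(\<eta> + \<eta>) * ln rmin = - ln (\<rho> axis_dim)" using ln by (simp add: \<eta>_def field_simps)
  then have "rmin powr (\<eta> + \<eta>) = exp (- ln (\<rho> axis_dim))" using rmin_pos by (simp add: powr_def)
  then have "rmin powr (\<eta> + \<eta>) * \<rho> axis_dim = 1" using gt by (simp add: exp_minus)
  then have "1 \<le> \<rho> (\<lambda>i. axis_dim i + \<eta>)"
    using rho_shift(1)[of "\<lambda>_. \<eta>" axis_dim] \<eta> by simp
  from covering_number_X_lower[OF this _ _ _ v, of \<eta> "\<eta>/4"] \<eta>
  obtain K \<delta>\<^sub>0 where K: "0 < K" "0 < \<delta>\<^sub>0" "\<And>\<delta>. 0 < \<delta> \<Longrightarrow> \<delta> < \<delta>\<^sub>0 \<Longrightarrow>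
      K * \<delta> powr (- ((axis_dim 1 + \<eta>) + (axis_dim 2 + \<eta>) - \<eta> - \<eta>/4)) \<le> real (covering_number (X v) \<delta>)"
    by auto
  from covering_number_X_trivial_upper[OF _ v, of "\<eta>/4"] \<eta>
  obtain C where C: "0 < C" "\<And>\<delta>. 0 < \<delta> \<Longrightarrow> \<delta> \<le> 1 \<Longrightarrow>
      real (covering_number (X v) (2 * \<delta>)) \<le> C * \<delta> powr (- (axis_dim 1 + axis_dim 2) - 2 * (\<eta>/4))"
    by auto
  have "axis_dim 1 + axis_dim 2 + 3/4 * \<eta> \<le> axis_dim 1 + axis_dim 2 + \<eta>/2"
  proof (rule exponent_le_of_power_le[OF K(1), of "min \<delta>\<^sub>0 1"])
    fix \<delta> :: real assume \<delta>: "0 < \<delta>" "\<delta> < min \<delta>\<^sub>0 1"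
    have "K * \<delta> powr (- (axis_dim 1 + axis_dim 2 + 3/4 * \<eta>)) \<le> real (covering_number (X v) \<delta>)"
      using K(3)[of \<delta>] \<delta> by (simp add: algebra_simps)
    also have "\<dots> \<le> C * (\<delta>/2) powr (- (axis_dim 1 + axis_dim 2 + \<eta>/2))"
      using C(2)[of "\<delta>/2"] \<delta> by (simp add: algebra_simps)
    also have "\<dots> = C * (1/2) powr (- (axis_dim 1 + axis_dim 2 + \<eta>/2)) * \<delta> powr (- (axis_dim 1 + axis_dim 2 + \<eta>/2))"
      using \<delta> powr_mult[of "1/2" \<delta> "- (axis_dim 1 + axis_dim 2 + \<eta>/2)"] by simp
    finally show "K * \<delta> powr (- (axis_dim 1 + axis_dim 2 + 3/4 * \<eta>)) \<le>
      C * (1/2) powr (- (axis_dim 1 + axis_dim 2 + \<eta>/2)) * \<delta> powr (- (axis_dim 1 + axis_dim 2 + \<eta>/2))" .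
  qed (use K in auto)
  then show False using \<eta> by simp
qed

text \<open>
  At \<open>s = axis_dim 1 + axis_dim 2\<close> both transfer matrices are the one with exponents
  \<open>axis_dim 1\<close> and \<open>axis_dim 2\<close>.
\<close>

lemma crit_le: "crit k \<le> axis_dim 1 + axis_dim 2"
proof (rule ccontr)
  assume "\<not> ?thesis"
  then have "1 < \<rho> (expo k (axis_dim 1 + axis_dim 2))" by (intro crit(3)) simp
  moreover have "expo k (axis_dim 1 + axis_dim 2) = axis_dim"
  proof
    show "expo k (axis_dim 1 + axis_dim 2) i = axis_dim i" for i
      using exhaust_2[of i] exhaust_2[of k] by (auto simp: expo_def)
  qed
  ultimately show False using rho_axis_dim_le_1 by simp
qed

lemma has_box_dimension_X:
  assumes v: "v \<in> verts G"
  shows "has_box_dimension (X v) (max (crit 1) (crit 2))"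
proof (rule has_box_dimensionI[OF compact_X[OF v] X_nonempty[OF v]])
  let ?d = "max (crit 1) (crit 2)"
  fix s assume s: "?d < s"
  define s' where "s' = (?d + s) / 2"
  have s': "?d < s'" "0 < s - s'" using s by (auto simp: s'_def)
  have "\<rho> (expo k s') < 1" for k using s'(1) exhaust_2[of k] by (intro crit(2)) auto
  from covering_number_X_upper[OF this s'(2)] v obtain K where
    K: "0 < K" "\<And>\<delta>. 0 < \<delta> \<Longrightarrow> \<delta> \<le> 1 \<Longrightarrow> real (covering_number (X v) (2 * \<delta>)) \<le> K * \<delta> powr (- s' - (s - s'))"
    by blast
  have "real (covering_number (X v) \<delta>) \<le> (K * (1/2) powr (- s)) * \<delta> powr (- s)" if \<delta>: "0 < \<delta>" "\<delta> < 1" for \<delta>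
    using K(2)[of "\<delta>/2"] \<delta> powr_mult[of "1/2" \<delta> "- s"] by simp
  then have "\<forall>\<^sub>F \<delta> in at_right 0. real (covering_number (X v) \<delta>) \<le> (K * (1/2) powr (- s)) * \<delta> powr (- s)"
    unfolding eventually_at_right_field by (intro exI[of _ 1]) auto
  moreover have "0 < K * (1/2) powr (- s)" using K(1) by simp
  ultimately show "\<exists>K>0. \<forall>\<^sub>F \<delta> in at_right 0. real (covering_number (X v) \<delta>) \<le> K * \<delta> powr (- s)"
    by blast
next
  fix s assume "s < max (crit 1) (crit 2)"
  then obtain k where k: "s < crit k" by (auto simp: less_max_iff_disj)
  have le: "expo k (crit k) i \<le> axis_dim i + 0" for i
    using crit_le[of k] exhaust_2[of i] exhaust_2[of k] by (auto simp: expo_def)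
  have sum: "expo k (crit k) 1 + expo k (crit k) 2 - 0 - (crit k - s) = s"
    using exhaust_2[of k] by (auto simp: expo_def)
  have "\<exists>K>0. \<exists>\<delta>\<^sub>0>0. \<forall>\<delta>. 0 < \<delta> \<and> \<delta> < \<delta>\<^sub>0 \<longrightarrow>
      K * \<delta> powr (- (expo k (crit k) 1 + expo k (crit k) 2 - 0 - (crit k - s))) \<le> real (covering_number (X v) \<delta>)"
    using crit(1)[of k] k by (intro covering_number_X_lower le v) auto
  then show "\<exists>K>0. \<forall>\<^sub>F \<delta> in at_right 0. K * \<delta> powr (- s) \<le> real (covering_number (X v) \<delta>)"
    unfolding sum eventually_at_right_field by auto
qed

lemma tau_0_proj_measure:
  assumes "associated_vector G p" "measure_family G T t X p \<mu>" "v \<in> verts G"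
  shows "tau_0 (proj_measure i (\<mu> v)) = axis_dim i"
  unfolding tau_0_def measure_support_proj[OF assms]
  by (rule box_dimension_eq[OF has_box_dimension_proj_X[OF assms(3)]])

end

theorem corollary2p4:
  fixes G :: "('v, 'e) pre_digraph"
    and T :: "'e \<Rightarrow> real^2^2" and t :: "'e \<Rightarrow> real^2"
    and X :: "'v \<Rightarrow> (real^2) set"
    and p :: "'e \<Rightarrow> real" and \<mu> :: "'v \<Rightarrow> (real^2) measure"
    and u v :: 'v
  assumes "diagonal_box_like_gifs G T"
    and "strongly_conn G"
    and "rosc G T t"
    and "carpet_family G T t X"
    and "associated_vector G p"
    and "measure_family G T t X p \<mu>"
    and "u \<in> verts G"
    and "v \<in> verts G"
  shows "has_box_dimension (X v)
           (max (gamma_A G T (tau_0 (proj_measure 1 (\<mu> u))))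
                (gamma_B G T (tau_0 (proj_measure 2 (\<mu> u)))))"
proof -
  interpret box_carpet G T t X
    using assms(1-4,7) by unfold_locales auto
  show ?thesis
    unfolding tau_0_proj_measure[OF assms(5-7)] gamma_A_eq gamma_B_eq
    by (rule has_box_dimension_X[OF assms(8)])
qed

end
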